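(* Let $n,m,j,\delta$ and $f$ be as in the context, and let $\mathcal X$ be the surface constructed in the context. Then the induced map $f_{\mathcal X}:\mathcal X\to\mathcal X$ is an automorphism. The exceptional fibers are mapped according to: $$\Sigma_0\to\Sigma_0,\qquad \mathcal F^k_0\to\mathcal F^k_1\to\cdots\to\mathcal F^k_{n-1}\to\mathcal F^k_0\quad(k=1,2),$$ $$\Sigma_2\to\mathcal F^3_{0,1}\to\cdots\to\mathcal F^3_{n-1,1}\to\mathcal F^3_{0,2}\to\cdots\to\mathcal F^3_{n-1,2}\to\cdots\to\mathcal F^3_{0,m}\to\cdots\to\mathcal F^3_{n-1,m}\to\Sigma_1 .$$
   Context: Let $n,m$ be integers with either $n\ge4,\ m\ge1$, or $n=3,\ m\ge2$, and let $$\chi_{n,m}(t)=\frac{t(t^{nm}-1)(t^n-2t^{n-1}+1)}{(t^n-1)(t-1)}+1 .$$ Let $\delta$ be a root of $\chi_{n,m}$ with $|\delta|=1$ which is not a root of unity. Let $1\le j\le n-1$ with $\gcd(j,n)=1$, fix a square root $\sqrt\delta$, put $c=2\sqrt\delta\cos(j\pi/n)$, and $f(x,y)=(y,-\delta x+cy+y^{-1})$. Embed $\mathbf C^2\subset\mathbf P^2$ by $(x,y)\mapsto[1:x:y]$; then $f$ is the birational map $f[t:x:y]=[ty:y^2:-\delta xy+cy^2+t^2]$. Write $\Sigma_0=\{t=0\}$, $\Sigma_1=\{x=0\}$, $\Sigma_2=\{y=0\}$. Let $g(w)=c-\delta/w$, $\omega_s=g^{s-1}(c)$ for $1\le s\le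 n-1$ (so $\omega_{n-1}=0$), $p_0=[0:0:1]$ and $p_s=[0:1:\omega_s]$ for $1\le s\le n-1$. Let $L_0=\{x=0\}$ and $L_s=\{y=\omega_s x\}$ for $1\le s\le n-1$. Let $\mathcal X^1\to\mathbf P^2$ be the blowup of $p_0,\dots,p_{n-1}$ with exceptional fibers $\mathcal F^1_0,\dots,\mathcal F^1_{n-1}$. Let $\mathcal X^2\to\mathcal X^1$ be the blowup of the points $\mathcal F^1_s\cap L_s$ ($L_s$ replaced by its strict transform), $0\le s\le n-1$, with exceptional fibers $\mathcal F^2_s$. The induced birational map $f_{\mathcal X^2}$ contracts $\Sigma_2$ to a point of $\mathcal F^2_0$, and, because $\chi_{n,m}(\delta)=0$, the iterated images $f_{\mathcal X^2}^{i+1}\Sigma_2$, $0\le i\le nm-1$, are points with $f_{\mathcal X^2}^{i+1}\Sigma_2\in\mathcal F^2_{i\bmod n}$, the last one ($i=nm-1$) being the point $f_{\mathcal X^2}^{-1}\Sigma_1\in\mathcal F^2_{n-1}$ of indeterminacy. Let $\mathcal X=\mathcal X^3\to\mathcal X^2$ be the blowup of these $nm$ points; the exceptional fiber over $f_{\mathcal X^2}^{(\ell-1)n+s+1}\Sigma_2$ is denoted $\mathcal F^3_{s,\ell}$ ($0\le s\le n-1$, $1\le\ell\le m$). Strict transforms are denoted by the same symbols, and $f_{\mathcal X}$ is the map of $\mathcal X$ induced by $f$. *)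

theory Defs
  imports "HOL-Analysis.Analysis"
begin

section \<open>Complex surfaces, holomorphic maps and point blowups\<close>

text \<open>
  A local parametrization is a pair (D, psi) of an open set D of C^2 and an injective map psi from D
  onto an open set of the surface; its inverse is a coordinate chart.  A surface is a set of points
  together with a parametrization around each of them.  The topology and the complex structure are
  those of the resulting atlas.
\<close>

type_synonym 'a param = "(complex \<times> complex) set \<times> (complex \<times> complex \<Rightarrow> 'a)"

record 'a surf =
  pts :: "'a set"
  chart :: "'a \<Rightarrow> 'a param"

definition atlas :: "'a surf \<Rightarrow> 'a param set"
  where "atlas S = chart S ` pts S"

definition surf_open :: "'a surf \<Rightarrow> 'a set \<Rightarrow> bool"
  where "surf_open S V \<longleftrightarrow>
    V \<subseteq> pts S \<and> (\<forall>(D, \<psi>) \<in> atlas S. open {z \<in> D. \<psi> z \<in> V})"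

definition surf_top :: "'a surf \<Rightarrow> 'a topology"
  where "surf_top S = topology (surf_open S)"

lemma istopology_surf_open: "istopology (surf_open S)"
  unfolding istopology_def
proof (intro conjI allI impI)
  fix V W assume V: "surf_open S V" and W: "surf_open S W"
  have "open {z \<in> D. \<psi> z \<in> V \<inter> W}" if "(D, \<psi>) \<in> atlas S" for D \<psi>
  proof -
    have "open ({z \<in> D. \<psi> z \<in> V} \<inter> {z \<in> D. \<psi> z \<in> W})"
      using V W that unfolding surf_open_def by (intro open_Int) auto
    moreover have "{z \<in> D. \<psi> z \<in> V} \<inter> {z \<in> D. \<psi> z \<in> W} = {z \<in> D. \<psi> z \<in> V \<inter> W}"
      by auto
    ultimately show ?thesis by simp
  qed
  then show "surf_open S (V \<inter> W)"
    using V unfolding surf_open_def by auto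
next
  fix \<V> assume *: "\<forall>V\<in>\<V>. surf_open S V"
  have "open {z \<in> D. \<psi> z \<in> \<Union> \<V>}" if "(D, \<psi>) \<in> atlas S" for D \<psi>
  proof -
    have "open (\<Union>V\<in>\<V>. {z \<in> D. \<psi> z \<in> V})"
      using * that unfolding surf_open_def by (intro open_UN) auto
    moreover have "(\<Union>V\<in>\<V>. {z \<in> D. \<psi> z \<in> V}) = {z \<in> D. \<psi> z \<in> \<Union> \<V>}"
      by auto
    ultimately show ?thesis by simp
  qed
  then show "surf_open S (\<Union> \<V>)"
    using * unfolding surf_open_def by auto
qed

lemma openin_surf_top: "openin (surf_top S) V \<longleftrightarrow> surf_open S V"
  unfolding surf_top_def by (metis istopology_surf_open topology_inverse')

text \<open>Holomorphy in two variables: complex (Frechet) differentiability on an open set.\<close>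

definition holo2 :: "(complex \<times> complex) set \<Rightarrow> (complex \<times> complex \<Rightarrow> complex \<times> complex) \<Rightarrow> bool"
  where "holo2 U G \<longleftrightarrow> open U \<and>
    (\<forall>z\<in>U. \<exists>a b c d. (G has_derivative (\<lambda>(u, v). (a * u + b * v, c * u + d * v))) (at z))"

text \<open>
  Openness of the sets on which the coordinate expressions are defined is part of \<^const>\<open>holo2\<close>, so
  that continuity is included.
\<close>

definition holo_map :: "'a surf \<Rightarrow> 'a set \<Rightarrow> 'b surf \<Rightarrow> ('a \<Rightarrow> 'b) \<Rightarrow> bool"
  where "holo_map S N T F \<longleftrightarrow>
    openin (surf_top S) N \<and> F ` N \<subseteq> pts T \<and>
    (\<forall>(D, \<psi>) \<in> atlas S. \<forall>(E, \<eta>) \<in> atlas T.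
       holo2 {z \<in> D. \<psi> z \<in> N \<and> F (\<psi> z) \<in> \<eta> ` E} (\<lambda>z. inv_into E \<eta> (F (\<psi> z))))"

text \<open>
  The meromorphic self-map induced on S by a map f that is holomorphic on a dense open subset U of
  C^2, where \<iota> embeds C^2 into S as a dense open subset.  It is represented by its graph over the
  set of points at which it is regular: p is sent to q iff f extends holomorphically to a
  neighborhood of p with value q at p.
\<close>

definition induced_map ::
    "'a surf \<Rightarrow> (complex \<times> complex \<Rightarrow> 'a) \<Rightarrow> (complex \<times> complex) set
      \<Rightarrow> (complex \<times> complex \<Rightarrow> complex \<times> complex) \<Rightarrow> ('a \<times> 'a) set"
  where "induced_map S \<iota> U f =
    {(p, q). \<exists>N F. p \<in> N \<and> holo_map S N S F \<and>
       (\<forall>v\<in>U. \<iota> v \<in> N \<longrightarrow> F (\<iota> v) = \<iota> (f v)) \<and> F p = q}"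

definition is_automorphism :: "'a surf \<Rightarrow> ('a \<times> 'a) set \<Rightarrow> bool"
  where "is_automorphism S R \<longleftrightarrow>
    (\<exists>F. R = {(p, F p) |p. p \<in> pts S} \<and> bij_betw F (pts S) (pts S) \<and>
         holo_map S (pts S) S F \<and> holo_map S (pts S) S (inv_into (pts S) F))"

text \<open>
  Blowup of a finite set Z of points.  The exceptional fiber over p consists of the points
  \<open>Exc p d\<close>, where d is a tangent direction at p, written in the coordinates \<open>chart S p\<close>:
  \<open>Slope l\<close> is the direction of (1, l) and \<open>Vertical\<close> that of (0, 1).  Around a point
  \<open>Exc p d\<close> the usual coordinates (u, l) with (z1, z2) = (u, u l), or (l, v) with
  (z1, z2) = (l v, v), are used, (z1, z2) being the coordinates of S centered at p.
\<close>

datatype dir = Slope complex | Vertical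

datatype 'a bpt = Base 'a | Exc 'a dir

definition exc_fiber :: "'a set \<Rightarrow> 'a bpt set"
  where "exc_fiber Z = {Exc p d |p d. p \<in> Z}"

fun blowup_chart :: "'a surf \<Rightarrow> 'a set \<Rightarrow> 'a bpt \<Rightarrow> 'a bpt param" where
  "blowup_chart S Z (Base p) =
    (let (D, \<psi>) = chart S p in ({z \<in> D. \<psi> z \<notin> Z}, \<lambda>z. Base (\<psi> z)))"
| "blowup_chart S Z (Exc p (Slope _)) =
    (let (D, \<psi>) = chart S p; a = inv_into D \<psi> p; w = (\<lambda>(u, l). a + (u, u * l)) in
      ({z. w z \<in> D \<and> (fst z = 0 \<or> \<psi> (w z) \<notin> Z)},
       \<lambda>z. if fst z = 0 then Exc p (Slope (snd z)) else Base (\<psi> (w z))))"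
| "blowup_chart S Z (Exc p Vertical) =
    (let (D, \<psi>) = chart S p; a = inv_into D \<psi> p; w = (\<lambda>(l, v). a + (l * v, v)) in
      ({z. w z \<in> D \<and> (snd z = 0 \<or> \<psi> (w z) \<notin> Z)},
       \<lambda>z. if snd z = 0
            then Exc p (if fst z = 0 then Vertical else Slope (1 / fst z))
            else Base (\<psi> (w z))))"

definition blowup :: "'a surf \<Rightarrow> 'a set \<Rightarrow> 'a bpt surf"
  where "blowup S Z =
    \<lparr>pts = Base ` (pts S - Z) \<union> exc_fiber Z, chart = blowup_chart S Z\<rparr>"

definition strict_transform :: "'a surf \<Rightarrow> 'a set \<Rightarrow> 'a set \<Rightarrow> 'a bpt set"
  where "strict_transform S Z C = surf_top (blowup S Z) closure_of (Base ` (C - Z))"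


section \<open>The projective plane\<close>

text \<open>\<open>hom t x y\<close> is the point [t:x:y], as the punctured line through (t, x, y).\<close>

type_synonym p2 = "(complex \<times> complex \<times> complex) set"

definition hom :: "complex \<Rightarrow> complex \<Rightarrow> complex \<Rightarrow> p2"
  where "hom t x y = {(k * t, k * x, k * y) |k. k \<noteq> 0}"

definition P2 :: "p2 surf"
  where "P2 =
    \<lparr>pts = {hom t x y |t x y. (t, x, y) \<noteq> (0, 0, 0)},
     chart = (\<lambda>p.
       if \<exists>x y. p = hom 1 x y then (UNIV, \<lambda>(x, y). hom 1 x y)
       else if \<exists>y. p = hom 0 1 y then (UNIV, \<lambda>(t, y). hom t 1 y)
       else (UNIV, \<lambda>(t, x). hom t x 1))\<rparr>"

definition emb :: "complex \<times> complex \<Rightarrow> p2"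
  where "emb = (\<lambda>(x, y). hom 1 x y)"

definition Sigma0 :: "p2 set"
  where "Sigma0 = {hom 0 x y |x y. (x, y) \<noteq> (0, 0)}"

definition Sigma1 :: "p2 set"
  where "Sigma1 = {hom t 0 y |t y. (t, y) \<noteq> (0, 0)}"

definition Sigma2 :: "p2 set"
  where "Sigma2 = {hom t x 0 |t x. (t, x) \<noteq> (0, 0)}"


section \<open>The maps and the surfaces\<close>

text \<open>
  The quotient defining \<open>chi\<close> is a polynomial in t; it is only evaluated at points that are not
  roots of unity, where the denominator does not vanish.
\<close>

definition chi :: "nat \<Rightarrow> nat \<Rightarrow> complex \<Rightarrow> complex"
  where "chi n m t =
    t * (t ^ (n * m) - 1) * (t ^ n - 2 * t ^ (n - 1) + 1) / ((t ^ n - 1) * (t - 1)) + 1"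

definition root_of_unity :: "complex \<Rightarrow> bool"
  where "root_of_unity z \<longleftrightarrow> (\<exists>k\<ge>1. z ^ k = 1)"

definition fmap :: "complex \<Rightarrow> complex \<Rightarrow> complex \<times> complex \<Rightarrow> complex \<times> complex"
  where "fmap \<delta> c = (\<lambda>(x, y). (y, - \<delta> * x + c * y + 1 / y))"

definition fdom :: "(complex \<times> complex) set"
  where "fdom = {(x, y). y \<noteq> 0}"

definition omega :: "complex \<Rightarrow> complex \<Rightarrow> nat \<Rightarrow> complex"
  where "omega \<delta> c s = ((\<lambda>w. c - \<delta> / w) ^^ (s - 1)) c"

definition pnt :: "complex \<Rightarrow> complex \<Rightarrow> nat \<Rightarrow> p2"
  where "pnt \<delta> c s = (if s = 0 then hom 0 0 1 else hom 0 1 (omega \<delta> c s))"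

definition Lline :: "complex \<Rightarrow> complex \<Rightarrow> nat \<Rightarrow> p2 set"
  where "Lline \<delta> c s =
    (if s = 0 then Sigma1 else {hom t x (omega \<delta> c s * x) |t x. (t, x) \<noteq> (0, 0)})"

text \<open>
  Below, \<open>Zk\<close> is the center of the blowup \<open>Xk\<close> of the preceding surface.  Points obtained as
  intersections or as images of curves are represented by the corresponding singletons.
\<close>

definition Z1 :: "nat \<Rightarrow> complex \<Rightarrow> complex \<Rightarrow> p2 set"
  where "Z1 n \<delta> c = pnt \<delta> c ` {..<n}"

definition X1 :: "nat \<Rightarrow> complex \<Rightarrow> complex \<Rightarrow> p2 bpt surf"
  where "X1 n \<delta> c = blowup P2 (Z1 n \<delta> c)"

definition F1 :: "complex \<Rightarrow> complex \<Rightarrow> nat \<Rightarrow> p2 bpt set"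
  where "F1 \<delta> c s = exc_fiber {pnt \<delta> c s}"

definition F1_L :: "nat \<Rightarrow> complex \<Rightarrow> complex \<Rightarrow> nat \<Rightarrow> p2 bpt set"
  where "F1_L n \<delta> c s = F1 \<delta> c s \<inter> strict_transform P2 (Z1 n \<delta> c) (Lline \<delta> c s)"

definition Z2 :: "nat \<Rightarrow> complex \<Rightarrow> complex \<Rightarrow> p2 bpt set"
  where "Z2 n \<delta> c = (\<Union>s<n. F1_L n \<delta> c s)"

definition X2 :: "nat \<Rightarrow> complex \<Rightarrow> complex \<Rightarrow> p2 bpt bpt surf"
  where "X2 n \<delta> c = blowup (X1 n \<delta> c) (Z2 n \<delta> c)"

definition F2 :: "nat \<Rightarrow> complex \<Rightarrow> complex \<Rightarrow> nat \<Rightarrow> p2 bpt bpt set"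
  where "F2 n \<delta> c s = exc_fiber (F1_L n \<delta> c s)"

definition fX2 :: "nat \<Rightarrow> complex \<Rightarrow> complex \<Rightarrow> (p2 bpt bpt \<times> p2 bpt bpt) set"
  where "fX2 n \<delta> c =
    induced_map (X2 n \<delta> c) (\<lambda>v. Base (Base (emb v))) fdom (fmap \<delta> c)"

definition lift2 :: "nat \<Rightarrow> complex \<Rightarrow> complex \<Rightarrow> p2 set \<Rightarrow> p2 bpt bpt set"
  where "lift2 n \<delta> c C =
    strict_transform (X1 n \<delta> c) (Z2 n \<delta> c) (strict_transform P2 (Z1 n \<delta> c) C)"

text \<open>\<open>orbit n \<delta> c i\<close> is the (i+1)-st image of the strict transform of \<open>Sigma2\<close> in \<open>X2\<close>.\<close>

definition orbit :: "nat \<Rightarrow> complex \<Rightarrow> complex \<Rightarrow> nat \<Rightarrow> p2 bpt bpt set"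
  where "orbit n \<delta> c i = (fX2 n \<delta> c ^^ (i + 1)) `` lift2 n \<delta> c Sigma2"

definition Z3 :: "nat \<Rightarrow> nat \<Rightarrow> complex \<Rightarrow> complex \<Rightarrow> p2 bpt bpt set"
  where "Z3 n m \<delta> c = (\<Union>i<n * m. orbit n \<delta> c i)"

definition X3 :: "nat \<Rightarrow> nat \<Rightarrow> complex \<Rightarrow> complex \<Rightarrow> p2 bpt bpt bpt surf"
  where "X3 n m \<delta> c = blowup (X2 n \<delta> c) (Z3 n m \<delta> c)"

definition fX3 ::
    "nat \<Rightarrow> nat \<Rightarrow> complex \<Rightarrow> complex \<Rightarrow> (p2 bpt bpt bpt \<times> p2 bpt bpt bpt) set"
  where "fX3 n m \<delta> c =
    induced_map (X3 n m \<delta> c) (\<lambda>v. Base (Base (Base (emb v)))) fdom (fmap \<delta> c)"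

text \<open>The curves in \<open>X3\<close>; all but \<open>F3\<close> are strict transforms.\<close>

definition lift3 :: "nat \<Rightarrow> nat \<Rightarrow> complex \<Rightarrow> complex \<Rightarrow> p2 set \<Rightarrow> p2 bpt bpt bpt set"
  where "lift3 n m \<delta> c C = strict_transform (X2 n \<delta> c) (Z3 n m \<delta> c) (lift2 n \<delta> c C)"

definition F1_X3 :: "nat \<Rightarrow> nat \<Rightarrow> complex \<Rightarrow> complex \<Rightarrow> nat \<Rightarrow> p2 bpt bpt bpt set"
  where "F1_X3 n m \<delta> c s = strict_transform (X2 n \<delta> c) (Z3 n m \<delta> c)
    (strict_transform (X1 n \<delta> c) (Z2 n \<delta> c) (F1 \<delta> c s))"

definition F2_X3 :: "nat \<Rightarrow> nat \<Rightarrow> complex \<Rightarrow> complex \<Rightarrow> nat \<Rightarrow> p2 bpt bpt bpt set"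
  where "F2_X3 n m \<delta> c s = strict_transform (X2 n \<delta> c) (Z3 n m \<delta> c) (F2 n \<delta> c s)"

definition F3 :: "nat \<Rightarrow> complex \<Rightarrow> complex \<Rightarrow> nat \<Rightarrow> nat \<Rightarrow> p2 bpt bpt bpt set"
  where "F3 n \<delta> c s l = exc_fiber (orbit n \<delta> c ((l - 1) * n + s))"

end

theory Submission
  imports Defs
begin

text \<open>
  Every assertion of the theorem is local except for one, that the induced map is single-valued, and that
  follows from the Hausdorff property of a blowup together with the density of the affine plane
  (\<open>induced_map_unique\<close>).  So it suffices to describe a bijection of the points of the surface and to
  extend f, at each pair of corresponding points, to a local biholomorphism between them
  (\<open>automorphism_criterion\<close>).  The inverse then is holomorphic because the Jacobians do not vanish.

  Away from \<^const>\<open>Sigma2\<close> there is little to do.  In affine charts around [0:0:1] and [0:1:0] the map is the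
  polynomial automorphism (t, x) \<open>\<mapsto>\<close> (t, c - \<open>\<delta>\<close> x + \<open>t\<^sup>2\<close>) of the plane, from the complement of \<^const>\<open>Sigma2\<close>
  to the complement of \<^const>\<open>Sigma1\<close>.  It takes each center of the blowups over the complement of
  \<^const>\<open>Sigma2\<close> to the next one and preserves the line at infinity, so around the centers it has the form
  (u A, u B + v C).  A map of this form lifts to the blowup by explicit formulas (\<open>biholo_at_slope\<close>,
  \<open>biholo_at_vertical\<close>).  On the second exceptional fibers, where \<open>\<eta>\<close> is the second-order coordinate
  \<open>(w - omega) / t\<^sup>2\<close>, the lift is \<open>\<eta>\<close> \<open>\<mapsto>\<close> 1 + \<open>\<delta>\<close> \<open>\<eta>\<close>, and \<open>\<eta>\<close> \<open>\<mapsto>\<close> 1 - \<open>\<delta>\<close> \<open>\<eta>\<close> on the fibers that come from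
  or go to [0:0:1].

  Over \<^const>\<open>Sigma2\<close> and the last center [0:1:0] the map is worked out in coordinates.  The first two exceptional
  fibers over [0:1:0] go to those over [0:0:1].  The line \<^const>\<open>Sigma2\<close> is contracted to the point \<open>\<eta>\<close> = 1 on the
  second fiber over [0:0:1], and the only point of indeterminacy that is left is \<open>\<eta>\<close> = 1/\<open>\<delta>\<close> on the second
  fiber over [0:1:0].  Blowing up \<open>\<eta>\<close> = 1 undoes the contraction (\<open>biholo_line\<close>, \<open>biholo_F2_zero\<close>), and
  blowing up \<open>\<eta>\<close> = 1/\<open>\<delta>\<close> spreads the point out over \<^const>\<open>Sigma1\<close> (\<open>biholo_last_slope\<close>,
  \<open>biholo_last_vertical\<close>).

  It remains to see that the orbit of \<open>\<eta>\<close> = 1 reaches \<open>\<eta>\<close> = 1/\<open>\<delta>\<close> after n m points, and not before, and without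
  repetition.  Up to signs the orbit is \<open>eps (i + 1) = \<delta> eps i \<plusminus> 1\<close>, a linear recurrence with periodic
  inhomogeneity, for which \<open>eps (n m) = - chi n m \<delta>\<close> (\<open>eps_root\<close>); along a residue class modulo n it runs
  through a geometric progression, which does not repeat a value since \<open>\<delta>\<close> is not a root of unity
  (\<open>eps_inj\<close>).

  The curves are closures of their generic points, and an automorphism commutes with closures; so the
  assertions about curves reduce to the images of generic points (\<open>fX3_closure_image\<close>).
\<close>

section \<open>Complex differentiability in two variables\<close>

text \<open>
  The two partial derivatives are explicit numbers: the rules below then compute a Jacobian matrix
  at a point mechanically, and only its determinant has to be compared with 0.
\<close>

definition sder :: "(complex \<times> complex \<Rightarrow> complex) \<Rightarrow> complex \<times> complex \<Rightarrow> complex \<Rightarrow> complex \<Rightarrow> bool"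
  where "sder h z a b \<longleftrightarrow> (h has_derivative (\<lambda>x. a * fst x + b * snd x)) (at z)"

definition sdiff :: "(complex \<times> complex \<Rightarrow> complex) \<Rightarrow> complex \<times> complex \<Rightarrow> bool"
  where "sdiff h z \<longleftrightarrow> (\<exists>a b. sder h z a b)"

text \<open>
  The differentiability in the definition of \<^const>\<open>holo2\<close>, split into the two coordinates of the
  map (see \<open>cdiff_has_derivative\<close> below).
\<close>

definition cdiff :: "(complex \<times> complex \<Rightarrow> complex \<times> complex) \<Rightarrow> complex \<times> complex \<Rightarrow> bool"
  where "cdiff G z \<longleftrightarrow> sdiff (\<lambda>x. fst (G x)) z \<and> sdiff (\<lambda>x. snd (G x)) z"

definition nondeg :: "(complex \<times> complex \<Rightarrow> complex \<times> complex) \<Rightarrow> complex \<times> complex \<Rightarrow> bool"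
  where "nondeg G z \<longleftrightarrow> (\<exists>a b c d. sder (\<lambda>x. fst (G x)) z a b \<and> sder (\<lambda>x. snd (G x)) z c d \<and>
    a * d - b * c \<noteq> 0)"

lemma nondegI:
  "sder (\<lambda>x. fst (G x)) z a b \<Longrightarrow> sder (\<lambda>x. snd (G x)) z c d \<Longrightarrow> a * d - b * c \<noteq> 0 \<Longrightarrow> nondeg G z"
  unfolding nondeg_def by (intro exI conjI)

lemma sder_sdiff: "sder h z a b \<Longrightarrow> sdiff h z"
  by (auto simp: sdiff_def)

lemma sder_eq: "sder h z a b \<Longrightarrow> a = a' \<Longrightarrow> b = b' \<Longrightarrow> sder h z a' b'"
  by simp

lemma sder_const: "sder (\<lambda>x. k) z 0 0"
  by (auto simp: sder_def)

lemma sder_fst: "sder fst z 1 0"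
  unfolding sder_def by (auto intro!: derivative_eq_intros)

lemma sder_snd: "sder snd z 0 1"
  unfolding sder_def by (auto intro!: derivative_eq_intros)

lemma sder_add:
  "sder g z a b \<Longrightarrow> sder h z a' b' \<Longrightarrow> sder (\<lambda>x. g x + h x) z (a + a') (b + b')"
  unfolding sder_def by (auto intro!: derivative_eq_intros simp: algebra_simps)

lemma sder_diff:
  "sder g z a b \<Longrightarrow> sder h z a' b' \<Longrightarrow> sder (\<lambda>x. g x - h x) z (a - a') (b - b')"
  unfolding sder_def by (auto intro!: derivative_eq_intros simp: algebra_simps)

lemma sder_minus: "sder g z a b \<Longrightarrow> sder (\<lambda>x. - g x) z (- a) (- b)"
  unfolding sder_def by (auto intro!: derivative_eq_intros simp: algebra_simps)

lemma sder_mult: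
  "sder g z a b \<Longrightarrow> sder h z a' b' \<Longrightarrow>
    sder (\<lambda>x. g x * h x) z (g z * a' + a * h z) (g z * b' + b * h z)"
  unfolding sder_def by (auto intro!: derivative_eq_intros simp: algebra_simps)

lemma sder_power:
  "sder g z a b \<Longrightarrow>
    sder (\<lambda>x. g x ^ k) z (of_nat k * g z ^ (k - 1) * a) (of_nat k * g z ^ (k - 1) * b)"
  unfolding sder_def by (auto intro!: derivative_eq_intros simp: algebra_simps)

lemma sder_divide:
  "sder g z a b \<Longrightarrow> sder h z a' b' \<Longrightarrow> h z \<noteq> 0 \<Longrightarrow>
    sder (\<lambda>x. g x / h x) z ((a * h z - g z * a') / (h z)\<^sup>2) ((b * h z - g z * b') / (h z)\<^sup>2)"
  unfolding sder_def
  by (rule has_derivative_eq_rhs, rule has_derivative_divide', assumption+)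
    (simp add: fun_eq_iff power2_eq_square add_divide_distrib diff_divide_distrib algebra_simps)

lemma sder_compose:
  assumes "sder h (g1 z, g2 z) a b" "sder g1 z a1 b1" "sder g2 z a2 b2"
  shows "sder (\<lambda>x. h (g1 x, g2 x)) z (a * a1 + b * a2) (a * b1 + b * b2)"
proof -
  have "((\<lambda>x. (g1 x, g2 x)) has_derivative
      (\<lambda>x. (a1 * fst x + b1 * snd x, a2 * fst x + b2 * snd x))) (at z)"
    using assms(2,3) unfolding sder_def by (rule has_derivative_Pair)
  from has_derivative_compose[OF this assms(1)[unfolded sder_def]] show ?thesis
    unfolding sder_def by (rule has_derivative_eq_rhs) (auto simp: algebra_simps)
qed

named_theorems sdiff_intros

lemma sdiff_const [sdiff_intros]: "sdiff (\<lambda>x. k) z"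
  by (rule sder_sdiff[OF sder_const])

lemma sdiff_fst [sdiff_intros]: "sdiff fst z"
  by (rule sder_sdiff[OF sder_fst])

lemma sdiff_snd [sdiff_intros]: "sdiff snd z"
  by (rule sder_sdiff[OF sder_snd])

lemma sdiff_add [sdiff_intros]: "sdiff g z \<Longrightarrow> sdiff h z \<Longrightarrow> sdiff (\<lambda>x. g x + h x) z"
  unfolding sdiff_def by (elim exE, intro exI, rule sder_add)

lemma sdiff_diff [sdiff_intros]: "sdiff g z \<Longrightarrow> sdiff h z \<Longrightarrow> sdiff (\<lambda>x. g x - h x) z"
  unfolding sdiff_def by (elim exE, intro exI, rule sder_diff)

lemma sdiff_mult [sdiff_intros]: "sdiff g z \<Longrightarrow> sdiff h z \<Longrightarrow> sdiff (\<lambda>x. g x * h x) z"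
  unfolding sdiff_def by (elim exE, intro exI, rule sder_mult)

lemma sdiff_minus [sdiff_intros]: "sdiff g z \<Longrightarrow> sdiff (\<lambda>x. - g x) z"
  unfolding sdiff_def by (elim exE, intro exI, rule sder_minus)

lemma sdiff_power [sdiff_intros]: "sdiff g z \<Longrightarrow> sdiff (\<lambda>x. g x ^ k) z"
  unfolding sdiff_def by (elim exE, intro exI, rule sder_power)

lemma sdiff_divide [sdiff_intros]:
  "sdiff g z \<Longrightarrow> sdiff h z \<Longrightarrow> h z \<noteq> 0 \<Longrightarrow> sdiff (\<lambda>x. g x / h x) z"
  unfolding sdiff_def by (elim exE, intro exI, rule sder_divide)

lemma sdiff_compose:
  assumes "sdiff h (g1 z, g2 z)" "sdiff g1 z" "sdiff g2 z"
  shows "sdiff (\<lambda>x. h (g1 x, g2 x)) z"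
proof -
  obtain a b a1 b1 a2 b2 where "sder h (g1 z, g2 z) a b" "sder g1 z a1 b1" "sder g2 z a2 b2"
    using assms unfolding sdiff_def by auto
  then show ?thesis by (rule sder_sdiff[OF sder_compose])
qed

lemma cdiff_PairI [sdiff_intros]: "sdiff g z \<Longrightarrow> sdiff h z \<Longrightarrow> cdiff (\<lambda>x. (g x, h x)) z"
  by (simp add: cdiff_def)

lemma sdiff_compose_pair:
  assumes "sdiff h (G z)" "cdiff G z"
  shows "sdiff (\<lambda>x. h (G x)) z"
  using sdiff_compose[of h "\<lambda>x. fst (G x)" z "\<lambda>x. snd (G x)"] assms by (simp add: cdiff_def)

lemma cdiff_compose:
  assumes "cdiff H (G z)" "cdiff G z"
  shows "cdiff (\<lambda>x. H (G x)) z"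
  using assms sdiff_compose_pair[OF _ assms(2), of "\<lambda>x. fst (H x)"]
    sdiff_compose_pair[OF _ assms(2), of "\<lambda>x. snd (H x)"]
  unfolding cdiff_def by simp

lemma cdiff_has_derivative:
  "cdiff G z \<longleftrightarrow> (\<exists>a b c d. (G has_derivative (\<lambda>(u, v). (a * u + b * v, c * u + d * v))) (at z))"
    (is "?l \<longleftrightarrow> ?r")
proof
  assume ?l
  then obtain a b c d where 1: "sder (\<lambda>x. fst (G x)) z a b" "sder (\<lambda>x. snd (G x)) z c d"
    unfolding cdiff_def sdiff_def by blast
  have "((\<lambda>x. (fst (G x), snd (G x))) has_derivative
      (\<lambda>x. (a * fst x + b * snd x, c * fst x + d * snd x))) (at z)"
    using 1 unfolding sder_def by (rule has_derivative_Pair)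
  then show ?r unfolding case_prod_beta by auto
next
  assume ?r
  then obtain a b c d where
    *: "(G has_derivative (\<lambda>x. (a * fst x + b * snd x, c * fst x + d * snd x))) (at z)"
    unfolding case_prod_beta by blast
  show ?l
    using has_derivative_fst[OF *] has_derivative_snd[OF *]
    unfolding cdiff_def sdiff_def sder_def by auto
qed

lemma holo2_iff: "holo2 U G \<longleftrightarrow> open U \<and> (\<forall>z\<in>U. cdiff G z)"
  unfolding holo2_def cdiff_has_derivative by simp

lemma cdiff_isCont: "cdiff G z \<Longrightarrow> isCont G z"
  unfolding cdiff_has_derivative by (blast dest: has_derivative_continuous)

lemma sdiff_isCont: "sdiff h z \<Longrightarrow> isCont h z"
  unfolding sdiff_def sder_def by (blast dest: has_derivative_continuous)

lemma holo2_continuous_on: "holo2 U G \<Longrightarrow> continuous_on U G"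
  using cdiff_isCont continuous_at_imp_continuous_on unfolding holo2_iff by blast

lemma holo2_subset: "holo2 U G \<Longrightarrow> open V \<Longrightarrow> V \<subseteq> U \<Longrightarrow> holo2 V G"
  unfolding holo2_iff by blast

lemma holo2_open_preimage: "holo2 U G \<Longrightarrow> open V \<Longrightarrow> open {z \<in> U. G z \<in> V}"
  using continuous_open_preimage[OF holo2_continuous_on, of U G V]
  by (simp add: holo2_iff Int_def vimage_def)

lemma sder_transform:
  assumes "sder h z a b" "open A" "z \<in> A" "\<And>x. x \<in> A \<Longrightarrow> h x = k x"
  shows "sder k z a b"
  using assms has_derivative_transform_within_open unfolding sder_def by blast

lemma cdiff_transform:
  assumes "cdiff G z" "open A" "z \<in> A" "\<And>x. x \<in> A \<Longrightarrow> G x = H x"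
  shows "cdiff H z"
proof -
  have "sdiff (\<lambda>x. fst (H x)) z"
    using assms(1) sder_transform[OF _ assms(2,3), of "\<lambda>x. fst (G x)" _ _ "\<lambda>x. fst (H x)"] assms(4)
    unfolding cdiff_def sdiff_def by auto
  moreover have "sdiff (\<lambda>x. snd (H x)) z"
    using assms(1) sder_transform[OF _ assms(2,3), of "\<lambda>x. snd (G x)" _ _ "\<lambda>x. snd (H x)"] assms(4)
    unfolding cdiff_def sdiff_def by auto
  ultimately show ?thesis by (simp add: cdiff_def)
qed

text \<open>
  Injectivity makes a holomorphic map open, by invariance of domain, so its inverse is continuous;
  the inverse is then differentiable wherever the Jacobian does not vanish.
\<close>

lemma inverse_cdiff:
  assumes A: "holo2 A G" and inj: "inj_on G A" and z: "z \<in> A" and nd: "nondeg G z"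
  shows "open (G ` A)" "continuous_on (G ` A) (inv_into A G)" "cdiff (inv_into A G) (G z)"
proof -
  have opA: "open A" and cont: "continuous_on A G"
    using A holo2_continuous_on by (auto simp: holo2_iff)
  show op: "open (G ` A)" by (rule invariance_of_domain[OF cont opA inj])
  show ci: "continuous_on (G ` A) (inv_into A G)"
    by (rule continuous_on_inverse_open[OF opA cont]) (auto simp: inj)
  obtain a b c d where 1: "sder (\<lambda>x. fst (G x)) z a b" "sder (\<lambda>x. snd (G x)) z c d"
    and det: "a * d - b * c \<noteq> 0"
    using nd unfolding nondeg_def by blast
  define k where "k = a * d - b * c"
  have k: "k \<noteq> 0" using det k_def by simp
  let ?L = "\<lambda>x. (a * fst x + b * snd x, c * fst x + d * snd x)"
  let ?M = "\<lambda>x. ((d / k) * fst x + (- b / k) * snd x, (- c / k) * fst x + (a / k) * snd x)"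
  have der: "(G has_derivative ?L) (at z)"
    using has_derivative_Pair[OF 1[unfolded sder_def]] by simp
  have bl: "bounded_linear ?M"
    by (intro bounded_linear_Pair bounded_linear_add bounded_linear_const_mult
        bounded_linear_fst bounded_linear_snd)
  have "?M (?L x) = x" for x
  proof -
    have 1: "d / k * (a * fst x + b * snd x) + - b / k * (c * fst x + d * snd x) = fst x"
    proof -
      have "d * (a * fst x + b * snd x) - b * (c * fst x + d * snd x) = k * fst x"
        by (simp add: k_def algebra_simps)
      then show ?thesis using k by (simp add: divide_simps)
    qed
    have 2: "- c / k * (a * fst x + b * snd x) + a / k * (c * fst x + d * snd x) = snd x"
    proof -
      have "a * (c * fst x + d * snd x) - c * (a * fst x + b * snd x) = k * snd x"
        by (simp add: k_def algebra_simps)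
      then show ?thesis using k by (simp add: divide_simps)
    qed
    show ?thesis unfolding fst_conv snd_conv 1 2 by simp
  qed
  then have id: "?M \<circ> ?L = id" by (auto simp: fun_eq_iff)
  have "(inv_into A G has_derivative ?M) (at (G z))"
  proof (rule has_derivative_inverse_basic_x[OF der bl id _ _ op])
    show "continuous (at (G z)) (inv_into A G)"
      using ci op z by (simp add: continuous_on_eq_continuous_at)
    show "inv_into A G (G z) = z" using inj z by simp
    show "G z \<in> G ` A" using z by simp
    show "\<And>y. y \<in> G ` A \<Longrightarrow> G (inv_into A G y) = y" by (simp add: f_inv_into_f)
  qed
  then show "cdiff (inv_into A G) (G z)"
    unfolding cdiff_has_derivative case_prod_beta by blast
qed

section \<open>Complex surfaces\<close>

text \<open>
  The transition from P to Q is holomorphic near z.  In this local form transitions compose without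
  any bookkeeping of domains, and it suffices to describe them near each point.
\<close>

definition coord_change :: "'a param \<Rightarrow> 'a param \<Rightarrow> complex \<times> complex \<Rightarrow> bool"
  where "coord_change P Q z \<longleftrightarrow>
    (\<exists>A \<Phi>. z \<in> A \<and> A \<subseteq> fst P \<and> holo2 A \<Phi> \<and> (\<forall>x\<in>A. \<Phi> x \<in> fst Q \<and> snd Q (\<Phi> x) = snd P x))"

lemma coord_changeI:
  assumes "holo2 A \<Phi>" "z \<in> A" "A \<subseteq> fst P"
    "\<And>x. x \<in> A \<Longrightarrow> \<Phi> x \<in> fst Q" "\<And>x. x \<in> A \<Longrightarrow> snd Q (\<Phi> x) = snd P x"
  shows "coord_change P Q z"
  using assms unfolding coord_change_def by blast

lemma coord_changeE:
  assumes "coord_change P Q z"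
  obtains A \<Phi> where "holo2 A \<Phi>" "z \<in> A" "A \<subseteq> fst P"
    "\<forall>x\<in>A. \<Phi> x \<in> fst Q" "\<forall>x\<in>A. snd Q (\<Phi> x) = snd P x"
proof -
  from assms obtain A \<Phi> where *: "z \<in> A \<and> A \<subseteq> fst P \<and> holo2 A \<Phi> \<and>
      (\<forall>x\<in>A. \<Phi> x \<in> fst Q \<and> snd Q (\<Phi> x) = snd P x)"
    unfolding coord_change_def by (elim exE)
  show thesis by (rule that[of A \<Phi>]) (use * in simp_all)
qed

lemma coord_change_trans:
  assumes "coord_change P Q z"
    and "\<And>w. w \<in> fst Q \<Longrightarrow> snd Q w = snd P z \<Longrightarrow> coord_change Q R w"
  shows "coord_change P R z"
proof -
  obtain A \<Phi> where A: "holo2 A \<Phi>" "z \<in> A" "A \<subseteq> fst P"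
    and \<Phi>0: "\<forall>x\<in>A. \<Phi> x \<in> fst Q" "\<forall>x\<in>A. snd Q (\<Phi> x) = snd P x"
    using assms(1) by (rule coord_changeE)
    note \<Phi> = \<Phi>0[rule_format]
  have "coord_change Q R (\<Phi> z)" by (rule assms(2)[OF \<Phi>(1)[OF A(2)] \<Phi>(2)[OF A(2)]])
  then obtain B \<Psi> where B: "holo2 B \<Psi>" "\<Phi> z \<in> B" "B \<subseteq> fst Q"
    and \<Psi>0: "\<forall>x\<in>B. \<Psi> x \<in> fst R" "\<forall>x\<in>B. snd R (\<Psi> x) = snd Q x"
    by (rule coord_changeE)
    note \<Psi> = \<Psi>0[rule_format]
  \<comment> \<open>The composition lives where the first transition lands in the domain of the second.\<close>
  let ?C = "{x \<in> A. \<Phi> x \<in> B}"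
  have "open ?C" using holo2_open_preimage[OF A(1), of B] B(1) by (simp add: holo2_iff)
  moreover have "cdiff (\<lambda>x. \<Psi> (\<Phi> x)) x" if "x \<in> ?C" for x
    using that A(1) B(1) by (auto simp: holo2_iff intro: cdiff_compose[of \<Psi> \<Phi>])
  ultimately have "holo2 ?C (\<lambda>x. \<Psi> (\<Phi> x))" by (simp add: holo2_iff)
  then show ?thesis
    by (rule coord_changeI) (use A B \<Phi> \<Psi> in auto)
qed

text \<open>
  The parametrizations that are compatible with the atlas.  The atlas itself is too small for working
  with blowups: the chart chosen at a center need not be chosen at any other point (in the plane, the
  chart around [0:0:1] is not), and then its restriction to the complement of the centers is no chart
  of the blowup, although it is compatible with all of them.
\<close>

definition params :: "'a surf \<Rightarrow> 'a param set"
  where "params S = {P. open (fst P) \<and> inj_on (snd P) (fst P) \<and> snd P ` fst P \<subseteq> pts S \<and>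
    (\<forall>Q\<in>atlas S. (\<forall>z\<in>fst P. snd P z \<in> snd Q ` fst Q \<longrightarrow> coord_change P Q z) \<and>
      (\<forall>z\<in>fst Q. snd Q z \<in> snd P ` fst P \<longrightarrow> coord_change Q P z))}"

lemma params_open: "P \<in> params S \<Longrightarrow> open (fst P)"
  and params_inj: "P \<in> params S \<Longrightarrow> inj_on (snd P) (fst P)"
  by (simp_all add: params_def)

lemma params_pts: "P \<in> params S \<Longrightarrow> z \<in> fst P \<Longrightarrow> snd P z \<in> pts S"
  by (simp add: params_def image_subset_iff)

text \<open>
  The Hausdorff property is separated from the rest, since its proof for a blowup already uses that charts
  are open maps.
\<close>

locale complex_atlas =
  fixes S :: "'a surf"
  assumes chart_covers: "p \<in> pts S \<Longrightarrow> p \<in> snd (chart S p) ` fst (chart S p)"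
    and atlas_params: "P \<in> atlas S \<Longrightarrow> P \<in> params S"

locale complex_surface = complex_atlas +
  assumes Hausdorff: "Hausdorff_space (surf_top S)"

lemma openin_surf_iff:
  "openin (surf_top S) V \<longleftrightarrow>
    V \<subseteq> pts S \<and> (\<forall>P\<in>atlas S. open {z \<in> fst P. snd P z \<in> V})"
  unfolding openin_surf_top surf_open_def case_prod_beta ..

lemma holo_map_iff:
  "holo_map S N T F \<longleftrightarrow>
    openin (surf_top S) N \<and> F ` N \<subseteq> pts T \<and>
    (\<forall>P\<in>atlas S. \<forall>Q\<in>atlas T.
       holo2 {z \<in> fst P. snd P z \<in> N \<and> F (snd P z) \<in> snd Q ` fst Q}
         (\<lambda>z. inv_into (fst Q) (snd Q) (F (snd P z))))"
  unfolding holo_map_def case_prod_beta ..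

context complex_atlas
begin

lemma topspace_surf: "topspace (surf_top S) = pts S"
proof -
  have "{z \<in> fst P. snd P z \<in> pts S} = fst P" if "P \<in> atlas S" for P
    using params_pts[OF atlas_params[OF that]] by blast
  then have "openin (surf_top S) (pts S)"
    using params_open[OF atlas_params] by (simp add: openin_surf_iff)
  moreover have "openin (surf_top S) V \<Longrightarrow> V \<subseteq> pts S" for V
    by (simp add: openin_surf_iff)
  ultimately show ?thesis by (simp add: openin_subset subset_antisym)
qed

lemma chart_in_atlas: "p \<in> pts S \<Longrightarrow> chart S p \<in> atlas S"
  by (simp add: atlas_def)

lemma chartE:
  assumes "p \<in> pts S"
  obtains P z where "P \<in> atlas S" "z \<in> fst P" "snd P z = p"
  using chart_covers[OF assms] chart_in_atlas[OF assms] by (metis imageE)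

lemma params_change:
  assumes P: "P \<in> params S" and Q: "Q \<in> params S" and z: "z \<in> fst P" "snd P z \<in> snd Q ` fst Q"
  shows "coord_change P Q z"
proof -
  \<comment> \<open>Compatibility is only known for charts, so the transition goes through a chart around the point.\<close>
  obtain C x where C: "C \<in> atlas S" "x \<in> fst C" "snd C x = snd P z"
    using chartE[OF params_pts[OF P z(1)]] by blast
  then have "snd P z \<in> snd C ` fst C" by (metis imageI)
  then have "coord_change P C z" using P C(1) z(1) by (simp add: params_def)
  then show ?thesis
  proof (rule coord_change_trans)
    fix w assume "w \<in> fst C" "snd C w = snd P z"
    then show "coord_change C Q w" using Q C(1) z(2) by (simp add: params_def)
  qed
qed

lemma openin_chart_image:
  assumes P: "P \<in> params S" and V: "open V" "V \<subseteq> fst P"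
  shows "openin (surf_top S) (snd P ` V)"
  unfolding openin_surf_iff
proof (intro conjI ballI)
  show "snd P ` V \<subseteq> pts S" using V params_pts[OF P] by blast
  fix Q assume Q: "Q \<in> atlas S"
  show "open {z \<in> fst Q. snd Q z \<in> snd P ` V}"
    unfolding open_subopen[of "{z \<in> fst Q. snd Q z \<in> snd P ` V}"]
  proof
    fix z assume "z \<in> {z \<in> fst Q. snd Q z \<in> snd P ` V}"
    then obtain v where z: "z \<in> fst Q" and v: "v \<in> V" "snd Q z = snd P v" by blast
    have "coord_change Q P z"
      by (rule params_change[OF atlas_params[OF Q] P z]) (use v V in auto)
    then obtain A \<Phi> where A: "holo2 A \<Phi>" "z \<in> A" "A \<subseteq> fst Q"
      and \<Phi>0: "\<forall>x\<in>A. \<Phi> x \<in> fst P" "\<forall>x\<in>A. snd P (\<Phi> x) = snd Q x"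
      by (rule coord_changeE)
    note \<Phi> = \<Phi>0[rule_format]
    have "\<Phi> z = v"
      by (rule inj_onD[OF params_inj[OF P]]) (use \<Phi>[OF A(2)] v V in auto)
    then have "z \<in> {x \<in> A. \<Phi> x \<in> V}" using A v by simp
    moreover have "open {x \<in> A. \<Phi> x \<in> V}" using holo2_open_preimage[OF A(1) V(1)] .
    moreover have "{x \<in> A. \<Phi> x \<in> V} \<subseteq> {z \<in> fst Q. snd Q z \<in> snd P ` V}"
    proof
      fix x assume "x \<in> {x \<in> A. \<Phi> x \<in> V}"
      then have x: "x \<in> A" "\<Phi> x \<in> V" by auto
      then have "snd Q x = snd P (\<Phi> x)" using \<Phi>(2) by simp
      then show "x \<in> {z \<in> fst Q. snd Q z \<in> snd P ` V}" using x A(3) by blast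
    qed
    ultimately show "\<exists>T. open T \<and> z \<in> T \<and> T \<subseteq> {z \<in> fst Q. snd Q z \<in> snd P ` V}" by blast
  qed
qed

lemma open_chart_preimage:
  assumes P: "P \<in> params S" and V: "openin (surf_top S) V"
  shows "open {z \<in> fst P. snd P z \<in> V}"
  unfolding open_subopen[of "{z \<in> fst P. snd P z \<in> V}"]
proof
  fix z assume "z \<in> {z \<in> fst P. snd P z \<in> V}"
  then have z: "z \<in> fst P" "snd P z \<in> V" by auto
  obtain Q x where Q: "Q \<in> atlas S" "x \<in> fst Q" "snd Q x = snd P z"
    using chartE[OF params_pts[OF P z(1)]] by blast
  have "coord_change P Q z"
    by (rule params_change[OF P atlas_params[OF Q(1)] z(1)]) (use Q in force)
  then obtain A \<Phi> where A: "holo2 A \<Phi>" "z \<in> A" "A \<subseteq> fst P"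
    and \<Phi>: "\<forall>x\<in>A. \<Phi> x \<in> fst Q" "\<forall>x\<in>A. snd Q (\<Phi> x) = snd P x"
    by (rule coord_changeE)
  let ?W = "{x \<in> A. \<Phi> x \<in> {y \<in> fst Q. snd Q y \<in> V}}"
  have "open ?W"
    by (rule holo2_open_preimage[OF A(1)]) (use V Q(1) in \<open>simp add: openin_surf_iff\<close>)
  moreover have "z \<in> ?W" using A(2) \<Phi> z(2) by simp
  moreover have "?W \<subseteq> {z \<in> fst P. snd P z \<in> V}" using \<Phi>(2) A(3) by auto
  ultimately show "\<exists>T. open T \<and> z \<in> T \<and> T \<subseteq> {z \<in> fst P. snd P z \<in> V}" by blast
qed

lemma closure_of_chartI:
  assumes P: "P \<in> params S" and lim: "(g \<longlongrightarrow> z) (at (0::complex))" and z: "z \<in> fst P"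
    and ev: "eventually (\<lambda>h. snd P (g h) \<in> C) (at 0)"
  shows "snd P z \<in> surf_top S closure_of C"
  unfolding in_closure_of
proof (intro conjI allI impI)
  show "snd P z \<in> topspace (surf_top S)" using params_pts[OF P z] by (simp add: topspace_surf)
  fix V assume V: "snd P z \<in> V \<and> openin (surf_top S) V"
  have "eventually (\<lambda>h. g h \<in> {z \<in> fst P. snd P z \<in> V}) (at 0)"
    using lim open_chart_preimage[OF P] V z by (intro topological_tendstoD) auto
  with ev have "eventually (\<lambda>h. snd P (g h) \<in> C \<and> snd P (g h) \<in> V) (at 0)"
    by eventually_elim simp
  then show "\<exists>y. y \<in> C \<and> y \<in> V"
    using eventually_happens by fastforce
qed

end

context complex_surface
begin

lemma finite_closed: "finite Z \<Longrightarrow> Z \<subseteq> pts S \<Longrightarrow> openin (surf_top S) (pts S - Z)"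
  using Hausdorff_imp_t1_space[OF Hausdorff] unfolding t1_space_closedin_finite closedin_def
  by (simp add: topspace_surf)

end

text \<open>
  Preimages are computed chart by chart; the charts of the target cover it, so the preimage is a union
  of preimages under holomorphic maps between open subsets of the plane.
\<close>

lemma continuous_of_holo_map:
  assumes S: "complex_surface S" and T: "complex_surface T"
    and F: "holo_map S N T F" and W: "openin (surf_top T) W"
  shows "openin (surf_top S) {x \<in> N. F x \<in> W}"
  unfolding openin_surf_iff
proof (intro conjI ballI)
  interpret S: complex_surface S by fact
  interpret T: complex_surface T by fact
  have N: "openin (surf_top S) N" "F ` N \<subseteq> pts T" using F by (auto simp: holo_map_iff)
  then show "{x \<in> N. F x \<in> W} \<subseteq> pts S" by (auto simp: openin_surf_iff)
  fix P assume P: "P \<in> atlas S"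
  let ?D = "\<lambda>Q. {z \<in> fst P. snd P z \<in> N \<and> F (snd P z) \<in> snd Q ` fst Q}"
  let ?V = "\<lambda>Q. {z \<in> ?D Q. inv_into (fst Q) (snd Q) (F (snd P z)) \<in> {w \<in> fst Q. snd Q w \<in> W}}"
  have "open (\<Union>Q\<in>atlas T. ?V Q)"
  proof (intro open_UN ballI)
    fix Q assume Q: "Q \<in> atlas T"
    have "holo2 (?D Q) (\<lambda>z. inv_into (fst Q) (snd Q) (F (snd P z)))"
      using F P Q by (simp add: holo_map_iff)
    then show "open (?V Q)" by (rule holo2_open_preimage) (rule T.open_chart_preimage[OF T.atlas_params[OF Q] W])
  qed
  moreover have "{z \<in> fst P. snd P z \<in> {x \<in> N. F x \<in> W}} = (\<Union>Q\<in>atlas T. ?V Q)"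
  proof (intro set_eqI iffI)
    fix z assume z: "z \<in> {z \<in> fst P. snd P z \<in> {x \<in> N. F x \<in> W}}"
    then have "F (snd P z) \<in> pts T" using N by auto
    then obtain Q w where "Q \<in> atlas T" "w \<in> fst Q" "snd Q w = F (snd P z)"
      by (rule T.chartE)
    moreover from this have "F (snd P z) \<in> snd Q ` fst Q" by force
    ultimately show "z \<in> (\<Union>Q\<in>atlas T. ?V Q)"
      using z by (auto simp: f_inv_into_f inv_into_into intro!: bexI[of _ Q])
  qed (auto simp: f_inv_into_f)
  ultimately show "open {z \<in> fst P. snd P z \<in> {x \<in> N. F x \<in> W}}" by simp
qed

text \<open>
  A representation of F by \<open>\<Phi>\<close> in local coordinates.  Only continuity is asked of \<open>\<Phi>\<close>, because an
  inverse map is at first known to be differentiable at single points only.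
\<close>

definition holo_rep ::
    "'a surf \<Rightarrow> 'b surf \<Rightarrow> ('a \<Rightarrow> 'b) \<Rightarrow> 'a param \<Rightarrow> 'b param \<Rightarrow> (complex \<times> complex) set \<Rightarrow>
      (complex \<times> complex \<Rightarrow> complex \<times> complex) \<Rightarrow> bool"
  where "holo_rep S T F P Q A \<Phi> \<longleftrightarrow> P \<in> params S \<and> Q \<in> params T \<and> open A \<and> A \<subseteq> fst P \<and>
    continuous_on A \<Phi> \<and> \<Phi> ` A \<subseteq> fst Q \<and> (\<forall>x\<in>A. F (snd P x) = snd Q (\<Phi> x))"

text \<open>
  A map is holomorphic if around each point it has a representation, in any compatible parametrizations
  whatsoever, that is continuous and differentiable at that point: composition with the coordinate
  changes turns it into the expression in given charts.
\<close>

lemma holo_mapI: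
  assumes S: "complex_surface S" and T: "complex_surface T"
    and N: "openin (surf_top S) N"
    and loc: "\<And>p. p \<in> N \<Longrightarrow> \<exists>P Q A \<Phi> z. holo_rep S T F P Q A \<Phi> \<and> z \<in> A \<and> snd P z = p \<and> cdiff \<Phi> z"
  shows "holo_map S N T F"
  unfolding holo_map_iff
proof (intro conjI ballI)
  interpret S: complex_surface S by fact
  interpret T: complex_surface T by fact
  show "openin (surf_top S) N" by fact
  show "F ` N \<subseteq> pts T"
  proof clarify
    fix p assume "p \<in> N"
    then obtain P Q A \<Phi> z where "holo_rep S T F P Q A \<Phi>" "z \<in> A" "snd P z = p"
      using loc by blast
    then show "F p \<in> pts T"
      unfolding holo_rep_def by (metis params_pts image_subset_iff)
  qed
  fix P Q assume "P \<in> atlas S" and "Q \<in> atlas T"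
  then have P: "P \<in> params S" and Q: "Q \<in> params T"
    using S.atlas_params T.atlas_params by simp_all
  let ?D = "{z \<in> fst P. snd P z \<in> N \<and> F (snd P z) \<in> snd Q ` fst Q}"
  let ?H = "\<lambda>z. inv_into (fst Q) (snd Q) (F (snd P z))"
  have main: "\<exists>V. open V \<and> z \<in> V \<and> V \<subseteq> ?D \<and> cdiff ?H z" if z: "z \<in> ?D" for z
  proof -
    obtain P' Q' A \<Phi> y where rep: "holo_rep S T F P' Q' A \<Phi>"
      and y: "y \<in> A" "snd P' y = snd P z" "cdiff \<Phi> y"
      using loc[of "snd P z"] z by blast
    from rep have P': "P' \<in> params S" and Q': "Q' \<in> params T"
      and A: "y \<in> A" "snd P' y = snd P z" "open A" "A \<subseteq> fst P'"
      and \<Phi>: "continuous_on A \<Phi>" "cdiff \<Phi> y"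
        "\<And>x. x \<in> A \<Longrightarrow> \<Phi> x \<in> fst Q'" "\<And>x. x \<in> A \<Longrightarrow> F (snd P' x) = snd Q' (\<Phi> x)"
      using y unfolding holo_rep_def by auto
    have "snd P z \<in> snd P' ` fst P'" using A by (metis imageI subsetD)
    then have "coord_change P P' z" using S.params_change[OF P P'] z by blast
    then obtain B \<tau> where B: "holo2 B \<tau>" "z \<in> B" "B \<subseteq> fst P"
      and \<tau>0: "\<forall>x\<in>B. \<tau> x \<in> fst P'" "\<forall>x\<in>B. snd P' (\<tau> x) = snd P x"
      by (rule coord_changeE)
    note \<tau> = \<tau>0[rule_format]
    have \<tau>z: "\<tau> z = y"
      by (rule inj_onD[OF params_inj[OF P']]) (use \<tau>[OF B(2)] A in auto)
    have Fz: "F (snd P z) = snd Q' (\<Phi> y)" using \<Phi>(4)[OF A(1)] A(2) by simp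
    have "snd Q' (\<Phi> y) \<in> snd Q ` fst Q" using z Fz by auto
    then have "coord_change Q' Q (\<Phi> y)" using T.params_change[OF Q' Q] \<Phi>(3)[OF A(1)] by blast
    then obtain C \<sigma> where C: "holo2 C \<sigma>" "\<Phi> y \<in> C" "C \<subseteq> fst Q'"
      and \<sigma>0: "\<forall>x\<in>C. \<sigma> x \<in> fst Q" "\<forall>x\<in>C. snd Q (\<sigma> x) = snd Q' x"
      by (rule coord_changeE)
    note \<sigma> = \<sigma>0[rule_format]
    let ?A' = "A \<inter> \<Phi> -` C"
    have opA': "open ?A'" using \<Phi>(1) A(3) C(1) by (auto simp: holo2_iff intro: continuous_open_preimage)
    let ?V0 = "{x \<in> B. \<tau> x \<in> ?A'}"
    have "open {x \<in> B. \<tau> x \<in> ?A'}" using B(1) opA' by (rule holo2_open_preimage)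
    moreover have "open {x \<in> fst P. snd P x \<in> N}" by (rule S.open_chart_preimage[OF P N])
    ultimately have op: "open (?V0 \<inter> {x \<in> fst P. snd P x \<in> N})" by blast
    have eq: "F (snd P x) = snd Q (\<sigma> (\<Phi> (\<tau> x)))" "\<sigma> (\<Phi> (\<tau> x)) \<in> fst Q" if "x \<in> ?V0" for x
    proof -
      have x: "x \<in> B" "\<tau> x \<in> A" "\<Phi> (\<tau> x) \<in> C" using that by auto
      show "F (snd P x) = snd Q (\<sigma> (\<Phi> (\<tau> x)))"
        using \<tau>(2)[OF x(1)] \<Phi>(4)[OF x(2)] \<sigma>(2)[OF x(3)] by simp
      show "\<sigma> (\<Phi> (\<tau> x)) \<in> fst Q" using \<sigma>(1)[OF x(3)] .
    qed
    have zV: "z \<in> ?V0 \<inter> {x \<in> fst P. snd P x \<in> N}" using B(2) \<tau>z A(1) C(2) z by auto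
    have "cdiff (\<lambda>x. \<Phi> (\<tau> x)) z"
      using B \<Phi>(2) \<tau>z cdiff_compose[of \<Phi> \<tau> z] by (simp add: holo2_iff)
    then have "cdiff (\<lambda>x. \<sigma> (\<Phi> (\<tau> x))) z"
      using C \<tau>z cdiff_compose[of \<sigma> "\<lambda>x. \<Phi> (\<tau> x)" z] by (simp add: holo2_iff)
    then have "cdiff ?H z"
      by (rule cdiff_transform[OF _ op zV])
        (use eq params_inj[OF Q] in \<open>auto simp: inv_into_f_f\<close>)
    moreover have "?V0 \<inter> {x \<in> fst P. snd P x \<in> N} \<subseteq> ?D" using eq by auto
    ultimately show ?thesis using op zV by blast
  qed
  have "open ?D" unfolding open_subopen[of ?D] using main by blast
  then show "holo2 ?D ?H" unfolding holo2_iff using main by blast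
qed


section \<open>Meromorphic maps in local coordinates\<close>

text \<open>
  An extension of f, read through the embedding \<open>\<iota>\<close>, to a neighborhood of points at which f itself
  need not be defined.
\<close>

definition local_form ::
    "'a surf \<Rightarrow> (complex \<times> complex \<Rightarrow> 'a) \<Rightarrow> (complex \<times> complex) set \<Rightarrow>
      (complex \<times> complex \<Rightarrow> complex \<times> complex) \<Rightarrow> 'a param \<Rightarrow> 'a param \<Rightarrow>
      (complex \<times> complex) set \<Rightarrow> (complex \<times> complex \<Rightarrow> complex \<times> complex) \<Rightarrow> bool"
  where "local_form S \<iota> U f P Q A \<Phi> \<longleftrightarrow>
    P \<in> params S \<and> Q \<in> params S \<and> holo2 A \<Phi> \<and> A \<subseteq> fst P \<and> \<Phi> ` A \<subseteq> fst Q \<and>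
    (\<forall>z\<in>A. \<forall>v\<in>U. snd P z = \<iota> v \<longrightarrow> snd Q (\<Phi> z) = \<iota> (f v))"

text \<open>
  f extends to a local biholomorphism that takes p to q.
\<close>

definition biholo_at ::
    "'a surf \<Rightarrow> (complex \<times> complex \<Rightarrow> 'a) \<Rightarrow> (complex \<times> complex) set \<Rightarrow>
      (complex \<times> complex \<Rightarrow> complex \<times> complex) \<Rightarrow> 'a \<Rightarrow> 'a \<Rightarrow> bool"
  where "biholo_at S \<iota> U f p q \<longleftrightarrow>
    (\<exists>P Q A \<Phi> z. local_form S \<iota> U f P Q A \<Phi> \<and> z \<in> A \<and> p = snd P z \<and> q = snd Q (\<Phi> z) \<and> nondeg \<Phi> z)"

definition dense_in :: "'a surf \<Rightarrow> (complex \<times> complex \<Rightarrow> 'a) \<Rightarrow> (complex \<times> complex) set \<Rightarrow> bool"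
  where "dense_in S \<iota> U \<longleftrightarrow> (\<forall>V. openin (surf_top S) V \<longrightarrow> V \<noteq> {} \<longrightarrow> (\<exists>v\<in>U. \<iota> v \<in> V))"

context complex_surface
begin

lemma local_form_induced:
  assumes lf: "local_form S \<iota> U f P Q A \<Phi>" and z: "z \<in> A"
  shows "(snd P z, snd Q (\<Phi> z)) \<in> induced_map S \<iota> U f"
proof -
  have P: "P \<in> params S" and Q: "Q \<in> params S" and h: "holo2 A \<Phi>" and A: "A \<subseteq> fst P"
    and im: "\<Phi> ` A \<subseteq> fst Q"
    and f: "\<And>z v. z \<in> A \<Longrightarrow> v \<in> U \<Longrightarrow> snd P z = \<iota> v \<Longrightarrow> snd Q (\<Phi> z) = \<iota> (f v)"
    using lf unfolding local_form_def by simp_all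
  let ?F = "\<lambda>p. snd Q (\<Phi> (inv_into A (snd P) p))"
  have inj: "inj_on (snd P) A" using params_inj[OF P] A inj_on_subset by blast
  have F: "?F (snd P x) = snd Q (\<Phi> x)" if "x \<in> A" for x using inj that by simp
  have opA: "open A" using h by (simp add: holo2_iff)
  have "holo_map S (snd P ` A) S ?F"
  proof (rule holo_mapI[OF complex_surface_axioms complex_surface_axioms])
    show "openin (surf_top S) (snd P ` A)" using openin_chart_image[OF P opA A] .
    fix p assume "p \<in> snd P ` A"
    then obtain x where x: "x \<in> A" "snd P x = p" by blast
    have "holo_rep S S ?F P Q A \<Phi>"
      unfolding holo_rep_def using P Q opA A holo2_continuous_on[OF h] im F by simp
    moreover have "cdiff \<Phi> x" using h x(1) by (simp add: holo2_iff)
    ultimately show "\<exists>P Q A \<Phi> z. holo_rep S S ?F P Q A \<Phi> \<and> z \<in> A \<and> snd P z = p \<and> cdiff \<Phi> z"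
      using x by (intro exI conjI)
  qed
  moreover have "\<forall>v\<in>U. \<iota> v \<in> snd P ` A \<longrightarrow> ?F (\<iota> v) = \<iota> (f v)"
    using f F by force
  moreover have "?F (snd P z) = snd Q (\<Phi> z)" using F z .
  ultimately show ?thesis unfolding induced_map_def using z by blast
qed

text \<open>
  Two holomorphic extensions of the same map agree on a dense set, hence everywhere, because the
  surface is a Hausdorff space.
\<close>

lemma induced_map_unique:
  assumes dense: "dense_in S \<iota> U"
    and 1: "(p, q) \<in> induced_map S \<iota> U f" and 2: "(p, q') \<in> induced_map S \<iota> U f"
  shows "q = q'"
proof (rule ccontr)
  assume neq: "q \<noteq> q'"
  obtain N F where F: "p \<in> N" "holo_map S N S F" "\<And>v. v \<in> U \<Longrightarrow> \<iota> v \<in> N \<Longrightarrow> F (\<iota> v) = \<iota> (f v)"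
    "F p = q" using 1 unfolding induced_map_def by blast
  obtain N' F' where F': "p \<in> N'" "holo_map S N' S F'"
    "\<And>v. v \<in> U \<Longrightarrow> \<iota> v \<in> N' \<Longrightarrow> F' (\<iota> v) = \<iota> (f v)" "F' p = q'"
    using 2 unfolding induced_map_def by blast
  have "q \<in> topspace (surf_top S)" "q' \<in> topspace (surf_top S)"
    using F F' by (auto simp: holo_map_iff topspace_surf)
  then obtain W W' where W: "openin (surf_top S) W" "openin (surf_top S) W'" "q \<in> W" "q' \<in> W'"
    "disjnt W W'" using Hausdorff neq unfolding Hausdorff_space_def by blast
  let ?V = "{x \<in> N. F x \<in> W} \<inter> {x \<in> N'. F' x \<in> W'}"
  have "openin (surf_top S) ?V"
    using continuous_of_holo_map[OF complex_surface_axioms complex_surface_axioms F(2) W(1)]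
      continuous_of_holo_map[OF complex_surface_axioms complex_surface_axioms F'(2) W(2)]
    by (rule openin_Int)
  moreover have "p \<in> ?V" using F F' W by auto
  ultimately obtain v where v: "v \<in> U" "\<iota> v \<in> ?V" using dense unfolding dense_in_def by blast
  then have "\<iota> (f v) \<in> W" "\<iota> (f v) \<in> W'" using F(3)[of v] F'(3)[of v] by simp_all
  then show False using W(5) by (auto simp: disjnt_def)
qed

lemma biholo_at_induced: "biholo_at S \<iota> U f p q \<Longrightarrow> (p, q) \<in> induced_map S \<iota> U f"
  unfolding biholo_at_def by (elim exE conjE) (simp add: local_form_induced)

lemma induced_map_pts: "(p, q) \<in> induced_map S \<iota> U f \<Longrightarrow> p \<in> pts S \<and> q \<in> pts S"
  unfolding induced_map_def by (auto simp: holo_map_iff openin_surf_iff)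

text \<open>
  A contracted curve has a single image: the value at a point where the map is regular is the limit
  of the values at nearby points of the curve.
\<close>

lemma induced_map_closure:
  assumes dense: "dense_in S \<iota> U"
    and pq: "(p, q) \<in> induced_map S \<iota> U f" and p: "p \<in> surf_top S closure_of C"
    and C: "\<And>x. x \<in> C \<Longrightarrow> (x, q0) \<in> induced_map S \<iota> U f"
  shows "q = q0"
proof (rule ccontr)
  assume neq: "q \<noteq> q0"
  obtain N F where F: "p \<in> N" "holo_map S N S F" "\<And>v. v \<in> U \<Longrightarrow> \<iota> v \<in> N \<Longrightarrow> F (\<iota> v) = \<iota> (f v)"
    "F p = q" using pq unfolding induced_map_def by blast
  have "C \<noteq> {}" using p by auto
  then obtain x0 where "x0 \<in> C" by blast
  then have q0: "q0 \<in> pts S" using induced_map_pts[OF C] by simp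
  have "openin (surf_top S) {x \<in> N. F x \<in> pts S - {q0}}"
    by (rule continuous_of_holo_map[OF complex_surface_axioms complex_surface_axioms F(2)])
      (rule finite_closed, use q0 in auto)
  moreover have "p \<in> {x \<in> N. F x \<in> pts S - {q0}}"
    using F neq induced_map_pts[OF pq] by simp
  ultimately obtain x where x: "x \<in> C" "x \<in> N" "F x \<noteq> q0"
    using p unfolding in_closure_of by (metis (no_types, lifting) Diff_iff insertI1 mem_Collect_eq)
  have "\<forall>v\<in>U. \<iota> v \<in> N \<longrightarrow> F (\<iota> v) = \<iota> (f v)" using F(3) by simp
  then have "(x, F x) \<in> induced_map S \<iota> U f"
    unfolding induced_map_def mem_Collect_eq case_prod_conv
    by (intro exI[of _ N] exI[of _ F] conjI x(2) F(2)) auto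
  then show False using induced_map_unique[OF dense _ C[OF x(1)]] x(3) by simp
qed

text \<open>
  The way in which the automorphism is established.  It is given by its graph R, and at each pair in R by
  a local biholomorphism extending f.  Since R is total and extensions are unique, R is the graph of
  the induced map F, which is holomorphic.  Since R is injective and onto, F is a bijection, and in local
  coordinates it is injective with nonzero Jacobian, so \<open>inverse_cdiff\<close> makes the inverse
  holomorphic.  The last part says that F is a homeomorphism.
\<close>

lemma automorphism_criterion:
  assumes dense: "dense_in S \<iota> U"
    and R: "\<And>p q. R p q \<Longrightarrow> biholo_at S \<iota> U f p q"
    and total: "\<And>p. p \<in> pts S \<Longrightarrow> \<exists>q. R p q"
    and onto: "\<And>q. q \<in> pts S \<Longrightarrow> \<exists>p. R p q"
    and inj: "\<And>p p' q. R p q \<Longrightarrow> R p' q \<Longrightarrow> p = p'"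
  shows "is_automorphism S (induced_map S \<iota> U f)"
    and "(p, q) \<in> induced_map S \<iota> U f \<longleftrightarrow> R p q"
    and "C \<subseteq> pts S \<Longrightarrow>
      induced_map S \<iota> U f `` (surf_top S closure_of C) = surf_top S closure_of {q. \<exists>p\<in>C. R p q}"
proof -
  note S = complex_surface_axioms
  let ?I = "induced_map S \<iota> U f"
  have RI: "R p q \<Longrightarrow> (p, q) \<in> ?I" for p q using R biholo_at_induced by blast
  note uniq = induced_map_unique[OF dense]
  have IR: "R p q" if pq: "(p, q) \<in> ?I" for p q
  proof -
    obtain q' where "R p q'" using total induced_map_pts[OF pq] by blast
    moreover from this have "q' = q" using uniq[OF RI pq] by simp
    ultimately show ?thesis by simp
  qed
  show "(p, q) \<in> ?I \<longleftrightarrow> R p q" for p q using RI IR by blast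
  define F where "F p = (THE q. R p q)" for p
  have F: "F p = q" if "R p q" for p q
    unfolding F_def by (rule the_equality[of "R p", OF that]) (rule uniq[OF RI RI[OF that]])
  have RF: "R p (F p)" if "p \<in> pts S" for p using total[OF that] F by auto
  have R_pts: "p \<in> pts S" "q \<in> pts S" if "R p q" for p q
    using induced_map_pts[OF RI[OF that]] by auto
  have "inj_on F (pts S)"
    by (rule inj_onI) (metis RF inj)
  moreover have "F ` pts S = pts S"
  proof
    show "F ` pts S \<subseteq> pts S" by (rule image_subsetI) (rule R_pts(2)[OF RF])
    show "pts S \<subseteq> F ` pts S"
    proof
      fix q assume "q \<in> pts S"
      then obtain p where "R p q" using onto by blast
      then show "q \<in> F ` pts S" using F R_pts(1) by (metis imageI)
    qed
  qed
  ultimately have bij: "bij_betw F (pts S) (pts S)" by (simp add: bij_betw_def)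
  have graph: "?I = {(p, F p) |p. p \<in> pts S}"
  proof (intro set_eqI iffI)
    fix x assume "x \<in> ?I"
    moreover obtain p q where "x = (p, q)" by fastforce
    ultimately have "R p q" "x = (p, q)" using IR by auto
    then show "x \<in> {(p, F p) |p. p \<in> pts S}" using F R_pts(1) by auto
  next
    fix x assume "x \<in> {(p, F p) |p. p \<in> pts S}"
    then show "x \<in> ?I" using RI[OF RF] by auto
  qed
  have inv: "inv_into (pts S) F (F p) = p" if "p \<in> pts S" for p
    using bij that by (simp add: bij_betw_def)
  have loc: "\<exists>P Q A \<Phi> z. local_form S \<iota> U f P Q A \<Phi> \<and> z \<in> A \<and> p = snd P z \<and> F p = snd Q (\<Phi> z) \<and>
      nondeg \<Phi> z \<and> (\<forall>x\<in>A. F (snd P x) = snd Q (\<Phi> x))" if p: "p \<in> pts S" for p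
  proof -
    obtain P Q A \<Phi> z where *: "local_form S \<iota> U f P Q A \<Phi>" "z \<in> A" "p = snd P z"
      "F p = snd Q (\<Phi> z)" "nondeg \<Phi> z"
      using R[OF RF[OF p]] unfolding biholo_at_def by (elim exE conjE)
    have "F (snd P x) = snd Q (\<Phi> x)" if "x \<in> A" for x
      by (rule F[OF IR[OF local_form_induced[OF *(1) that]]])
    with * show ?thesis
      by (intro exI[of _ P] exI[of _ Q] exI[of _ A] exI[of _ \<Phi>] exI[of _ z]) simp
  qed
  have openS: "openin (surf_top S) (pts S)" by (metis topspace_surf openin_topspace)
  have holo: "holo_map S (pts S) S F"
  proof (rule holo_mapI[OF S S openS])
    fix p assume "p \<in> pts S"
    from loc[OF this] obtain P Q A \<Phi> z where *: "local_form S \<iota> U f P Q A \<Phi>" "z \<in> A" "p = snd P z"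
      "\<forall>x\<in>A. F (snd P x) = snd Q (\<Phi> x)" by (elim exE conjE)
    have h: "holo2 A \<Phi>" using *(1) by (simp add: local_form_def)
    have "holo_rep S S F P Q A \<Phi>"
      unfolding holo_rep_def
      using *(1,4) holo2_continuous_on[OF h] h by (simp add: local_form_def holo2_iff)
    moreover have "cdiff \<Phi> z" using h *(2) by (simp add: holo2_iff)
    ultimately show "\<exists>P Q A \<Phi> z. holo_rep S S F P Q A \<Phi> \<and> z \<in> A \<and> snd P z = p \<and> cdiff \<Phi> z"
      using *(2) *(3)[symmetric] by (intro exI conjI)
  qed
  have holo': "holo_map S (pts S) S (inv_into (pts S) F)"
  proof (rule holo_mapI[OF S S openS])
    fix q assume "q \<in> pts S"
    then have "q \<in> F ` pts S" using bij by (simp add: bij_betw_def)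
    then obtain p where p: "p \<in> pts S" "F p = q" by blast
    obtain P Q A \<Phi> z where lf: "local_form S \<iota> U f P Q A \<Phi>"
      and z: "z \<in> A" "p = snd P z" "q = snd Q (\<Phi> z)" and nd: "nondeg \<Phi> z"
      and eq: "\<forall>x\<in>A. F (snd P x) = snd Q (\<Phi> x)"
      using loc[OF p(1)] unfolding p(2) by (elim exE conjE)
    have P: "P \<in> params S" and Q: "Q \<in> params S" and h: "holo2 A \<Phi>" and A: "A \<subseteq> fst P"
      and im: "\<Phi> ` A \<subseteq> fst Q" using lf unfolding local_form_def by simp_all
    have "inj_on \<Phi> A"
    proof (rule inj_onI)
      fix x y assume xy: "x \<in> A" "y \<in> A" "\<Phi> x = \<Phi> y"
      then have "F (snd P x) = F (snd P y)" using eq by simp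
      moreover have "snd P x \<in> pts S" "snd P y \<in> pts S" using xy A by (blast intro: params_pts[OF P])+
      ultimately have "snd P x = snd P y" using inv by metis
      then show "x = y" by (rule inj_onD[OF params_inj[OF P]]) (use xy A in auto)
    qed
    note inv_cdiff = inverse_cdiff[OF h this z(1) nd]
    have "inv_into (pts S) F (snd Q x) = snd P (inv_into A \<Phi> x)" if x: "x \<in> \<Phi> ` A" for x
    proof -
      let ?y = "inv_into A \<Phi> x"
      have y: "?y \<in> A" "\<Phi> ?y = x" using x by (simp_all add: inv_into_into f_inv_into_f)
      have "snd P ?y \<in> pts S" using params_pts[OF P] y(1) A by blast
      moreover have "F (snd P ?y) = snd Q x" using eq y by simp
      ultimately show ?thesis using inv by metis
    qed
    moreover have "inv_into A \<Phi> ` \<Phi> ` A \<subseteq> fst P"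
      using A inv_into_into[of _ \<Phi> A] by blast
    ultimately have "holo_rep S S (inv_into (pts S) F) Q P (\<Phi> ` A) (inv_into A \<Phi>)"
      unfolding holo_rep_def using P Q inv_cdiff(1,2) im by simp
    then show "\<exists>P Q A \<Phi> z. holo_rep S S (inv_into (pts S) F) P Q A \<Phi> \<and> z \<in> A \<and> snd P z = q \<and> cdiff \<Phi> z"
      using imageI[OF z(1), of \<Phi>] z(3)[symmetric] inv_cdiff(3) by (intro exI conjI)
  qed
  show "is_automorphism S ?I"
    unfolding is_automorphism_def by (intro exI[of _ F] conjI graph bij holo holo')
  have "continuous_map (surf_top S) (surf_top S) F"
    using continuous_of_holo_map[OF S S holo] bij
    by (auto simp: continuous_map_def topspace_surf bij_betw_def)
  moreover have "continuous_map (surf_top S) (surf_top S) (inv_into (pts S) F)"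
    using continuous_of_holo_map[OF S S holo'] bij
    by (auto simp: continuous_map_def topspace_surf bij_betw_def inv_into_into)
  ultimately have "homeomorphic_maps (surf_top S) (surf_top S) F (inv_into (pts S) F)"
    unfolding homeomorphic_maps_def topspace_surf
    using inv bij by (auto simp: bij_betw_def f_inv_into_f)
  then have hom: "homeomorphic_map (surf_top S) (surf_top S) F"
    by (auto simp: homeomorphic_map_maps)
  show "?I `` (surf_top S closure_of C) = surf_top S closure_of {q. \<exists>p\<in>C. R p q}"
    if C: "C \<subseteq> pts S"
  proof -
    have img: "?I `` D = F ` D" if "D \<subseteq> pts S" for D
      unfolding graph using that by auto
    have "{q. \<exists>p\<in>C. R p q} = F ` C"
    proof (intro set_eqI iffI)
      fix q assume "q \<in> {q. \<exists>p\<in>C. R p q}"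
      then obtain p where "p \<in> C" "R p q" by blast
      then show "q \<in> F ` C" using F[of p q] by auto
    next
      fix q assume "q \<in> F ` C"
      then obtain p where p: "p \<in> C" "q = F p" by blast
      then have "R p q" using RF[of p] C by auto
      then show "q \<in> {q. \<exists>p\<in>C. R p q}" using p(1) by blast
    qed
    moreover have "surf_top S closure_of (F ` C) = F ` (surf_top S closure_of C)"
      using homeomorphic_map_closure_of[OF hom] C by (simp add: topspace_surf)
    moreover have "surf_top S closure_of C \<subseteq> pts S"
      using closure_of_subset_topspace topspace_surf by metis
    ultimately show ?thesis using img by simp
  qed
qed

end

section \<open>Blowups\<close>

lemma coord_change_refl: "open (fst P) \<Longrightarrow> z \<in> fst P \<Longrightarrow> coord_change P P z"
  by (rule coord_changeI[of "fst P" "\<lambda>x. x"])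
    (simp_all add: holo2_iff cdiff_def sdiff_fst sdiff_snd)

text \<open>
  The two affine pieces of the blowdown of the point a, in coordinates.
\<close>

definition slope_map :: "complex \<times> complex \<Rightarrow> complex \<times> complex \<Rightarrow> complex \<times> complex"
  where "slope_map a z = (fst a + fst z, snd a + fst z * snd z)"

definition vert_map :: "complex \<times> complex \<Rightarrow> complex \<times> complex \<Rightarrow> complex \<times> complex"
  where "vert_map a z = (fst a + fst z * snd z, snd a + snd z)"

definition center :: "'a surf \<Rightarrow> 'a \<Rightarrow> complex \<times> complex"
  where "center S p = inv_into (fst (chart S p)) (snd (chart S p)) p"

text \<open>
  The charts of a blowup, with the underlying chart of S as a parameter in the first case, so that it
  can be any compatible parametrization.
\<close>

definition bp_base :: "'a set \<Rightarrow> 'a param \<Rightarrow> 'a bpt param"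
  where "bp_base Z P = ({z \<in> fst P. snd P z \<notin> Z}, \<lambda>z. Base (snd P z))"

definition bp_slope :: "'a surf \<Rightarrow> 'a set \<Rightarrow> 'a \<Rightarrow> 'a bpt param"
  where "bp_slope S Z p =
    ({z. slope_map (center S p) z \<in> fst (chart S p) \<and>
        (fst z = 0 \<or> snd (chart S p) (slope_map (center S p) z) \<notin> Z)},
     \<lambda>z. if fst z = 0 then Exc p (Slope (snd z))
          else Base (snd (chart S p) (slope_map (center S p) z)))"

definition bp_vert :: "'a surf \<Rightarrow> 'a set \<Rightarrow> 'a \<Rightarrow> 'a bpt param"
  where "bp_vert S Z p =
    ({z. vert_map (center S p) z \<in> fst (chart S p) \<and>
        (snd z = 0 \<or> snd (chart S p) (vert_map (center S p) z) \<notin> Z)},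
     \<lambda>z. if snd z = 0 then Exc p (if fst z = 0 then Vertical else Slope (1 / fst z))
          else Base (snd (chart S p) (vert_map (center S p) z)))"

lemma chart_blowup:
  "chart (blowup S Z) (Base p) = bp_base Z (chart S p)"
  "chart (blowup S Z) (Exc p (Slope l)) = bp_slope S Z p"
  "chart (blowup S Z) (Exc p Vertical) = bp_vert S Z p"
proof -
  obtain D \<psi> where e: "chart S p = (D, \<psi>)" by fastforce
  have c: "inv_into D \<psi> p = center S p" by (simp add: center_def e)
  have 1: "(\<lambda>(u, l). center S p + (u, u * l)) = slope_map (center S p)"
    by (auto simp: slope_map_def fun_eq_iff prod_eq_iff)
  have 2: "(\<lambda>(l, v). center S p + (l * v, v)) = vert_map (center S p)"
    by (auto simp: vert_map_def fun_eq_iff prod_eq_iff)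
  show "chart (blowup S Z) (Base p) = bp_base Z (chart S p)"
    by (simp add: blowup_def bp_base_def e)
  show "chart (blowup S Z) (Exc p (Slope l)) = bp_slope S Z p"
    by (simp add: blowup_def bp_slope_def e c 1 Let_def cong: if_cong)
  show "chart (blowup S Z) (Exc p Vertical) = bp_vert S Z p"
    by (simp add: blowup_def bp_vert_def e c 2 Let_def cong: if_cong)
qed

lemma pts_blowup: "pts (blowup S Z) = Base ` (pts S - Z) \<union> exc_fiber Z"
  by (simp add: blowup_def)

lemma Base_in_pts_blowup [simp]: "Base p \<in> pts (blowup S Z) \<longleftrightarrow> p \<in> pts S \<and> p \<notin> Z"
  by (auto simp: pts_blowup exc_fiber_def)

lemma Exc_in_pts_blowup [simp]: "Exc p d \<in> pts (blowup S Z) \<longleftrightarrow> p \<in> Z"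
  by (auto simp: pts_blowup exc_fiber_def)

lemma sdiff_slope_map:
  "sdiff (\<lambda>z. fst (slope_map a z)) x" "sdiff (\<lambda>z. snd (slope_map a z)) x"
  unfolding slope_map_def by (auto intro!: sdiff_intros)

lemma sdiff_vert_map:
  "sdiff (\<lambda>z. fst (vert_map a z)) x" "sdiff (\<lambda>z. snd (vert_map a z)) x"
  unfolding vert_map_def by (auto intro!: sdiff_intros)

lemma cdiff_slope_map: "cdiff (slope_map a) x"
  by (simp add: cdiff_def sdiff_slope_map)

lemma cdiff_vert_map: "cdiff (vert_map a) x"
  by (simp add: cdiff_def sdiff_vert_map)

lemma open_slope_preimage: "open V \<Longrightarrow> open {z. slope_map a z \<in> V}"
  using holo2_open_preimage[of UNIV "slope_map a" V] by (simp add: holo2_iff cdiff_slope_map)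

lemma open_vert_preimage: "open V \<Longrightarrow> open {z. vert_map a z \<in> V}"
  using holo2_open_preimage[of UNIV "vert_map a" V] by (simp add: holo2_iff cdiff_vert_map)

lemma open_fst: "open V \<Longrightarrow> open {z::complex \<times> complex. fst z \<in> V}"
  using continuous_open_preimage[of UNIV fst V] by (simp add: vimage_def continuous_on_fst)

lemma open_snd: "open V \<Longrightarrow> open {z::complex \<times> complex. snd z \<in> V}"
  using continuous_open_preimage[of UNIV snd V] by (simp add: vimage_def continuous_on_snd)

lemma open_fst_neq: "open {z::complex \<times> complex. fst z \<noteq> k}"
  using open_fst[of "- {k}"] by (simp add: open_Compl)

lemma open_snd_neq: "open {z::complex \<times> complex. snd z \<noteq> k}"
  using open_snd[of "- {k}"] by (simp add: open_Compl)

text \<open>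
  Points off a coordinate line, found in a given open set.
\<close>

lemma approach_in_open:
  assumes "open V" "(g \<longlongrightarrow> z) (at (0::complex))" "z \<in> V"
  shows "\<exists>h. h \<noteq> 0 \<and> g h \<in> V"
proof -
  have "eventually (\<lambda>h. g h \<in> V) (at 0)" using assms by (intro topological_tendstoD)
  moreover have "eventually (\<lambda>h. h \<noteq> 0) (at (0::complex))" by (rule eventually_neq_at_within)
  ultimately have "eventually (\<lambda>h. h \<noteq> 0 \<and> g h \<in> V) (at 0)" by eventually_elim simp
  from eventually_happens[OF this] show ?thesis by simp
qed

locale blowup_data = complex_surface S for S :: "'a surf" +
  fixes Z :: "'a set"
  assumes finite_Z: "finite Z" and Z_pts: "Z \<subseteq> pts S"
begin

abbreviation "Bl \<equiv> blowup S Z"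

text \<open>
  A family of parametrizations of the blowup that contains its atlas.  All of its transitions are shown
  to be holomorphic, so it consists of compatible parametrizations.
\<close>

definition BP :: "'a bpt param set"
  where "BP = bp_base Z ` params S \<union> bp_slope S Z ` Z \<union> bp_vert S Z ` Z"

lemma BP_cases:
  assumes "X \<in> BP"
  obtains P where "P \<in> params S" "X = bp_base Z P"
    | p where "p \<in> Z" "X = bp_slope S Z p"
    | p where "p \<in> Z" "X = bp_vert S Z p"
  using assms unfolding BP_def by (elim UnE imageE) simp_all

lemma chart_params: "p \<in> Z \<Longrightarrow> chart S p \<in> params S"
  using Z_pts chart_in_atlas atlas_params by blast

lemma center: "p \<in> Z \<Longrightarrow> center S p \<in> fst (chart S p) \<and> snd (chart S p) (center S p) = p"
  unfolding center_def using chart_covers[of p] Z_pts by (simp add: inv_into_into f_inv_into_f subset_iff)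

lemma atlas_BP: "atlas Bl \<subseteq> BP"
proof
  fix X assume "X \<in> atlas Bl"
  then obtain x where x: "x \<in> pts Bl" "X = chart Bl x" by (auto simp: atlas_def)
  show "X \<in> BP"
  proof (cases x)
    case (Base p)
    then have "p \<in> pts S" using x(1) by simp
    then show ?thesis using x(2) Base chart_in_atlas atlas_params by (simp add: chart_blowup BP_def)
  next
    case (Exc p d)
    then show ?thesis using x by (cases d) (simp_all add: chart_blowup BP_def)
  qed
qed

lemma finite_preimage: "P \<in> params S \<Longrightarrow> finite {z \<in> fst P. snd P z \<in> Z}"
  using finite_vimage_IntI[OF finite_Z params_inj, of P] by (simp add: vimage_def Int_def conj_commute)

lemma open_off: "P \<in> params S \<Longrightarrow> open {z \<in> fst P. snd P z \<notin> Z}"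
proof -
  assume P: "P \<in> params S"
  have "open (fst P - {z \<in> fst P. snd P z \<in> Z})"
    using params_open[OF P] finite_preimage[OF P] by (simp add: finite_imp_closed open_Diff)
  moreover have "fst P - {z \<in> fst P. snd P z \<in> Z} = {z \<in> fst P. snd P z \<notin> Z}" by auto
  ultimately show ?thesis by simp
qed

text \<open>
  Off its exceptional line, \<^const>\<open>slope_map\<close> is injective, so it meets the finite set Z in finitely many
  points only; the domain arises from an open set by removing these.
\<close>

lemma BP_open: "X \<in> BP \<Longrightarrow> open (fst X)"
proof (erule BP_cases)
  fix P assume "P \<in> params S" "X = bp_base Z P"
  then show ?thesis using open_off by (simp add: bp_base_def)
next
  fix p assume p: "p \<in> Z" "X = bp_slope S Z p"
  let ?P = "chart S p" and ?w = "slope_map (center S p)"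
  let ?B = "{z. fst z \<noteq> 0 \<and> ?w z \<in> {y \<in> fst ?P. snd ?P y \<in> Z}}"
  have "inj_on ?w ?B" by (auto simp: inj_on_def slope_map_def)
  then have "finite ?B"
    by (rule inj_on_finite[OF _ _ finite_preimage[OF chart_params[OF p(1)]]]) auto
  then have "open ({z. ?w z \<in> fst ?P} - ?B)"
    using open_slope_preimage[OF params_open[OF chart_params[OF p(1)]]]
    by (simp add: finite_imp_closed open_Diff)
  moreover have "fst X = {z. ?w z \<in> fst ?P} - ?B" using p(2) by (auto simp: bp_slope_def)
  ultimately show ?thesis by simp
next
  fix p assume p: "p \<in> Z" "X = bp_vert S Z p"
  let ?P = "chart S p" and ?w = "vert_map (center S p)"
  let ?B = "{z. snd z \<noteq> 0 \<and> ?w z \<in> {y \<in> fst ?P. snd ?P y \<in> Z}}"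
  have "inj_on ?w ?B" by (auto simp: inj_on_def vert_map_def)
  then have "finite ?B"
    by (rule inj_on_finite[OF _ _ finite_preimage[OF chart_params[OF p(1)]]]) auto
  then have "open ({z. ?w z \<in> fst ?P} - ?B)"
    using open_vert_preimage[OF params_open[OF chart_params[OF p(1)]]]
    by (simp add: finite_imp_closed open_Diff)
  moreover have "fst X = {z. ?w z \<in> fst ?P} - ?B" using p(2) by (auto simp: bp_vert_def)
  ultimately show ?thesis by simp
qed

lemma BP_inj: "X \<in> BP \<Longrightarrow> inj_on (snd X) (fst X)"
proof (erule BP_cases)
  fix P assume "P \<in> params S" "X = bp_base Z P"
  then show ?thesis using params_inj[of P S] by (auto simp: bp_base_def inj_on_def)
next
  fix p assume p: "p \<in> Z" "X = bp_slope S Z p"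
  have inj: "x = y" if "x \<in> fst (chart S p)" "y \<in> fst (chart S p)"
    "snd (chart S p) x = snd (chart S p) y" for x y
    using inj_onD[OF params_inj[OF chart_params[OF p(1)]]] that by simp
  show ?thesis
  proof (rule inj_onI)
    fix x y assume xy: "x \<in> fst X" "y \<in> fst X" "snd X x = snd X y"
    show "x = y"
    proof (cases "fst x = 0 \<or> fst y = 0")
      case True
      then show ?thesis using xy p(2) by (auto simp: bp_slope_def prod_eq_iff split: if_splits)
    next
      case False
      then have "slope_map (center S p) x = slope_map (center S p) y"
        using xy p(2) by (intro inj) (simp_all add: bp_slope_def)
      then show ?thesis using False by (auto simp: slope_map_def prod_eq_iff)
    qed
  qed
next
  fix p assume p: "p \<in> Z" "X = bp_vert S Z p"
  have inj: "x = y" if "x \<in> fst (chart S p)" "y \<in> fst (chart S p)"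
    "snd (chart S p) x = snd (chart S p) y" for x y
    using inj_onD[OF params_inj[OF chart_params[OF p(1)]]] that by simp
  show ?thesis
  proof (rule inj_onI)
    fix x y assume xy: "x \<in> fst X" "y \<in> fst X" "snd X x = snd X y"
    show "x = y"
    proof (cases "snd x = 0 \<or> snd y = 0")
      case True
      then show ?thesis using xy p(2) by (auto simp: bp_vert_def prod_eq_iff split: if_splits)
    next
      case False
      then have "vert_map (center S p) x = vert_map (center S p) y"
        using xy p(2) by (intro inj) (simp_all add: bp_vert_def)
      then show ?thesis using False by (auto simp: vert_map_def prod_eq_iff)
    qed
  qed
qed

lemma BP_pts: "X \<in> BP \<Longrightarrow> snd X ` fst X \<subseteq> pts Bl"
proof (erule BP_cases; rule image_subsetI)
  fix P z assume "P \<in> params S" "X = bp_base Z P" "z \<in> fst X"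
  then show "snd X z \<in> pts Bl" using params_pts[of P S z] by (simp add: bp_base_def)
next
  fix p z assume "p \<in> Z" "X = bp_slope S Z p" "z \<in> fst X"
  then show "snd X z \<in> pts Bl"
    using params_pts[OF chart_params, of p "slope_map (center S p) z"] by (auto simp: bp_slope_def)
next
  fix p z assume "p \<in> Z" "X = bp_vert S Z p" "z \<in> fst X"
  then show "snd X z \<in> pts Bl"
    using params_pts[OF chart_params, of p "vert_map (center S p) z"] by (auto simp: bp_vert_def)
qed

text \<open>Off the exceptional fibers, every chart of the blowup is a chart of S in disguise.\<close>

lemma BP_down:
  assumes X: "X \<in> BP" and z: "z \<in> fst X" "snd X z = Base q"
  obtains P where "P \<in> params S" "q \<in> snd P ` fst P" "coord_change X (bp_base Z P) z"
    "\<And>w. w \<in> fst (bp_base Z P) \<Longrightarrow> snd P w = q \<Longrightarrow> coord_change (bp_base Z P) X w"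
  using X
proof (cases rule: BP_cases)
  case (1 P)
  have o: "open (fst (bp_base Z P))" using BP_open X 1 by simp
  show ?thesis
  proof (rule that[OF 1(1)])
    show "q \<in> snd P ` fst P" using z 1 by (auto simp: bp_base_def)
    show "coord_change X (bp_base Z P) z" using coord_change_refl[OF o] z(1) 1 by simp
    show "coord_change (bp_base Z P) X w" if "w \<in> fst (bp_base Z P)" "snd P w = q" for w
      using coord_change_refl[OF o] that 1 by simp
  qed
next
  case (2 p)
  let ?P = "chart S p" and ?w = "slope_map (center S p)"
  have z0: "fst z \<noteq> 0" "?w z \<in> fst ?P" "snd ?P (?w z) = q" "q \<notin> Z"
    using z 2 by (auto simp: bp_slope_def split: if_splits)
  show ?thesis
  proof (rule that[OF chart_params[OF 2(1)]])
    show "q \<in> snd ?P ` fst ?P" using z0 by blast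
    have "open (fst X \<inter> {z. fst z \<noteq> 0})" using BP_open[OF X] open_fst_neq by (rule open_Int)
    then have "holo2 (fst X \<inter> {z. fst z \<noteq> 0}) ?w" by (simp add: holo2_iff cdiff_slope_map)
    then show "coord_change X (bp_base Z ?P) z"
      by (rule coord_changeI) (use z z0 2 in \<open>auto simp: bp_base_def bp_slope_def\<close>)
    fix w assume w: "w \<in> fst (bp_base Z ?P)" "snd ?P w = q"
    let ?v = "\<lambda>x. (fst x - fst (center S p), (snd x - snd (center S p)) / (fst x - fst (center S p)))"
    let ?A = "fst (bp_base Z ?P) \<inter> {x. fst x \<noteq> fst (center S p)}"
    have w': "w = ?w z"
      by (rule inj_onD[OF params_inj[OF chart_params[OF 2(1)]]]) (use w z0 in \<open>auto simp: bp_base_def\<close>)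
    have wv: "?w (?v x) = x" if "x \<in> ?A" for x
      using that by (simp add: slope_map_def)
    have "open ?A"
      using open_off[OF chart_params[OF 2(1)]] open_fst_neq by (auto simp: bp_base_def)
    then have "holo2 ?A ?v"
      by (auto simp: holo2_iff intro!: sdiff_intros)
    then show "coord_change (bp_base Z ?P) X w"
    proof (rule coord_changeI)
      show "w \<in> ?A" using w z0 w' by (simp add: slope_map_def)
      fix x assume x: "x \<in> ?A"
      show "?v x \<in> fst X" using x wv[OF x] 2 by (simp add: bp_base_def bp_slope_def)
      show "snd X (?v x) = snd (bp_base Z ?P) x"
        using x wv[OF x] 2 by (simp add: bp_base_def bp_slope_def)
    qed simp
  qed
next
  case (3 p)
  let ?P = "chart S p" and ?w = "vert_map (center S p)"
  have z0: "snd z \<noteq> 0" "?w z \<in> fst ?P" "snd ?P (?w z) = q" "q \<notin> Z"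
    using z 3 by (auto simp: bp_vert_def split: if_splits)
  show ?thesis
  proof (rule that[OF chart_params[OF 3(1)]])
    show "q \<in> snd ?P ` fst ?P" using z0 by blast
    have "open (fst X \<inter> {z. snd z \<noteq> 0})" using BP_open[OF X] open_snd_neq by (rule open_Int)
    then have "holo2 (fst X \<inter> {z. snd z \<noteq> 0}) ?w" by (simp add: holo2_iff cdiff_vert_map)
    then show "coord_change X (bp_base Z ?P) z"
      by (rule coord_changeI) (use z z0 3 in \<open>auto simp: bp_base_def bp_vert_def\<close>)
    fix w assume w: "w \<in> fst (bp_base Z ?P)" "snd ?P w = q"
    let ?v = "\<lambda>x. ((fst x - fst (center S p)) / (snd x - snd (center S p)), snd x - snd (center S p))"
    let ?A = "fst (bp_base Z ?P) \<inter> {x. snd x \<noteq> snd (center S p)}"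
    have w': "w = ?w z"
      by (rule inj_onD[OF params_inj[OF chart_params[OF 3(1)]]]) (use w z0 in \<open>auto simp: bp_base_def\<close>)
    have wv: "?w (?v x) = x" if "x \<in> ?A" for x
      using that by (simp add: vert_map_def)
    have "open ?A"
      using open_off[OF chart_params[OF 3(1)]] open_snd_neq by (auto simp: bp_base_def)
    then have "holo2 ?A ?v"
      by (auto simp: holo2_iff intro!: sdiff_intros)
    then show "coord_change (bp_base Z ?P) X w"
    proof (rule coord_changeI)
      show "w \<in> ?A" using w z0 w' by (simp add: vert_map_def)
      fix x assume x: "x \<in> ?A"
      show "?v x \<in> fst X" using x wv[OF x] 3 by (simp add: bp_base_def bp_vert_def)
      show "snd X (?v x) = snd (bp_base Z ?P) x"
        using x wv[OF x] 3 by (simp add: bp_base_def bp_vert_def)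
    qed simp
  qed
qed

lemma bp_base_change:
  assumes P: "P \<in> params S" and Q: "Q \<in> params S" and z: "z \<in> fst (bp_base Z P)" "snd P z \<in> snd Q ` fst Q"
  shows "coord_change (bp_base Z P) (bp_base Z Q) z"
proof -
  have "z \<in> fst P" using z(1) by (simp add: bp_base_def)
  from params_change[OF P Q this z(2)] obtain A \<Phi> where A: "holo2 A \<Phi>" "z \<in> A" "A \<subseteq> fst P"
    and \<Phi>: "\<forall>x\<in>A. \<Phi> x \<in> fst Q" "\<forall>x\<in>A. snd Q (\<Phi> x) = snd P x"
    by (rule coord_changeE)
  have o: "open (fst (bp_base Z P))" using open_off[OF P] by (simp add: bp_base_def)
  have "holo2 (A \<inter> fst (bp_base Z P)) \<Phi>"
    by (rule holo2_subset[OF A(1)]) (use o A(1) in \<open>auto simp: holo2_iff\<close>)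
  then show ?thesis
    by (rule coord_changeI) (use z A \<Phi> in \<open>auto simp: bp_base_def\<close>)
qed

text \<open>
  Over a point outside Z the transition passes through a transition of S.  Over a point of the exceptional
  fiber the only two charts are those of the two affine pieces, and (u, l) corresponds to (1/l, u l).
\<close>

lemma BP_change:
  assumes X: "X \<in> BP" and Y: "Y \<in> BP" and z: "z \<in> fst X" "snd X z \<in> snd Y ` fst Y"
  shows "coord_change X Y z"
proof -
  obtain y where y: "y \<in> fst Y" "snd Y y = snd X z" using z(2) by (metis imageE)
  show ?thesis
  proof (cases "snd X z")
    case (Base q)
    obtain P where P: "P \<in> params S" "q \<in> snd P ` fst P" "coord_change X (bp_base Z P) z"
      using BP_down[OF X z(1) Base] by metis
    obtain Q where Q: "Q \<in> params S" "q \<in> snd Q ` fst Q"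
      "\<And>w. w \<in> fst (bp_base Z Q) \<Longrightarrow> snd Q w = q \<Longrightarrow> coord_change (bp_base Z Q) Y w"
      using BP_down[OF Y y(1)] y(2) Base by metis
    have snd_bp: "snd (bp_base Z R) w = Base (snd R w)" for R w by (simp add: bp_base_def)
    show ?thesis
    proof (rule coord_change_trans[OF P(3)])
      fix w assume w: "w \<in> fst (bp_base Z P)" "snd (bp_base Z P) w = snd X z"
      then have wq: "snd P w = q" using Base by (simp add: snd_bp)
      show "coord_change (bp_base Z P) Y w"
      proof (rule coord_change_trans[OF bp_base_change[OF P(1) Q(1) w(1)]])
        show "snd P w \<in> snd Q ` fst Q" using wq Q(2) by simp
        fix v assume v: "v \<in> fst (bp_base Z Q)" "snd (bp_base Z Q) v = snd (bp_base Z P) w"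
        then show "coord_change (bp_base Z Q) Y v"
          using Q(3) wq by (simp add: snd_bp)
      qed
    qed
  next
    case (Exc p d)
    have XX: "p \<in> Z \<and> (X = bp_slope S Z p \<or> X = bp_vert S Z p)"
      using X by (cases rule: BP_cases)
        (use Exc in \<open>auto simp: bp_base_def bp_slope_def bp_vert_def split: if_splits\<close>)
    have YY: "Y = bp_slope S Z p \<or> Y = bp_vert S Z p"
      using Y by (cases rule: BP_cases)
        (use Exc y in \<open>auto simp: bp_base_def bp_slope_def bp_vert_def split: if_splits\<close>)
    consider "X = Y" | "X = bp_slope S Z p" "Y = bp_vert S Z p"
      | "X = bp_vert S Z p" "Y = bp_slope S Z p"
      using XX YY by blast
    then show ?thesis
    proof cases
      case 1
      then show ?thesis using coord_change_refl[OF BP_open[OF X] z(1)] by simp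
    next
      case 2
      let ?A = "fst X \<inter> {z. snd z \<noteq> 0}"
      let ?\<Phi> = "\<lambda>z. (1 / snd z, fst z * snd z)"
      have "holo2 ?A ?\<Phi>"
        using BP_open[OF X] open_snd_neq[of 0] by (auto simp: holo2_iff intro!: sdiff_intros)
      moreover have "z \<in> ?A"
        using z(1) y Exc 2 by (auto simp: bp_slope_def bp_vert_def split: if_splits)
      moreover have "vert_map (center S p) (?\<Phi> x) = slope_map (center S p) x" if "x \<in> ?A" for x
        using that by (simp add: vert_map_def slope_map_def)
      ultimately show ?thesis
        by (intro coord_changeI[of ?A ?\<Phi>])
          (auto simp: 2 bp_slope_def bp_vert_def)
    next
      case 3
      let ?A = "fst X \<inter> {z. fst z \<noteq> 0}"
      let ?\<Phi> = "\<lambda>z. (fst z * snd z, 1 / fst z)"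
      have "holo2 ?A ?\<Phi>"
        using BP_open[OF X] open_fst_neq[of 0] by (auto simp: holo2_iff intro!: sdiff_intros)
      moreover have "z \<in> ?A"
        using z(1) y Exc 3 by (auto simp: bp_slope_def bp_vert_def split: if_splits)
      moreover have "slope_map (center S p) (?\<Phi> x) = vert_map (center S p) x" if "x \<in> ?A" for x
        using that by (simp add: vert_map_def slope_map_def)
      ultimately show ?thesis
        by (intro coord_changeI[of ?A ?\<Phi>])
          (auto simp: 3 bp_slope_def bp_vert_def)
    qed
  qed
qed

lemma BP_params: "X \<in> BP \<Longrightarrow> X \<in> params Bl"
  unfolding params_def mem_Collect_eq using BP_open BP_inj BP_pts BP_change atlas_BP
  by (meson subsetD)

lemma bp_base_params: "P \<in> params S \<Longrightarrow> bp_base Z P \<in> params Bl"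
  and bp_slope_params: "p \<in> Z \<Longrightarrow> bp_slope S Z p \<in> params Bl"
  and bp_vert_params: "p \<in> Z \<Longrightarrow> bp_vert S Z p \<in> params Bl"
  by (rule BP_params, simp add: BP_def)+

lemma Exc_slope: "p \<in> Z \<Longrightarrow> (0, l) \<in> fst (bp_slope S Z p) \<and> snd (bp_slope S Z p) (0, l) = Exc p (Slope l)"
  using center[of p] by (simp add: bp_slope_def slope_map_def)

lemma Exc_vert: "p \<in> Z \<Longrightarrow> (l, 0) \<in> fst (bp_vert S Z p) \<and>
    snd (bp_vert S Z p) (l, 0) = Exc p (if l = 0 then Vertical else Slope (1 / l))"
  using center[of p] by (simp add: bp_vert_def vert_map_def)

lemma complex_atlas_blowup: "complex_atlas Bl"
proof
  fix x assume x: "x \<in> pts Bl"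
  show "x \<in> snd (chart Bl x) ` fst (chart Bl x)"
  proof (cases x)
    case (Base p)
    then have "p \<in> snd (chart S p) ` fst (chart S p)" "p \<notin> Z" using x chart_covers[of p] by simp_all
    then show ?thesis using Base by (auto simp: chart_blowup bp_base_def)
  next
    case (Exc p d)
    then have p: "p \<in> Z" using x by simp
    show ?thesis
    proof (cases d)
      case (Slope l)
      then show ?thesis using Exc_slope[OF p, of l] Exc by (metis chart_blowup(2) imageI)
    next
      case Vertical
      then show ?thesis using Exc_vert[OF p, of 0] Exc by (metis chart_blowup(3) imageI)
    qed
  qed
next
  show "X \<in> atlas Bl \<Longrightarrow> X \<in> params Bl" for X using BP_params atlas_BP by blast
qed


definition blow_down :: "'a bpt \<Rightarrow> 'a"
  where "blow_down x = (case x of Base p \<Rightarrow> p | Exc p d \<Rightarrow> p)"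

text \<open>
  Points over different points of S are separated by the preimages of open sets of S.
\<close>

lemma blow_down_continuous:
  assumes V: "openin (surf_top S) V"
  shows "openin (surf_top Bl) {x \<in> pts Bl. blow_down x \<in> V}"
  unfolding openin_surf_iff
proof (intro conjI ballI)
  fix X assume "X \<in> atlas Bl"
  then have X: "X \<in> BP" using atlas_BP by blast
  have eq: "{z \<in> fst X. snd X z \<in> {x \<in> pts Bl. blow_down x \<in> V}} =
      {z \<in> fst X. blow_down (snd X z) \<in> V}" using BP_pts[OF X] by blast
  have "open {z \<in> fst X. blow_down (snd X z) \<in> V}"
    using X
  proof (cases rule: BP_cases)
    case (1 P)
    have "{z \<in> fst X. blow_down (snd X z) \<in> V} = fst X \<inter> {z \<in> fst P. snd P z \<in> V}"
      using 1 by (auto simp: bp_base_def blow_down_def)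
    then show ?thesis using BP_open[OF X] open_chart_preimage[OF 1(1) V] by (simp add: open_Int)
  next
    case (2 p)
    have "{z \<in> fst X. blow_down (snd X z) \<in> V} = fst X \<inter>
        {z. slope_map (center S p) z \<in> {z \<in> fst (chart S p). snd (chart S p) z \<in> V}}"
      using 2 center[OF 2(1)] by (auto simp: bp_slope_def blow_down_def slope_map_def)
    then show ?thesis
      using BP_open[OF X] open_slope_preimage[OF open_chart_preimage[OF chart_params[OF 2(1)] V]]
      by (simp add: open_Int)
  next
    case (3 p)
    have "{z \<in> fst X. blow_down (snd X z) \<in> V} = fst X \<inter>
        {z. vert_map (center S p) z \<in> {z \<in> fst (chart S p). snd (chart S p) z \<in> V}}"
      using 3 center[OF 3(1)] by (auto simp: bp_vert_def blow_down_def vert_map_def)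
    then show ?thesis
      using BP_open[OF X] open_vert_preimage[OF open_chart_preimage[OF chart_params[OF 3(1)] V]]
      by (simp add: open_Int)
  qed
  then show "open {z \<in> fst X. snd X z \<in> {x \<in> pts Bl. blow_down x \<in> V}}"
    by (simp only: eq)
qed blast

text \<open>
  Two finite slopes are separated in one chart.  A slope l and the vertical direction are separated by
  the cones |dy/dx| < |l| + 1 and |dx/dy| < 1 / (|l| + 1), which are disjoint.
\<close>

lemma separate_directions:
  assumes p: "p \<in> Z" and dd: "d \<noteq> d'"
  shows "\<exists>V W. openin (surf_top Bl) V \<and> openin (surf_top Bl) W \<and> Exc p d \<in> V \<and> Exc p d' \<in> W \<and> disjnt V W"
proof -
  interpret Bl: complex_atlas Bl by (rule complex_atlas_blowup)
  note img_s = Bl.openin_chart_image[OF bp_slope_params[OF p]]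
  note img_v = Bl.openin_chart_image[OF bp_vert_params[OF p]]
  note op_s = params_open[OF bp_slope_params[OF p]]
  note op_v = params_open[OF bp_vert_params[OF p]]
  let ?Xs = "bp_slope S Z p" and ?Xv = "bp_vert S Z p"
  have case1: ?thesis if "d = Slope l" "d' = Slope l'" for l l'
  proof -
    have "l \<noteq> l'" using dd that by simp
    from hausdorff[OF this] obtain A B where
      AB: "open A" "open B" "l \<in> A" "l' \<in> B" "A \<inter> B = {}" by (elim exE conjE)
    let ?V = "\<lambda>C. snd ?Xs ` (fst ?Xs \<inter> {z. snd z \<in> C})"
    have "disjnt (?V A) (?V B)"
      unfolding disjnt_def
    proof (rule equals0I)
      fix x assume "x \<in> ?V A \<inter> ?V B"
      then have x: "x \<in> ?V A" "x \<in> ?V B" by (rule IntD1, rule IntD2)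
      obtain y where y0: "x = snd ?Xs y" "y \<in> fst ?Xs \<inter> {z. snd z \<in> A}" using x(1) by (rule imageE)
      obtain z where z0: "x = snd ?Xs z" "z \<in> fst ?Xs \<inter> {z. snd z \<in> B}" using x(2) by (rule imageE)
      have y: "y \<in> fst ?Xs" "snd y \<in> A" "x = snd ?Xs y" using y0 by simp_all
      have z: "z \<in> fst ?Xs" "snd z \<in> B" "x = snd ?Xs z" using z0 by simp_all
      have "y = z" by (rule inj_onD[OF params_inj[OF bp_slope_params[OF p]]]) (use y z in simp_all)
      then show False using y(2) z(2) AB(5) by auto
    qed
    moreover have "openin (surf_top Bl) (?V A)"
      by (rule img_s) (use open_Int[OF op_s open_snd[OF AB(1)]] in simp_all)
    moreover have "openin (surf_top Bl) (?V B)"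
      by (rule img_s) (use open_Int[OF op_s open_snd[OF AB(2)]] in simp_all)
    moreover have "Exc p d \<in> ?V A"
      by (rule image_eqI[of _ _ "(0, l)"]) (use Exc_slope[OF p, of l] that AB in simp_all)
    moreover have "Exc p d' \<in> ?V B"
      by (rule image_eqI[of _ _ "(0, l')"]) (use Exc_slope[OF p, of l'] that AB in simp_all)
    ultimately show ?thesis by (intro exI[of _ "?V A"] exI[of _ "?V B"] conjI)
  qed
  have case2: "\<exists>V W. openin (surf_top Bl) V \<and> openin (surf_top Bl) W \<and>
      Exc p (Slope l) \<in> V \<and> Exc p Vertical \<in> W \<and> disjnt V W" for l
  proof -
    define r where "r = norm l + 1"
    have r: "r > 0" by (simp add: r_def add_nonneg_pos)
    let ?A = "fst ?Xs \<inter> {z. snd z \<in> {x. norm x < r}}"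
    let ?B = "fst ?Xv \<inter> {z. fst z \<in> {x. norm x * r < 1}}"
    have o: "open {x::complex. norm x < r}" "open {x::complex. norm x * r < 1}"
      by (intro open_Collect_less continuous_intros)+
    have "openin (surf_top Bl) (snd ?Xs ` ?A)" by (rule img_s) (use open_Int[OF op_s open_snd[OF o(1)]] in simp_all)
    moreover have "openin (surf_top Bl) (snd ?Xv ` ?B)"
      by (rule img_v) (use open_Int[OF op_v open_fst[OF o(2)]] in simp_all)
    moreover have "Exc p (Slope l) \<in> snd ?Xs ` ?A"
      by (rule image_eqI[of _ _ "(0, l)"]) (use Exc_slope[OF p, of l] r_def in simp_all)
    moreover have "Exc p Vertical \<in> snd ?Xv ` ?B"
      by (rule image_eqI[of _ _ "(0, 0)"]) (use Exc_vert[OF p, of 0] in simp_all)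
    moreover have "disjnt (snd ?Xs ` ?A) (snd ?Xv ` ?B)"
      unfolding disjnt_def
    proof (rule equals0I)
      fix q assume "q \<in> snd ?Xs ` ?A \<inter> snd ?Xv ` ?B"
      then have q: "q \<in> snd ?Xs ` ?A" "q \<in> snd ?Xv ` ?B" by (rule IntD1, rule IntD2)
      obtain x where x0: "q = snd ?Xs x" "x \<in> ?A" using q(1) by (rule imageE)
      obtain y where y0: "q = snd ?Xv y" "y \<in> ?B" using q(2) by (rule imageE)
      note x = x0(2) x0(1) and y = y0(2) y0(1)
      then have xy: "snd ?Xs x = snd ?Xv y" by simp
      have small: "norm (snd x * fst y) < 1"
      proof -
        have "norm (snd x) * norm (fst y) \<le> r * norm (fst y)"
          using x(1) by (intro mult_right_mono) simp_all
        also have "\<dots> < 1" using y(1) by (simp add: mult.commute)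
        finally show ?thesis by (simp add: norm_mult)
      qed
      have "snd x * fst y = 1"
      proof (cases "fst x = 0")
        case True
        then show ?thesis using xy by (auto simp: bp_slope_def bp_vert_def split: if_splits)
      next
        case False
        then have ny: "snd y \<noteq> 0" using xy by (auto simp: bp_slope_def bp_vert_def)
        have "slope_map (center S p) x = vert_map (center S p) y"
          by (rule inj_onD[OF params_inj[OF chart_params[OF p]]])
            (use xy x(1) y(1) False ny in \<open>simp_all add: bp_slope_def bp_vert_def\<close>)
        then have e: "fst x = fst y * snd y" "fst x * snd x = snd y"
          by (auto simp: slope_map_def vert_map_def)
        then have "snd y * (snd x * fst y) = snd y * 1" by (simp add: algebra_simps)
        then show ?thesis using ny by (metis mult_left_cancel)
      qed
      then show False using small by simp
    qed
    ultimately show ?thesis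
      by (intro exI[of _ "snd ?Xs ` ?A"] exI[of _ "snd ?Xv ` ?B"] conjI)
  qed
  show ?thesis
  proof (cases d)
    case (Slope l)
    then show ?thesis using case1[OF Slope] case2[of l] by (cases d') simp_all
  next
    case Vertical
    then obtain l where "d' = Slope l" using dd by (cases d') auto
    then show ?thesis using case2[of l] Vertical by (metis disjnt_sym)
  qed
qed

text \<open>
  The Hausdorff property is what makes the extension of a meromorphic map unique.
\<close>

theorem complex_surface_blowup: "complex_surface Bl"
proof -
  interpret Bl: complex_atlas Bl by (rule complex_atlas_blowup)
  have "\<exists>V W. openin (surf_top Bl) V \<and> openin (surf_top Bl) W \<and> x \<in> V \<and> y \<in> W \<and> disjnt V W"
    if xy: "x \<in> pts Bl" "y \<in> pts Bl" "x \<noteq> y" for x y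
  proof (cases "blow_down x = blow_down y")
    case True
    then obtain p d d' where *: "x = Exc p d" "y = Exc p d'"
      using xy by (cases x; cases y) (auto simp: blow_down_def)
    then have "p \<in> Z" "d \<noteq> d'" using xy by auto
    then show ?thesis using separate_directions * by blast
  next
    case False
    have "blow_down z \<in> pts S" if "z \<in> pts Bl" for z
      using that Z_pts by (cases z) (auto simp: blow_down_def)
    then obtain V W where VW: "openin (surf_top S) V" "openin (surf_top S) W" "blow_down x \<in> V"
      "blow_down y \<in> W" "disjnt V W"
      using False xy Hausdorff unfolding Hausdorff_space_def topspace_surf by metis
    show ?thesis
      by (rule exI[of _ "{x \<in> pts Bl. blow_down x \<in> V}"], rule exI[of _ "{x \<in> pts Bl. blow_down x \<in> W}"])
        (use VW blow_down_continuous xy in \<open>auto simp: disjnt_def\<close>)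
  qed
  then have "Hausdorff_space (surf_top Bl)"
    unfolding Hausdorff_space_def Bl.topspace_surf by blast
  then show ?thesis by unfold_locales
qed

text \<open>
  An exceptional fiber is the preimage of a closed point under the continuous blowdown.
\<close>

lemma blowup_closed_point:
  "p \<in> Z \<Longrightarrow> closedin (surf_top Bl) (exc_fiber {p})"
proof -
  assume p: "p \<in> Z"
  interpret Bl: complex_atlas Bl by (rule complex_atlas_blowup)
  have "openin (surf_top Bl) {x \<in> pts Bl. blow_down x \<in> pts S - {p}}"
    by (rule blow_down_continuous) (use finite_closed[of "{p}"] p Z_pts in auto)
  moreover have "{x \<in> pts Bl. blow_down x \<in> pts S - {p}} = pts Bl - exc_fiber {p}"
  proof (rule set_eqI)
    fix x show "x \<in> {x \<in> pts Bl. blow_down x \<in> pts S - {p}} \<longleftrightarrow> x \<in> pts Bl - exc_fiber {p}"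
      using p Z_pts by (cases x) (auto simp: blow_down_def exc_fiber_def)
  qed
  moreover have "exc_fiber {p} \<subseteq> pts Bl" using p by (auto simp: exc_fiber_def)
  ultimately show ?thesis by (simp add: closedin_def Bl.topspace_surf)
qed

lemma openin_Base_part:
  assumes V: "openin (surf_top Bl) V"
  shows "openin (surf_top S) {q. Base q \<in> V}"
  unfolding openin_surf_iff
proof (intro conjI ballI)
  have sub: "V \<subseteq> pts Bl" using V by (simp add: openin_surf_iff)
  then show "{q. Base q \<in> V} \<subseteq> pts S" by force
  fix P assume "P \<in> atlas S"
  then have P: "P \<in> params S" by (rule atlas_params)
  interpret Bl: complex_atlas Bl by (rule complex_atlas_blowup)
  have "{z \<in> fst P. snd P z \<in> {q. Base q \<in> V}} = {z \<in> fst (bp_base Z P). snd (bp_base Z P) z \<in> V}"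
    using sub by (force simp: bp_base_def)
  then show "open {z \<in> fst P. snd P z \<in> {q. Base q \<in> V}}"
    using Bl.open_chart_preimage[OF bp_base_params[OF P] V] by simp
qed

text \<open>
  Every point of an exceptional fiber is a limit of points outside of it.
\<close>

lemma Base_part_nonempty:
  assumes V: "openin (surf_top Bl) V" and x: "x \<in> V"
  shows "\<exists>q. Base q \<in> V"
proof (cases x)
  case (Base q)
  then show ?thesis using x by blast
next
  case (Exc p d)
  interpret Bl: complex_atlas Bl by (rule complex_atlas_blowup)
  have "x \<in> pts Bl" using V x by (auto simp: openin_surf_iff)
  then have p: "p \<in> Z" using Exc by simp
  show ?thesis
  proof (cases d)
    case (Slope l)
    let ?O = "{z \<in> fst (bp_slope S Z p). snd (bp_slope S Z p) z \<in> V}"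
    have o: "open ?O" by (rule Bl.open_chart_preimage[OF bp_slope_params[OF p] V])
    have t: "((\<lambda>h. (h, l)) \<longlongrightarrow> (0, l)) (at 0)" by (intro tendsto_intros)
    have m: "(0, l) \<in> ?O" using Exc_slope[OF p, of l] x Exc Slope by simp
    obtain h where "h \<noteq> 0" "(h, l) \<in> ?O" using approach_in_open[OF o t m] by (elim exE conjE)
    then have "Base (snd (chart S p) (slope_map (center S p) (h, l))) \<in> V" by (simp add: bp_slope_def)
    then show ?thesis by (rule exI)
  next
    case Vertical
    let ?O = "{z \<in> fst (bp_vert S Z p). snd (bp_vert S Z p) z \<in> V}"
    have o: "open ?O" by (rule Bl.open_chart_preimage[OF bp_vert_params[OF p] V])
    have t: "((\<lambda>h. (0, h)) \<longlongrightarrow> (0, 0)) (at 0)" by (intro tendsto_intros)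
    have m: "(0, 0) \<in> ?O" using Exc_vert[OF p, of 0] x Exc Vertical by simp
    obtain h where "h \<noteq> 0" "(0, h) \<in> ?O" using approach_in_open[OF o t m] by (elim exE conjE)
    then have "Base (snd (chart S p) (vert_map (center S p) (0, h))) \<in> V" by (simp add: bp_vert_def)
    then show ?thesis by (rule exI)
  qed
qed

lemma dense_in_blowup:
  assumes "dense_in S \<iota> U"
  shows "dense_in Bl (\<lambda>v. Base (\<iota> v)) U"
  unfolding dense_in_def
proof (intro allI impI)
  fix V assume V: "openin (surf_top Bl) V" "V \<noteq> {}"
  then obtain q where "Base q \<in> V" using Base_part_nonempty by blast
  then have "{q. Base q \<in> V} \<noteq> {}" by blast
  then obtain v where "v \<in> U" "\<iota> v \<in> {q. Base q \<in> V}"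
    using assms openin_Base_part[OF V(1)] unfolding dense_in_def by metis
  then show "\<exists>v\<in>U. Base (\<iota> v) \<in> V" by blast
qed

text \<open>The strict transform of a closure only depends on the set one started with.\<close>

lemma strict_transform_closure:
  "strict_transform S Z (surf_top S closure_of C) = strict_transform S Z (C \<inter> pts S)"
proof -
  interpret Bl: complex_atlas Bl by (rule complex_atlas_blowup)
  let ?cl = "\<lambda>A. surf_top Bl closure_of A"
  have "Base ` (surf_top S closure_of C - Z) \<subseteq> ?cl (Base ` (C \<inter> pts S - Z))"
  proof
    fix x assume "x \<in> Base ` (surf_top S closure_of C - Z)"
    then obtain q where q: "x = Base q" "q \<in> surf_top S closure_of C" "q \<notin> Z" by blast
    have "q \<in> pts S" using q(2) by (auto simp: in_closure_of topspace_surf)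
    show "x \<in> ?cl (Base ` (C \<inter> pts S - Z))"
      unfolding in_closure_of
    proof (intro conjI allI impI)
      show "x \<in> topspace (surf_top Bl)" using q \<open>q \<in> pts S\<close> by (simp add: Bl.topspace_surf)
      fix V assume V: "x \<in> V \<and> openin (surf_top Bl) V"
      then have "q \<in> {q. Base q \<in> V}" "openin (surf_top S) {q. Base q \<in> V}"
        using q openin_Base_part by auto
      then obtain r where r: "r \<in> C" "Base r \<in> V" using q(2) by (auto simp: in_closure_of)
      have "Base r \<in> pts Bl" using V r by (auto simp: openin_surf_iff)
      then show "\<exists>y. y \<in> Base ` (C \<inter> pts S - Z) \<and> y \<in> V" using r by auto
    qed
  qed
  then have "?cl (Base ` (surf_top S closure_of C - Z)) \<subseteq> ?cl (Base ` (C \<inter> pts S - Z))"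
    by (metis closure_of_closure_of closure_of_mono)
  moreover have "?cl (Base ` (C \<inter> pts S - Z)) \<subseteq> ?cl (Base ` (surf_top S closure_of C - Z))"
  proof (intro closure_of_mono image_mono Diff_mono)
    have "C \<inter> pts S \<subseteq> topspace (surf_top S)" by (simp add: topspace_surf)
    from closure_of_subset[OF this] show "C \<inter> pts S \<subseteq> surf_top S closure_of C"
      using closure_of_mono[of "C \<inter> pts S" C "surf_top S"] by blast
  qed simp
  ultimately show ?thesis by (simp add: strict_transform_def)
qed


section \<open>Lifting maps to blowups\<close>

text \<open>
  Off the centers a blowup changes nothing: restrict the coordinate expression to the points that it
  does not take to a center.
\<close>

lemma biholo_at_Base:
  assumes bi: "biholo_at S \<iota> U f p q" and pq: "p \<notin> Z" "q \<notin> Z"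
  shows "biholo_at Bl (\<lambda>v. Base (\<iota> v)) U f (Base p) (Base q)"
proof -
  obtain P Q A \<Phi> z where lf: "local_form S \<iota> U f P Q A \<Phi>" and z: "z \<in> A" "p = snd P z"
    "q = snd Q (\<Phi> z)" and nd: "nondeg \<Phi> z"
    using bi unfolding biholo_at_def by (elim exE conjE)
  have P: "P \<in> params S" and Q: "Q \<in> params S" and h: "holo2 A \<Phi>" and A: "A \<subseteq> fst P"
    and im: "\<Phi> ` A \<subseteq> fst Q" and eq: "\<forall>z\<in>A. \<forall>v\<in>U. snd P z = \<iota> v \<longrightarrow> snd Q (\<Phi> z) = \<iota> (f v)"
    using lf unfolding local_form_def by simp_all
  let ?A = "{x \<in> A. \<Phi> x \<in> {y \<in> fst Q. snd Q y \<notin> Z}} \<inter> {x \<in> fst P. snd P x \<notin> Z}"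
  have "open ?A" using holo2_open_preimage[OF h open_off[OF Q]] open_off[OF P] by (rule open_Int)
  then have "holo2 ?A \<Phi>" by (rule holo2_subset[OF h]) auto
  then have "local_form Bl (\<lambda>v. Base (\<iota> v)) U f (bp_base Z P) (bp_base Z Q) ?A \<Phi>"
    unfolding local_form_def using bp_base_params[OF P] bp_base_params[OF Q] eq
    by (auto simp: bp_base_def)
  moreover have "z \<in> ?A" using z A im pq by auto
  moreover have "Base p = snd (bp_base Z P) z" "Base q = snd (bp_base Z Q) (\<Phi> z)"
    using z by (simp_all add: bp_base_def)
  ultimately show ?thesis unfolding biholo_at_def using nd by (intro exI conjI)
qed

end

text \<open>
  In coordinates (u, v) centered at a and b, the map (u A, u B + v C).  It preserves the line u = 0, and
  its lift to the blowup of the origin needs no division that could fail: in the chart (u, l) with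
  v = u l it is (u A, (B + l C) / A), and at the vertical direction, in the chart (l, v) with u = l v, it
  is (l A / (l B + C), v (l B + C)).  All the maps lifted below have this form, because they preserve the
  line at infinity or the exceptional curve through the center.
\<close>

definition tri_map ::
    "complex \<times> complex \<Rightarrow> complex \<times> complex \<Rightarrow> (complex \<times> complex \<Rightarrow> complex) \<Rightarrow>
      (complex \<times> complex \<Rightarrow> complex) \<Rightarrow> (complex \<times> complex \<Rightarrow> complex) \<Rightarrow>
      complex \<times> complex \<Rightarrow> complex \<times> complex"
  where "tri_map a b A B C z =
    (fst b + (fst z - fst a) * A z, snd b + (fst z - fst a) * B z + (snd z - snd a) * C z)"

text \<open>
  A local form, in the charts chosen at p and q, that is triangular around the two centers.
\<close>

definition tri_form ::
    "'a surf \<Rightarrow> (complex \<times> complex \<Rightarrow> 'a) \<Rightarrow> (complex \<times> complex) set \<Rightarrow>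
      (complex \<times> complex \<Rightarrow> complex \<times> complex) \<Rightarrow> 'a \<Rightarrow> 'a \<Rightarrow> (complex \<times> complex) set \<Rightarrow>
      (complex \<times> complex \<Rightarrow> complex) \<Rightarrow> (complex \<times> complex \<Rightarrow> complex) \<Rightarrow>
      (complex \<times> complex \<Rightarrow> complex) \<Rightarrow> bool"
  where "tri_form S \<iota> U f p q N A B C \<longleftrightarrow>
    open N \<and> center S p \<in> N \<and> N \<subseteq> fst (chart S p) \<and>
    (\<forall>z\<in>N. sdiff A z \<and> sdiff B z \<and> sdiff C z) \<and> A (center S p) \<noteq> 0 \<and> C (center S p) \<noteq> 0 \<and>
    (\<forall>z\<in>N. tri_map (center S p) (center S q) A B C z \<in> fst (chart S q)) \<and>
    (\<forall>z\<in>N. \<forall>v\<in>U. snd (chart S p) z = \<iota> v \<longrightarrow>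
      snd (chart S q) (tri_map (center S p) (center S q) A B C z) = \<iota> (f v))"

lemma tri_formI:
  assumes "chart S p = (UNIV, \<psi>)" "chart S q = (UNIV, \<eta>)" "center S p = a" "center S q = b"
    and "open N" "a \<in> N" "\<And>z. z \<in> N \<Longrightarrow> sdiff A z" "\<And>z. z \<in> N \<Longrightarrow> sdiff B z" "\<And>z. z \<in> N \<Longrightarrow> sdiff C z"
    and "A a \<noteq> 0" "C a \<noteq> 0"
    and "\<And>z v. z \<in> N \<Longrightarrow> v \<in> U \<Longrightarrow> \<psi> z = \<iota> v \<Longrightarrow> \<eta> (tri_map a b A B C z) = \<iota> (f v)"
  shows "tri_form S \<iota> U f p q N A B C"
  unfolding tri_form_def assms(1-4) fst_conv snd_conv
  using assms(5-) by (intro conjI ballI impI UNIV_I subset_UNIV)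

text \<open>
  The exceptional line u = 0 is contracted, so no function pulled back from below varies along it.
\<close>

lemma sder_slope_map:
  assumes "sdiff h a"
  shows "\<exists>\<alpha>. sder (\<lambda>x. h (slope_map a x)) (0, l) \<alpha> 0"
proof -
  obtain \<alpha> \<beta> where h: "sder h a \<alpha> \<beta>" using assms unfolding sdiff_def by auto
  have 1: "sder (\<lambda>x. fst a + fst x) (0, l) 1 0"
    by (rule sder_eq[OF sder_add[OF sder_const sder_fst]]) simp_all
  have 2: "sder (\<lambda>x. snd a + fst x * snd x) (0, l) l 0"
    by (rule sder_eq[OF sder_add[OF sder_const sder_mult[OF sder_fst sder_snd]]]) simp_all
  have "sder (\<lambda>x. h (slope_map a x)) (0, l) (\<alpha> * 1 + \<beta> * l) (\<alpha> * 0 + \<beta> * 0)"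
    unfolding slope_map_def by (rule sder_compose[OF _ 1 2]) (simp add: h)
  then show ?thesis by auto
qed

lemma sder_vert_map:
  assumes "sdiff h a"
  shows "\<exists>\<beta>. sder (\<lambda>x. h (vert_map a x)) (0, 0) 0 \<beta>"
proof -
  obtain \<alpha> \<beta> where h: "sder h a \<alpha> \<beta>" using assms unfolding sdiff_def by auto
  have 1: "sder (\<lambda>x. fst a + fst x * snd x) (0, 0) 0 0"
    by (rule sder_eq[OF sder_add[OF sder_const sder_mult[OF sder_fst sder_snd]]]) simp_all
  have 2: "sder (\<lambda>x. snd a + snd x) (0, 0) 0 1"
    by (rule sder_eq[OF sder_add[OF sder_const sder_snd]]) simp_all
  have "sder (\<lambda>x. h (vert_map a x)) (0, 0) (\<alpha> * 0 + \<beta> * 0) (\<alpha> * 0 + \<beta> * 1)"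
    unfolding vert_map_def by (rule sder_compose[OF _ 1 2]) (simp add: h)
  then show ?thesis by auto
qed

context blowup_data
begin

text \<open>
  Shrinking the domain: no other center may lie in it or be hit from it.
\<close>

lemma tri_form_domain:
  assumes tf: "tri_form S \<iota> U f p q N A B C" and p: "p \<in> Z" and q: "q \<in> Z"
  obtains N' where "open N'" "center S p \<in> N'" "N' \<subseteq> N" "\<forall>z\<in>N'. A z \<noteq> 0"
    "\<forall>z\<in>N'. z \<noteq> center S p \<longrightarrow> snd (chart S p) z \<notin> Z"
    "\<forall>z\<in>N'. tri_map (center S p) (center S q) A B C z \<noteq> center S q \<longrightarrow>
      snd (chart S q) (tri_map (center S p) (center S q) A B C z) \<notin> Z"
proof -
  let ?a = "center S p" and ?b = "center S q"
  let ?P = "chart S p" and ?Q = "chart S q"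
  let ?\<Phi> = "tri_map ?a ?b A B C"
  have N: "open N" "?a \<in> N" "N \<subseteq> fst ?P" and d: "\<forall>z\<in>N. sdiff A z \<and> sdiff B z \<and> sdiff C z"
    and A: "A ?a \<noteq> 0" and im: "\<forall>z\<in>N. ?\<Phi> z \<in> fst ?Q"
    using tf unfolding tri_form_def by simp_all
  let ?E = "\<lambda>R r. {y \<in> fst R. snd R y \<in> Z} - {center S r}"
  have E: "open (- ?E (chart S r) r)" if "r \<in> Z" for r
    using finite_preimage[OF chart_params[OF that]] by (intro open_Compl finite_imp_closed) simp
  have h: "holo2 N ?\<Phi>"
    unfolding holo2_iff tri_map_def using N(1) d by (auto intro!: sdiff_intros)
  have cA: "continuous_on N A"
    using d sdiff_isCont by (auto intro!: continuous_at_imp_continuous_on)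
  let ?N = "{z \<in> N. ?\<Phi> z \<in> - ?E ?Q q} \<inter> (N \<inter> A -` (- {0})) \<inter> - ?E ?P p"
  have o: "open (N \<inter> A -` (- {0}))"
    by (rule continuous_open_preimage[OF cA N(1)]) (simp add: open_Compl)
  have "open ?N"
    by (rule open_Int[OF open_Int[OF holo2_open_preimage[OF h E[OF q]] o] E[OF p]])
  moreover have "?\<Phi> ?a = ?b" by (simp add: tri_map_def)
  then have "?a \<in> ?N" using N A by simp
  moreover have "?N \<subseteq> N" by blast
  moreover have "\<forall>z\<in>?N. A z \<noteq> 0" by simp
  moreover have "\<forall>z\<in>?N. z \<noteq> ?a \<longrightarrow> snd ?P z \<notin> Z" using N(3) by auto
  moreover have "\<forall>z\<in>?N. ?\<Phi> z \<noteq> ?b \<longrightarrow> snd ?Q (?\<Phi> z) \<notin> Z" using im by auto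
  ultimately show thesis by (rule that)
qed

text \<open>
  The lift (u A, (B + l C) / A) has Jacobian C at a point with u = 0, whatever the direction.
\<close>

lemma biholo_at_slope:
  assumes tf: "tri_form S \<iota> U f p q N A B C" and p: "p \<in> Z" and q: "q \<in> Z"
    and l': "l' = (B (center S p) + l * C (center S p)) / A (center S p)"
  shows "biholo_at Bl (\<lambda>v. Base (\<iota> v)) U f (Exc p (Slope l)) (Exc q (Slope l'))"
proof -
  let ?a = "center S p" and ?b = "center S q"
  let ?P = "chart S p" and ?Q = "chart S q"
  let ?\<Phi> = "tri_map ?a ?b A B C"
  have N: "open N" "?a \<in> N" "N \<subseteq> fst ?P" and d: "\<forall>z\<in>N. sdiff A z \<and> sdiff B z \<and> sdiff C z"
    and A: "A ?a \<noteq> 0" and C: "C ?a \<noteq> 0" and im: "\<forall>z\<in>N. ?\<Phi> z \<in> fst ?Q"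
    and eq: "\<forall>z\<in>N. \<forall>v\<in>U. snd ?P z = \<iota> v \<longrightarrow> snd ?Q (?\<Phi> z) = \<iota> (f v)"
    using tf unfolding tri_form_def by simp_all
  obtain N' where N': "open N'" "?a \<in> N'" "N' \<subseteq> N" "\<forall>z\<in>N'. A z \<noteq> 0"
    "\<forall>z\<in>N'. z \<noteq> ?a \<longrightarrow> snd ?P z \<notin> Z" "\<forall>z\<in>N'. ?\<Phi> z \<noteq> ?b \<longrightarrow> snd ?Q (?\<Phi> z) \<notin> Z"
    using tri_form_domain[OF tf p q] by metis
  let ?w = "slope_map ?a"
  let ?M = "{x. ?w x \<in> N'}"
  let ?\<Psi> = "\<lambda>x. (fst x * A (?w x), (B (?w x) + snd x * C (?w x)) / A (?w x))"
  have comp: "sdiff (\<lambda>x. h (?w x)) x" if "sdiff h (?w x)" for h x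
    using that cdiff_slope_map by (rule sdiff_compose_pair)
  have "cdiff ?\<Psi> x" if "x \<in> ?M" for x
  proof -
    have w: "?w x \<in> N'" "?w x \<in> N" using that N'(3) by auto
    then have "sdiff (\<lambda>x. A (?w x)) x" "sdiff (\<lambda>x. B (?w x)) x" "sdiff (\<lambda>x. C (?w x)) x"
      using d by (simp_all add: comp)
    then show ?thesis using N'(4) w by (intro sdiff_intros) simp_all
  qed
  then have h: "holo2 ?M ?\<Psi>" using open_slope_preimage[OF N'(1)] by (simp add: holo2_iff)
  have up: "slope_map ?b (?\<Psi> x) = ?\<Phi> (?w x)" if "x \<in> ?M" for x
  proof -
    have "A (?w x) \<noteq> 0" using that N'(4) by blast
    then have "fst x * A (?w x) * ((B (?w x) + snd x * C (?w x)) / A (?w x)) =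
        fst x * (B (?w x) + snd x * C (?w x))" by simp
    then have "slope_map ?b (?\<Psi> x) =
        (fst ?b + fst x * A (?w x), snd ?b + fst x * (B (?w x) + snd x * C (?w x)))"
      by (simp only: slope_map_def fst_conv snd_conv)
    moreover have "fst (?w x) - fst ?a = fst x" "snd (?w x) - snd ?a = fst x * snd x"
      by (simp_all add: slope_map_def)
    ultimately show ?thesis by (simp only: tri_map_def) (simp add: algebra_simps)
  qed
  have dom: "x \<in> fst (bp_slope S Z p)" if "x \<in> ?M" for x
  proof -
    have w: "?w x \<in> N'" "?w x \<in> N" using that N'(3) by auto
    have "fst x = 0 \<or> ?w x \<noteq> ?a" by (auto simp: slope_map_def prod_eq_iff)
    then show ?thesis using w N(3) N'(5) by (auto simp: bp_slope_def)
  qed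
  have img: "?\<Psi> x \<in> fst (bp_slope S Z q)" if "x \<in> ?M" for x
  proof -
    have w: "?w x \<in> N'" "?w x \<in> N" using that N'(3) by auto
    have "fst (?\<Psi> x) = 0 \<or> ?\<Phi> (?w x) \<noteq> ?b"
      using N'(4) w by (auto simp: slope_map_def tri_map_def prod_eq_iff)
    then have "fst (?\<Psi> x) = 0 \<or> snd ?Q (?\<Phi> (?w x)) \<notin> Z" using N'(6) w by blast
    then show ?thesis using im w(2) by (simp add: bp_slope_def up[OF that])
  qed
  have "local_form Bl (\<lambda>v. Base (\<iota> v)) U f (bp_slope S Z p) (bp_slope S Z q) ?M ?\<Psi>"
    unfolding local_form_def
  proof (intro conjI ballI impI bp_slope_params p q h)
    show "?M \<subseteq> fst (bp_slope S Z p)" using dom by blast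
    show "?\<Psi> ` ?M \<subseteq> fst (bp_slope S Z q)" by (rule image_subsetI) (rule img)
    fix x v assume x: "x \<in> ?M" and v: "v \<in> U" and xv: "snd (bp_slope S Z p) x = Base (\<iota> v)"
    have w: "?w x \<in> N'" "?w x \<in> N" using x N'(3) by auto
    have "fst x \<noteq> 0" "snd ?P (?w x) = \<iota> v" using xv by (auto simp: bp_slope_def split: if_splits)
    moreover from this have "snd ?Q (?\<Phi> (?w x)) = \<iota> (f v)" using eq w(2) v by blast
    ultimately show "snd (bp_slope S Z q) (?\<Psi> x) = Base (\<iota> (f v))"
      using up[OF x] N'(4) w(1) by (simp add: bp_slope_def)
  qed
  moreover have w0: "?w (0, l) = ?a" by (simp add: slope_map_def)
  then have "(0, l) \<in> ?M" using N'(2) by simp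
  moreover have "Exc p (Slope l) = snd (bp_slope S Z p) (0, l)" by (simp add: bp_slope_def)
  moreover have "Exc q (Slope l') = snd (bp_slope S Z q) (?\<Psi> (0, l))"
    using l' w0 by (simp add: bp_slope_def)
  moreover have "nondeg ?\<Psi> (0, l)"
  proof -
    obtain \<alpha> \<beta> \<gamma> where s: "sder (\<lambda>x. A (?w x)) (0, l) \<alpha> 0" "sder (\<lambda>x. B (?w x)) (0, l) \<beta> 0"
      "sder (\<lambda>x. C (?w x)) (0, l) \<gamma> 0"
      using sder_slope_map d N(2) by metis
    have 1: "sder (\<lambda>x. fst (?\<Psi> x)) (0, l) (A ?a) 0"
      unfolding fst_conv by (rule sder_eq[OF sder_mult[OF sder_fst s(1)]]) (simp_all add: w0)
    have "sder (\<lambda>x. B (?w x) + snd x * C (?w x)) (0, l) (\<beta> + l * \<gamma>) (C ?a)"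
      by (rule sder_eq[OF sder_add[OF s(2) sder_mult[OF sder_snd s(3)]]]) (simp_all add: w0)
    from sder_divide[OF this s(1)] A
    have 2: "sder (\<lambda>x. snd (?\<Psi> x)) (0, l)
        (((\<beta> + l * \<gamma>) * A ?a - (B ?a + l * C ?a) * \<alpha>) / (A ?a)\<^sup>2) (C ?a / A ?a)"
      by (simp add: w0 power2_eq_square)
    show ?thesis by (rule nondegI[OF 1 2]) (use A C in simp)
  qed
  ultimately show ?thesis unfolding biholo_at_def by (intro exI conjI)
qed

text \<open>
  The lift (l A / (l B + C), v (l B + C)) has Jacobian A at the origin.
\<close>

lemma biholo_at_vertical:
  assumes tf: "tri_form S \<iota> U f p q N A B C" and p: "p \<in> Z" and q: "q \<in> Z"
  shows "biholo_at Bl (\<lambda>v. Base (\<iota> v)) U f (Exc p Vertical) (Exc q Vertical)"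
proof -
  let ?a = "center S p" and ?b = "center S q"
  let ?P = "chart S p" and ?Q = "chart S q"
  let ?\<Phi> = "tri_map ?a ?b A B C"
  have N: "open N" "?a \<in> N" "N \<subseteq> fst ?P" and d: "\<forall>z\<in>N. sdiff A z \<and> sdiff B z \<and> sdiff C z"
    and A: "A ?a \<noteq> 0" and C: "C ?a \<noteq> 0" and im: "\<forall>z\<in>N. ?\<Phi> z \<in> fst ?Q"
    and eq: "\<forall>z\<in>N. \<forall>v\<in>U. snd ?P z = \<iota> v \<longrightarrow> snd ?Q (?\<Phi> z) = \<iota> (f v)"
    using tf unfolding tri_form_def by simp_all
  obtain N' where N': "open N'" "?a \<in> N'" "N' \<subseteq> N" "\<forall>z\<in>N'. A z \<noteq> 0"
    "\<forall>z\<in>N'. z \<noteq> ?a \<longrightarrow> snd ?P z \<notin> Z" "\<forall>z\<in>N'. ?\<Phi> z \<noteq> ?b \<longrightarrow> snd ?Q (?\<Phi> z) \<notin> Z"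
    using tri_form_domain[OF tf p q] by metis
  let ?w = "vert_map ?a"
  let ?D = "\<lambda>x. fst x * B (?w x) + C (?w x)"
  let ?K = "{x. ?w x \<in> N'}"
  let ?M = "?K \<inter> ?D -` (- {0})"
  let ?\<Psi> = "\<lambda>x. (fst x * A (?w x) / ?D x, snd x * ?D x)"
  have comp: "sdiff (\<lambda>x. h (?w x)) x" if "sdiff h (?w x)" for h x
    using that cdiff_vert_map by (rule sdiff_compose_pair)
  have s: "sdiff (\<lambda>x. A (?w x)) x" "sdiff ?D x" if "x \<in> ?K" for x
  proof -
    have w: "?w x \<in> N" using that N'(3) by auto
    then have 1: "sdiff (\<lambda>x. A (?w x)) x" "sdiff (\<lambda>x. B (?w x)) x" "sdiff (\<lambda>x. C (?w x)) x"
      using d by (simp_all add: comp)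
    show "sdiff (\<lambda>x. A (?w x)) x" by (rule 1)
    show "sdiff ?D x" using 1 by (intro sdiff_intros)
  qed
  have K: "open ?K" by (rule open_vert_preimage[OF N'(1)])
  have "continuous_on ?K ?D"
    by (rule continuous_at_imp_continuous_on) (use s(2) sdiff_isCont in blast)
  then have M: "open ?M" by (rule continuous_open_preimage) (use K in \<open>simp_all add: open_Compl\<close>)
  have "cdiff ?\<Psi> x" if "x \<in> ?M" for x
    using s[of x] that by (intro cdiff_PairI sdiff_divide sdiff_mult sdiff_fst sdiff_snd) simp_all
  then have h: "holo2 ?M ?\<Psi>" using M by (simp add: holo2_iff)
  have up: "vert_map ?b (?\<Psi> x) = ?\<Phi> (?w x)" if "x \<in> ?M" for x
  proof -
    have "?D x \<noteq> 0" using that by simp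
    then have "fst x * A (?w x) / ?D x * (snd x * ?D x) = fst x * snd x * A (?w x)" by simp
    then have "vert_map ?b (?\<Psi> x) = (fst ?b + fst x * snd x * A (?w x), snd ?b + snd x * ?D x)"
      by (simp only: vert_map_def fst_conv snd_conv)
    moreover have "fst (?w x) - fst ?a = fst x * snd x" "snd (?w x) - snd ?a = snd x"
      by (simp_all add: vert_map_def)
    ultimately show ?thesis by (simp only: tri_map_def) (simp add: algebra_simps)
  qed
  have dom: "x \<in> fst (bp_vert S Z p)" if "x \<in> ?M" for x
  proof -
    have w: "?w x \<in> N'" "?w x \<in> N" using that N'(3) by auto
    have "snd x = 0 \<or> ?w x \<noteq> ?a" by (auto simp: vert_map_def prod_eq_iff)
    then show ?thesis using w N(3) N'(5) by (auto simp: bp_vert_def)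
  qed
  have ne: "?\<Phi> (?w x) \<noteq> ?b" if "x \<in> ?M" "snd x \<noteq> 0" for x
  proof -
    have "snd (vert_map ?b (?\<Psi> x)) \<noteq> snd ?b" using that by (simp add: vert_map_def)
    then show ?thesis using up[OF that(1)] by auto
  qed
  have img: "?\<Psi> x \<in> fst (bp_vert S Z q)" if "x \<in> ?M" for x
  proof -
    have w: "?w x \<in> N'" "?w x \<in> N" using that N'(3) by auto
    have "snd (?\<Psi> x) = 0 \<or> ?\<Phi> (?w x) \<noteq> ?b" using ne[OF that] by auto
    then have "snd (?\<Psi> x) = 0 \<or> snd ?Q (?\<Phi> (?w x)) \<notin> Z" using N'(6) w by blast
    then show ?thesis using im w(2) unfolding bp_vert_def fst_conv mem_Collect_eq up[OF that] by blast
  qed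
  have "local_form Bl (\<lambda>v. Base (\<iota> v)) U f (bp_vert S Z p) (bp_vert S Z q) ?M ?\<Psi>"
    unfolding local_form_def
  proof (intro conjI ballI impI bp_vert_params p q h)
    show "?M \<subseteq> fst (bp_vert S Z p)" using dom by blast
    show "?\<Psi> ` ?M \<subseteq> fst (bp_vert S Z q)" by (rule image_subsetI) (rule img)
    fix x v assume x: "x \<in> ?M" and v: "v \<in> U" and xv: "snd (bp_vert S Z p) x = Base (\<iota> v)"
    have w: "?w x \<in> N" using x N'(3) by auto
    have sx: "snd x \<noteq> 0" "snd ?P (?w x) = \<iota> v" using xv by (auto simp: bp_vert_def split: if_splits)
    then have "snd ?Q (?\<Phi> (?w x)) = \<iota> (f v)" using eq w v by blast
    moreover have "snd (?\<Psi> x) \<noteq> 0" using sx x by simp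
    ultimately show "snd (bp_vert S Z q) (?\<Psi> x) = Base (\<iota> (f v))"
      unfolding bp_vert_def snd_conv[of _ "\<lambda>x. _ x"] up[OF x, symmetric] by simp
  qed
  moreover have w0: "?w (0, 0) = ?a" by (simp add: vert_map_def)
  then have "(0, 0) \<in> ?M" using N'(2) C by simp
  moreover have "Exc p Vertical = snd (bp_vert S Z p) (0, 0)" by (simp add: bp_vert_def)
  moreover have "Exc q Vertical = snd (bp_vert S Z q) (?\<Psi> (0, 0))" by (simp add: bp_vert_def)
  moreover have "nondeg ?\<Psi> (0, 0)"
  proof -
    have "sdiff A ?a" using d N(2) by blast
    then obtain \<beta> where 1: "sder (\<lambda>x. A (?w x)) (0, 0) 0 \<beta>" using sder_vert_map by metis
    have "(0, 0) \<in> ?K" using w0 N'(2) by simp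
    then obtain d1 d2 where D: "sder ?D (0, 0) d1 d2" using s(2) unfolding sdiff_def by metis
    have D0: "?D (0, 0) = C ?a" by (simp add: w0)
    have 2: "sder (\<lambda>x. fst x * A (?w x)) (0, 0) (A ?a) 0"
      by (rule sder_eq[OF sder_mult[OF sder_fst 1]]) (simp_all add: w0)
    have 3: "sder (\<lambda>x. fst (?\<Psi> x)) (0, 0) (A ?a / C ?a) 0"
      unfolding fst_conv by (rule sder_eq[OF sder_divide[OF 2 D]])
        (use C in \<open>simp_all add: w0 power2_eq_square\<close>)
    have 4: "sder (\<lambda>x. snd (?\<Psi> x)) (0, 0) 0 (C ?a)"
      unfolding snd_conv by (rule sder_eq[OF sder_mult[OF sder_snd D]]) (simp_all add: w0)
    show ?thesis by (rule nondegI[OF 3 4]) (use A C in simp)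
  qed
  ultimately show ?thesis unfolding biholo_at_def by (intro exI conjI)
qed

end

section \<open>The projective plane\<close>

lemma hom_eq_iff: "hom t x y = hom t' x' y' \<longleftrightarrow> (\<exists>k. k \<noteq> 0 \<and> t' = k * t \<and> x' = k * x \<and> y' = k * y)"
proof
  assume "hom t x y = hom t' x' y'"
  moreover have "(t', x', y') \<in> hom t' x' y'" unfolding hom_def by (auto intro: exI[of _ 1])
  ultimately have "(t', x', y') \<in> hom t x y" by simp
  then show "\<exists>k. k \<noteq> 0 \<and> t' = k * t \<and> x' = k * x \<and> y' = k * y" unfolding hom_def by auto
next
  assume "\<exists>k. k \<noteq> 0 \<and> t' = k * t \<and> x' = k * x \<and> y' = k * y"
  then obtain k where k: "k \<noteq> 0" "t' = k * t" "x' = k * x" "y' = k * y" by blast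
  have "(a * t, a * x, a * y) \<in> hom t' x' y'" if "a \<noteq> 0" for a
    unfolding hom_def mem_Collect_eq
    by (rule exI[of _ "a / k"]) (use k that in simp)
  moreover have "(a * t', a * x', a * y') \<in> hom t x y" if "a \<noteq> 0" for a
    unfolding hom_def mem_Collect_eq
    by (rule exI[of _ "a * k"]) (use k that in simp)
  ultimately show "hom t x y = hom t' x' y'" unfolding hom_def[of t x y] hom_def[of t' x' y'] by auto
qed

text \<open>
  The proportionality factor between two triples in which a coordinate is normalized to 1.
\<close>

lemma eq_mult_one_iff: "1 = k * t \<longleftrightarrow> t \<noteq> 0 \<and> k = 1 / t" for k t :: complex
  by (cases "t = 0") (auto simp: eq_divide_eq)

lemma hom_eq_simps:
  "hom 1 x y = hom 1 x' y' \<longleftrightarrow> x' = x \<and> y' = y"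
  "hom t 1 y = hom t' 1 y' \<longleftrightarrow> t' = t \<and> y' = y"
  "hom t x 1 = hom t' x' 1 \<longleftrightarrow> t' = t \<and> x' = x"
  "hom t 1 y = hom 1 x' y' \<longleftrightarrow> t \<noteq> 0 \<and> x' = 1 / t \<and> y' = y / t"
  "hom 1 x y = hom t' 1 y' \<longleftrightarrow> x \<noteq> 0 \<and> t' = 1 / x \<and> y' = y / x"
  "hom t x 1 = hom 1 x' y' \<longleftrightarrow> t \<noteq> 0 \<and> x' = x / t \<and> y' = 1 / t"
  "hom 1 x y = hom t' x' 1 \<longleftrightarrow> y \<noteq> 0 \<and> t' = 1 / y \<and> x' = x / y"
  "hom t x 1 = hom t' 1 y' \<longleftrightarrow> x \<noteq> 0 \<and> t' = t / x \<and> y' = 1 / x"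
  "hom t 1 y = hom t' x' 1 \<longleftrightarrow> y \<noteq> 0 \<and> t' = t / y \<and> x' = 1 / y"
  unfolding hom_eq_iff by (auto simp: eq_mult_one_iff)

definition aff0 :: "p2 param" where "aff0 = (UNIV, \<lambda>z. hom 1 (fst z) (snd z))"
definition aff1 :: "p2 param" where "aff1 = (UNIV, \<lambda>z. hom (fst z) 1 (snd z))"
definition aff2 :: "p2 param" where "aff2 = (UNIV, \<lambda>z. hom (fst z) (snd z) 1)"

lemma chart_P2:
  "chart P2 p = (if \<exists>x y. p = hom 1 x y then aff0 else if \<exists>y. p = hom 0 1 y then aff1 else aff2)"
  by (simp add: P2_def aff0_def aff1_def aff2_def case_prod_beta')

lemma hom_in_P2: "(t, x, y) \<noteq> (0, 0, 0) \<Longrightarrow> hom t x y \<in> pts P2"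
  unfolding P2_def by auto

lemma P2_cases:
  assumes "p \<in> pts P2"
  obtains x y where "p = hom 1 x y" | y where "p = hom 0 1 y" | "p = hom 0 0 1"
proof -
  obtain t x y where p: "p = hom t x y" "(t, x, y) \<noteq> (0, 0, 0)"
    using assms unfolding P2_def by auto
  consider "t \<noteq> 0" | "t = 0" "x \<noteq> 0" | "t = 0" "x = 0" "y \<noteq> 0" using p(2) by auto
  then show thesis
  proof cases
    case 1
    have "p = hom 1 (x / t) (y / t)"
      unfolding p(1) hom_eq_iff by (rule exI[of _ "1 / t"]) (use 1 in simp)
    then show thesis by (rule that(1))
  next
    case 2
    have "p = hom 0 1 (y / x)"
      unfolding p(1) hom_eq_iff by (rule exI[of _ "1 / x"]) (use 2 in simp)
    then show thesis by (rule that(2))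
  next
    case 3
    have "p = hom 0 0 1"
      unfolding p(1) hom_eq_iff by (rule exI[of _ "1 / y"]) (use 3 in simp)
    then show thesis by (rule that(3))
  qed
qed

lemma aff_change:
  assumes "P \<in> {aff0, aff1, aff2}" "Q \<in> {aff0, aff1, aff2}" and z: "snd P z \<in> snd Q ` fst Q"
  shows "coord_change P Q z"
proof -
  have D: "open {z::complex \<times> complex. fst z \<noteq> 0}" "open {z::complex \<times> complex. snd z \<noteq> 0}"
    by (rule open_fst_neq, rule open_snd_neq)
  have h: "holo2 {z. fst z \<noteq> 0} (\<lambda>z. (1 / fst z, snd z / fst z))"
    "holo2 {z. snd z \<noteq> 0} (\<lambda>z. (1 / snd z, fst z / snd z))"
    "holo2 {z. snd z \<noteq> 0} (\<lambda>z. (fst z / snd z, 1 / snd z))"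
    "holo2 {z. fst z \<noteq> 0} (\<lambda>z. (snd z / fst z, 1 / fst z))"
    using D by (auto simp: holo2_iff intro!: sdiff_intros)
  have U: "open (fst aff0)" "open (fst aff1)" "open (fst aff2)"
    by (simp_all add: aff0_def aff1_def aff2_def)
  consider "P = Q" | "P = aff0" "Q = aff1" | "P = aff0" "Q = aff2" | "P = aff1" "Q = aff0"
    | "P = aff1" "Q = aff2" | "P = aff2" "Q = aff0" | "P = aff2" "Q = aff1" using assms(1,2) by auto
  then show ?thesis
  proof cases
    case 1
    then show ?thesis using coord_change_refl[of P z] assms(1) U
      by (auto simp: aff0_def aff1_def aff2_def)
  next
    case 2
    show ?thesis
      by (rule coord_changeI[OF h(1)]) (use z 2 in \<open>auto simp: aff0_def aff1_def hom_eq_simps\<close>)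
  next
    case 3
    show ?thesis
      by (rule coord_changeI[OF h(2)]) (use z 3 in \<open>auto simp: aff0_def aff2_def hom_eq_simps\<close>)
  next
    case 4
    show ?thesis
      by (rule coord_changeI[OF h(1)]) (use z 4 in \<open>auto simp: aff0_def aff1_def hom_eq_simps\<close>)
  next
    case 5
    show ?thesis
      by (rule coord_changeI[OF h(3)]) (use z 5 in \<open>auto simp: aff1_def aff2_def hom_eq_simps\<close>)
  next
    case 6
    show ?thesis
      by (rule coord_changeI[OF h(4)]) (use z 6 in \<open>auto simp: aff0_def aff2_def hom_eq_simps\<close>)
  next
    case 7
    show ?thesis
      by (rule coord_changeI[OF h(3)]) (use z 7 in \<open>auto simp: aff1_def aff2_def hom_eq_simps\<close>)
  qed
qed

lemma atlas_P2: "atlas P2 \<subseteq> {aff0, aff1, aff2}"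
  unfolding atlas_def chart_P2 by auto

lemma aff_params: "P \<in> {aff0, aff1, aff2} \<Longrightarrow> P \<in> params P2"
proof -
  assume P: "P \<in> {aff0, aff1, aff2}"
  have "open (fst P)" using P by (auto simp: aff0_def aff1_def aff2_def)
  moreover have "inj_on (snd P) (fst P)"
    using P by (auto simp: aff0_def aff1_def aff2_def inj_on_def hom_eq_simps)
  moreover have "snd P ` fst P \<subseteq> pts P2"
    using P by (auto simp: aff0_def aff1_def aff2_def hom_in_P2)
  ultimately show ?thesis
    unfolding params_def mem_Collect_eq using aff_change[OF P] aff_change[OF _ P] atlas_P2
    by (meson subsetD)
qed

interpretation P2: complex_atlas P2
proof
  fix p assume "p \<in> pts P2"
  then show "p \<in> snd (chart P2 p) ` fst (chart P2 p)"
  proof (cases rule: P2_cases)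
    case (1 x y)
    then have "chart P2 p = aff0" by (auto simp: chart_P2)
    then show ?thesis using 1 by (auto simp: aff0_def intro!: image_eqI[of _ _ "(x, y)"])
  next
    case (2 y)
    then have "chart P2 p = aff1" by (simp add: chart_P2 hom_eq_simps)
    then show ?thesis using 2 by (auto simp: aff1_def intro!: image_eqI[of _ _ "(0, y)"])
  next
    case 3
    then have "chart P2 p = aff2" by (simp add: chart_P2 hom_eq_simps)
    then show ?thesis using 3 by (auto simp: aff2_def intro!: image_eqI[of _ _ "(0, 0)"])
  qed
next
  show "P \<in> atlas P2 \<Longrightarrow> P \<in> params P2" for P using atlas_P2 aff_params by blast
qed

lemma separate_in_chart:
  assumes "complex_atlas S" and P: "P \<in> params S" and z: "z \<in> fst P" "w \<in> fst P" "z \<noteq> w"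
  shows "\<exists>V W. openin (surf_top S) V \<and> openin (surf_top S) W \<and> snd P z \<in> V \<and> snd P w \<in> W \<and> disjnt V W"
proof -
  interpret complex_atlas S by fact
  from hausdorff[OF z(3)] obtain A B where
    AB: "open A" "open B" "z \<in> A" "w \<in> B" "A \<inter> B = {}" by (elim exE conjE)
  have o: "open (A \<inter> fst P)" "open (B \<inter> fst P)" using AB params_open[OF P] by (simp_all add: open_Int)
  have "disjnt (snd P ` (A \<inter> fst P)) (snd P ` (B \<inter> fst P))"
    unfolding disjnt_def using AB(5) params_inj[OF P]
    by (subst inj_on_image_Int[of "snd P" "fst P", symmetric]) auto
  moreover have "openin (surf_top S) (snd P ` (A \<inter> fst P))"
    by (rule openin_chart_image[OF P o(1)]) simp
  moreover have "openin (surf_top S) (snd P ` (B \<inter> fst P))"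
    by (rule openin_chart_image[OF P o(2)]) simp
  moreover have "snd P z \<in> snd P ` (A \<inter> fst P)" using AB z by simp
  moreover have "snd P w \<in> snd P ` (B \<inter> fst P)" using AB z by simp
  ultimately show ?thesis
    by (intro exI[of _ "snd P ` (A \<inter> fst P)"] exI[of _ "snd P ` (B \<inter> fst P)"] conjI)
qed

text \<open>
  Two homogeneous coordinates, each vanishing at one of the two points: where their ratio is small
  one is close to the first point, and where the inverse ratio is small to the second.
\<close>

lemma separate_by_ratio:
  fixes g h :: "complex \<times> complex \<Rightarrow> complex"
  assumes "complex_atlas S" and P: "P \<in> params S" "fst P = UNIV" and Q: "Q \<in> params S" "fst Q = UNIV"
    and gh: "continuous_on UNIV g" "continuous_on UNIV h" "g z = 0" "h w = 0"
    and ratio: "\<And>x y. snd P x = snd Q y \<Longrightarrow> g x * h y = 1"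
  shows "\<exists>V W. openin (surf_top S) V \<and> openin (surf_top S) W \<and> snd P z \<in> V \<and> snd Q w \<in> W \<and> disjnt V W"
proof -
  interpret complex_atlas S by fact
  let ?A = "{x. norm (g x) < 1}" and ?B = "{x. norm (h x) < 1}"
  have "open ?A" "open ?B" using gh by (auto intro!: open_Collect_less continuous_intros)
  then have "openin (surf_top S) (snd P ` ?A)" "openin (surf_top S) (snd Q ` ?B)"
    using openin_chart_image P Q by simp_all
  moreover have "disjnt (snd P ` ?A) (snd Q ` ?B)"
    unfolding disjnt_def
  proof (rule equals0I)
    fix q assume "q \<in> snd P ` ?A \<inter> snd Q ` ?B"
    then have q: "q \<in> snd P ` ?A" "q \<in> snd Q ` ?B" by (rule IntD1, rule IntD2)
    obtain x where x: "q = snd P x" "x \<in> ?A" using q(1) by (rule imageE)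
    obtain y where y: "q = snd Q y" "y \<in> ?B" using q(2) by (rule imageE)
    have "norm (g x) * norm (h y) < 1 * 1"
      using x y by (intro mult_strict_mono') simp_all
    moreover have "norm (g x * h y) = 1" using ratio[of x y] x y by simp
    ultimately show False by (simp add: norm_mult)
  qed
  moreover have "snd P z \<in> snd P ` ?A" "snd Q w \<in> snd Q ` ?B" using gh by simp_all
  ultimately show ?thesis
    by (intro exI[of _ "snd P ` ?A"] exI[of _ "snd Q ` ?B"] conjI)
qed

text \<open>
  Two points that lie in a common affine chart are separated there; otherwise two coordinates vanish at
  one of the points each, and \<open>separate_by_ratio\<close> applies.
\<close>

lemma Hausdorff_P2: "Hausdorff_space (surf_top P2)"
proof -
  let ?sep = "\<lambda>p q. \<exists>V W. openin (surf_top P2) V \<and> openin (surf_top P2) W \<and> p \<in> V \<and> q \<in> W \<and> disjnt V W"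
  have sym: "?sep q p" if "?sep p q" for p q
    using that by (elim exE conjE) (intro exI conjI, assumption+, simp add: disjnt_sym)
  have same: "?sep (snd P z) (snd P w)" if "P \<in> {aff0, aff1, aff2}" "snd P z \<noteq> snd P w" for P z w
  proof (rule separate_in_chart[OF P2.complex_atlas_axioms aff_params[OF that(1)]])
    show "z \<in> fst P" "w \<in> fst P" using that(1) by (auto simp: aff0_def aff1_def aff2_def)
    show "z \<noteq> w" using that(2) by auto
  qed
  have "?sep p q" if "p \<in> pts P2" "q \<in> pts P2" "p \<noteq> q" for p q
  proof -
    have c01: "?sep (hom 1 x y) (hom 0 1 y')" for x y y'
    proof (cases "x = 0")
      case False
      then have "hom 1 x y = snd aff1 (1 / x, y / x)" by (simp add: aff1_def hom_eq_simps)
      moreover have "hom 0 1 y' = snd aff1 (0, y')" by (simp add: aff1_def)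
      moreover have "hom 1 x y \<noteq> hom 0 1 y'" by (simp add: hom_eq_simps)
      ultimately show ?thesis using same[of aff1] by simp
    next
      case True
      show ?thesis
        using separate_by_ratio[OF P2.complex_atlas_axioms aff_params[of aff0] _ aff_params[of aff1] _
            continuous_on_fst[OF continuous_on_id] continuous_on_fst[OF continuous_on_id],
            of "(x, y)" "(0, y')"] True
        by (auto simp: aff0_def aff1_def hom_eq_simps)
    qed
    have c02: "?sep (hom 1 x y) (hom 0 0 1)" for x y
    proof (cases "y = 0")
      case False
      then have "hom 1 x y = snd aff2 (1 / y, x / y)" by (simp add: aff2_def hom_eq_simps)
      moreover have "hom 0 0 1 = snd aff2 (0, 0)" by (simp add: aff2_def)
      moreover have "hom 1 x y \<noteq> hom 0 0 1" by (simp add: hom_eq_simps)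
      ultimately show ?thesis using same[of aff2] by simp
    next
      case True
      show ?thesis
        using separate_by_ratio[OF P2.complex_atlas_axioms aff_params[of aff0] _ aff_params[of aff2] _
            continuous_on_snd[OF continuous_on_id] continuous_on_fst[OF continuous_on_id],
            of "(x, y)" "(0, 0)"] True
        by (auto simp: aff0_def aff2_def hom_eq_simps)
    qed
    have c12: "?sep (hom 0 1 y) (hom 0 0 1)" for y
    proof (cases "y = 0")
      case False
      then have "hom 0 1 y = snd aff2 (0, 1 / y)" by (simp add: aff2_def hom_eq_simps)
      moreover have "hom 0 0 1 = snd aff2 (0, 0)" by (simp add: aff2_def)
      moreover have "hom 0 1 y \<noteq> hom 0 0 1" by (simp add: hom_eq_simps)
      ultimately show ?thesis using same[of aff2] by simp
    next
      case True
      show ?thesis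
        using separate_by_ratio[OF P2.complex_atlas_axioms aff_params[of aff1] _ aff_params[of aff2] _
            continuous_on_snd[OF continuous_on_id] continuous_on_snd[OF continuous_on_id],
            of "(0, y)" "(0, 0)"] True
        by (auto simp: aff1_def aff2_def hom_eq_simps)
    qed
    have c00: "?sep (hom 1 x y) (hom 1 x' y')" if "hom 1 x y \<noteq> hom 1 x' y'" for x y x' y'
      using same[of aff0 "(x, y)" "(x', y')"] that by (simp add: aff0_def)
    have c11: "?sep (hom 0 1 y) (hom 0 1 y')" if "hom 0 1 y \<noteq> hom 0 1 y'" for y y'
      using same[of aff1 "(0, y)" "(0, y')"] that by (simp add: aff1_def)
    from that(1) show ?thesis
    proof (cases rule: P2_cases)
      case (1 x y)
      from that(2) show ?thesis
        by (cases rule: P2_cases) (use 1 that(3) c00 c01 c02 in simp_all)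
    next
      case (2 y)
      from that(2) show ?thesis
        by (cases rule: P2_cases) (use 2 that(3) sym[OF c01] c11 c12 in simp_all)
    next
      case 3
      from that(2) show ?thesis
        by (cases rule: P2_cases) (use 3 that(3) sym[OF c02] sym[OF c12] in simp_all)
    qed
  qed
  then show ?thesis unfolding Hausdorff_space_def P2.topspace_surf by simp
qed

interpretation P2: complex_surface P2
  by unfold_locales (rule Hausdorff_P2)

text \<open>
  A nonempty open set is not contained in the union of the two axes.
\<close>

lemma open_nonzero:
  assumes V: "open V" "z \<in> V"
  shows "\<exists>w::complex \<times> complex. w \<in> V \<and> fst w \<noteq> 0 \<and> snd w \<noteq> 0"
proof -
  have "\<exists>w. w \<in> V \<and> fst w \<noteq> 0"
  proof (cases "fst z = 0")
    case True
    have "((\<lambda>h. (h, snd z)) \<longlongrightarrow> (0, snd z)) (at 0)" by (intro tendsto_intros)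
    moreover have "(0, snd z) \<in> V" using V(2) True by (cases z) simp
    ultimately obtain h where "h \<noteq> 0" "(h, snd z) \<in> V"
      by (rule approach_in_open[OF V(1), THEN exE]) (elim conjE)
    then show ?thesis by (intro exI[of _ "(h, snd z)"]) simp
  next
    case False
    then show ?thesis using V(2) by blast
  qed
  then obtain w where w: "w \<in> V" "fst w \<noteq> 0" by blast
  show ?thesis
  proof (cases "snd w = 0")
    case True
    have "((\<lambda>h. (fst w, h)) \<longlongrightarrow> (fst w, 0)) (at 0)" by (intro tendsto_intros)
    moreover have "(fst w, 0) \<in> V" using w(1) True by (cases w) simp
    ultimately obtain h where "h \<noteq> 0" "(fst w, h) \<in> V"
      by (rule approach_in_open[OF V(1), THEN exE]) (elim conjE)
    then show ?thesis using w(2) by (intro exI[of _ "(fst w, h)"]) simp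
  next
    case False
    then show ?thesis using w by blast
  qed
qed

lemma dense_in_P2: "dense_in P2 emb fdom"
  unfolding dense_in_def
proof (intro allI impI)
  fix V assume V: "openin (surf_top P2) V" "V \<noteq> {}"
  then obtain p where p: "p \<in> V" by blast
  then have "p \<in> pts P2" using V by (auto simp: openin_surf_iff)
  then obtain P z where P: "P \<in> atlas P2" "z \<in> fst P" "snd P z = p" by (rule P2.chartE)
  have "open {z \<in> fst P. snd P z \<in> V}" using P(1) V by (simp add: openin_surf_iff)
  moreover have "z \<in> {z \<in> fst P. snd P z \<in> V}" using P p by simp
  ultimately have "\<exists>w. w \<in> {z \<in> fst P. snd P z \<in> V} \<and> fst w \<noteq> 0 \<and> snd w \<noteq> 0"
    by (rule open_nonzero)
  then obtain w where w: "w \<in> {z \<in> fst P. snd P z \<in> V}" "fst w \<noteq> 0" "snd w \<noteq> 0"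
    by (elim exE conjE)
  have "P \<in> {aff0, aff1, aff2}" using P(1) atlas_P2 by blast
  then have "\<exists>v\<in>fdom. emb v = snd P w"
  proof (elim insertE emptyE)
    assume "P = aff0"
    then show ?thesis using w by (intro bexI[of _ w]) (auto simp: aff0_def emb_def fdom_def case_prod_beta)
  next
    assume "P = aff1"
    then show ?thesis using w
      by (intro bexI[of _ "(1 / fst w, snd w / fst w)"]) (auto simp: aff1_def emb_def fdom_def hom_eq_simps)
  next
    assume "P = aff2"
    then show ?thesis using w
      by (intro bexI[of _ "(snd w / fst w, 1 / fst w)"]) (auto simp: aff2_def emb_def fdom_def hom_eq_simps)
  qed
  then obtain v where "v \<in> fdom" "emb v = snd P w" by (elim bexE)
  then show "\<exists>v\<in>fdom. emb v \<in> V" using w(1) by (intro bexI[of _ v]) simp_all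
qed

section \<open>The first two blowups\<close>

lemma omega_Suc: "1 \<le> s \<Longrightarrow> omega \<delta> c (Suc s) = c - \<delta> / omega \<delta> c s"
  by (cases s) (simp_all add: omega_def)

lemma emb_eq: "emb v = hom 1 (fst v) (snd v)"
  by (simp add: emb_def case_prod_beta)

lemma fmap_eq: "fmap \<delta> c v = (snd v, - \<delta> * fst v + c * snd v + 1 / snd v)"
  by (simp add: fmap_def case_prod_beta)

lemma fdom_iff: "v \<in> fdom \<longleftrightarrow> snd v \<noteq> 0"
  by (simp add: fdom_def case_prod_beta)

text \<open>
  From the chart at infinity that contains [0:0:1] to the one that contains [0:1:0], the map is a
  polynomial automorphism of the plane; the other two lemmas express it in the remaining pairs of
  charts at infinity.
\<close>

lemma fmap_aff21:
  assumes "snd aff2 z = emb v"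
  shows "emb (fmap \<delta> c v) = snd aff1 (fst z, c - \<delta> * snd z + (fst z)\<^sup>2)"
  using assms by (auto simp: aff2_def aff1_def emb_eq fmap_eq hom_eq_simps field_simps power2_eq_square)

lemma fmap_aff11:
  assumes "snd aff1 z = emb v" "v \<in> fdom"
  shows "snd z \<noteq> 0" "emb (fmap \<delta> c v) = snd aff1 (fst z / snd z, c - \<delta> / snd z + (fst z / snd z)\<^sup>2)"
  using assms
  by (auto simp: aff1_def emb_eq fmap_eq fdom_iff hom_eq_simps field_simps power2_eq_square)

lemma fmap_aff12:
  assumes "snd aff1 z = emb v" "v \<in> fdom" and D: "D = (fst z)\<^sup>2 + snd z * (c * snd z - \<delta>)" "D \<noteq> 0"
  shows "emb (fmap \<delta> c v) = snd aff2 (fst z * snd z / D, (snd z)\<^sup>2 / D)"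
proof -
  obtain t w where z: "z = (t, w)" by (cases z)
  have v: "t \<noteq> 0" "w \<noteq> 0" "fst v = 1 / t" "snd v = w / t"
    using assms(1,2) z by (auto simp: aff1_def emb_eq fdom_iff hom_eq_simps)
  have "- \<delta> * (1 / t) + c * (w / t) + 1 / (w / t) = D / (t * w)"
    using v(1,2) by (simp add: D(1) z field_simps power2_eq_square)
  then have "emb (fmap \<delta> c v) = hom 1 (w / t) (D / (t * w))"
    by (simp only: emb_eq fmap_eq v fst_conv snd_conv)
  then show ?thesis
    using v(1,2) D(2) by (simp add: aff2_def hom_eq_simps z power2_eq_square)
qed

text \<open>
  The second coordinate of the center \<^term>\<open>pnt \<delta> c s\<close> in its affine chart at infinity.  With this and
  \<open>aff_at\<close>, the center [0:0:1] needs no separate treatment where only the blowups are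
  concerned: in both cases it lies at (0, om) and the line through it is horizontal.
\<close>

definition om :: "complex \<Rightarrow> complex \<Rightarrow> nat \<Rightarrow> complex"
  where "om \<delta> c s = (if s = 0 then 0 else omega \<delta> c s)"

definition aff_at :: "nat \<Rightarrow> p2 param"
  where "aff_at s = (if s = 0 then aff2 else aff1)"

lemma fst_aff_at [simp]: "fst (aff_at s) = UNIV"
  by (simp add: aff_at_def aff1_def aff2_def)

lemma aff_at_UNIV: "aff_at s = (UNIV, snd (aff_at s))"
  by (metis fst_aff_at prod.collapse)

lemma aff_at_params: "aff_at s \<in> params P2"
  by (simp add: aff_at_def aff_params)

lemma pnt_aff_at: "pnt \<delta> c s = snd (aff_at s) (0, om \<delta> c s)"
  by (simp add: pnt_def aff_at_def om_def aff1_def aff2_def)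

lemma chart_pnt: "chart P2 (pnt \<delta> c s) = aff_at s"
  by (simp add: pnt_def chart_P2 aff_at_def hom_eq_simps)

lemma center_pnt: "center P2 (pnt \<delta> c s) = (0, om \<delta> c s)"
  unfolding center_def chart_pnt
  by (subst pnt_aff_at) (rule inv_into_f_f[OF params_inj[OF aff_at_params]], simp)

lemma aff_at_finite: "fst z \<noteq> 0 \<Longrightarrow> \<exists>v. snd (aff_at s) z = emb v"
  by (rule exI[of _ "if s = 0 then (snd z / fst z, 1 / fst z) else (1 / fst z, snd z / fst z)"])
    (simp add: aff_at_def aff1_def aff2_def emb_eq hom_eq_simps)

lemma emb_neq_pnt: "emb v \<noteq> pnt \<delta> c s"
  by (simp add: emb_eq pnt_def hom_eq_simps)

lemma Lline_aff_at: "snd (aff_at s) z \<in> Lline \<delta> c s \<longleftrightarrow> snd z = om \<delta> c s"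
proof
  assume "snd (aff_at s) z \<in> Lline \<delta> c s"
  then show "snd z = om \<delta> c s"
    by (auto simp: aff_at_def aff1_def aff2_def Lline_def Sigma1_def om_def hom_eq_iff split: if_splits)
next
  assume z: "snd z = om \<delta> c s"
  show "snd (aff_at s) z \<in> Lline \<delta> c s"
  proof (cases "s = 0")
    case True
    then show ?thesis
      using z unfolding aff_at_def aff2_def Lline_def Sigma1_def om_def
      by simp (rule exI[of _ "fst z"], rule exI[of _ 1], simp)
  next
    case False
    then show ?thesis
      using z unfolding aff_at_def aff1_def Lline_def om_def
      by simp (rule exI[of _ "fst z"], rule exI[of _ 1], simp)
  qed
qed

text \<open>
  The center of the second blowup on the exceptional fiber over \<^term>\<open>pnt \<delta> c s\<close>.
\<close>

definition pE :: "complex \<Rightarrow> complex \<Rightarrow> nat \<Rightarrow> p2 bpt"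
  where "pE \<delta> c s = Exc (pnt \<delta> c s) (Slope 0)"

text \<open>
  The charts around the exceptional fibers of the first two blowups.  In the coordinates (t, w) of the
  affine chart at infinity, \<open>psi1\<close> is w = om + t l, \<open>psi2\<close> is w = om + \<open>t\<^sup>2\<close> \<open>\<eta>\<close>, and \<open>psi2v\<close> is
  t = \<open>\<lambda>\<close> v, w = om + \<open>\<lambda>\<close> \<open>v\<^sup>2\<close>, where \<open>\<eta>\<close> = 1 / \<open>\<lambda>\<close>.
\<close>

definition psi1 :: "complex \<Rightarrow> complex \<Rightarrow> nat \<Rightarrow> complex \<times> complex \<Rightarrow> p2 bpt"
  where "psi1 \<delta> c s z = (if fst z = 0 then Exc (pnt \<delta> c s) (Slope (snd z))
    else Base (snd (aff_at s) (fst z, om \<delta> c s + fst z * snd z)))"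

definition psi2 :: "complex \<Rightarrow> complex \<Rightarrow> nat \<Rightarrow> complex \<times> complex \<Rightarrow> p2 bpt bpt"
  where "psi2 \<delta> c s z = (if fst z = 0 then Exc (pE \<delta> c s) (Slope (snd z))
    else Base (Base (snd (aff_at s) (fst z, om \<delta> c s + (fst z)\<^sup>2 * snd z))))"

definition psi2v :: "complex \<Rightarrow> complex \<Rightarrow> nat \<Rightarrow> complex \<times> complex \<Rightarrow> p2 bpt bpt"
  where "psi2v \<delta> c s z =
    (if snd z = 0 then Exc (pE \<delta> c s) (if fst z = 0 then Vertical else Slope (1 / fst z))
     else if fst z = 0 then Base (Exc (pnt \<delta> c s) (Slope (snd z)))
     else Base (Base (snd (aff_at s) (fst z * snd z, om \<delta> c s + fst z * (snd z)\<^sup>2))))"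

abbreviation emb1 :: "complex \<times> complex \<Rightarrow> p2 bpt" where "emb1 v \<equiv> Base (emb v)"
abbreviation emb2 :: "complex \<times> complex \<Rightarrow> p2 bpt bpt" where "emb2 v \<equiv> Base (Base (emb v))"
abbreviation emb3 :: "complex \<times> complex \<Rightarrow> p2 bpt bpt bpt" where "emb3 v \<equiv> Base (Base (Base (emb v)))"

text \<open>
  What the blowups over the line at infinity need to know about the parameters: the centers are distinct,
  and the map permutes them cyclically, as omega vanishes at index n - 1 for the first time.
\<close>

locale henon =
  fixes n :: nat and \<delta> c :: complex
  assumes n3: "3 \<le> n" and d0: "\<delta> \<noteq> 0"
    and omega_nz: "\<And>s. 1 \<le> s \<Longrightarrow> s < n - 1 \<Longrightarrow> omega \<delta> c s \<noteq> 0"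
    and omega_last: "omega \<delta> c (n - 1) = 0"
    and omega_inj: "inj_on (omega \<delta> c) {1..<n}"
begin

lemma pnt_inj: "s < n \<Longrightarrow> r < n \<Longrightarrow> pnt \<delta> c s = pnt \<delta> c r \<longleftrightarrow> s = r"
  using inj_onD[OF omega_inj, of s r] by (auto simp: pnt_def hom_eq_simps)

lemma pE_inj: "s < n \<Longrightarrow> r < n \<Longrightarrow> pE \<delta> c s = pE \<delta> c r \<longleftrightarrow> s = r"
  by (simp add: pE_def pnt_inj)

lemma om_last: "om \<delta> c (n - 1) = 0"
  using n3 omega_last by (simp add: om_def)

lemma om_Suc: "1 \<le> s \<Longrightarrow> om \<delta> c (Suc s) = c - \<delta> / om \<delta> c s"
  by (simp add: om_def omega_Suc)

lemma om_1: "om \<delta> c (Suc 0) = c"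
  by (simp add: om_def omega_def)

lemma om_nz: "1 \<le> s \<Longrightarrow> s < n - 1 \<Longrightarrow> om \<delta> c s \<noteq> 0"
  by (simp add: om_def omega_nz)

lemma emb_notin_Z1: "emb v \<notin> Z1 n \<delta> c"
  using emb_neq_pnt[of v] by (auto simp: Z1_def)

lemma aff_at_notin_Z1: "fst z \<noteq> 0 \<Longrightarrow> snd (aff_at s) z \<notin> Z1 n \<delta> c"
  using aff_at_finite[of z s] emb_notin_Z1 by auto

lemma pnt_in_Z1: "s < n \<Longrightarrow> pnt \<delta> c s \<in> Z1 n \<delta> c"
  by (simp add: Z1_def)

lemma blowup_data_P2: "blowup_data P2 (Z1 n \<delta> c)"
proof
  show "finite (Z1 n \<delta> c)" by (simp add: Z1_def)
  show "Z1 n \<delta> c \<subseteq> pts P2" unfolding Z1_def pnt_def by (auto intro: hom_in_P2)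
qed

sublocale B1: blowup_data P2 "Z1 n \<delta> c" by (rule blowup_data_P2)

lemma complex_surface_X1: "complex_surface (X1 n \<delta> c)"
  unfolding X1_def by (rule B1.complex_surface_blowup)

lemma slope1: "bp_slope P2 (Z1 n \<delta> c) (pnt \<delta> c s) = (UNIV, psi1 \<delta> c s)"
  unfolding bp_slope_def chart_pnt center_pnt
  by (auto simp: slope_map_def psi1_def fun_eq_iff aff_at_notin_Z1)

lemma chart_pE: "chart (X1 n \<delta> c) (pE \<delta> c s) = (UNIV, psi1 \<delta> c s)"
  by (simp add: X1_def pE_def chart_blowup slope1)

lemma psi1_params: "s < n \<Longrightarrow> (UNIV, psi1 \<delta> c s) \<in> params (X1 n \<delta> c)"
  using B1.bp_slope_params[OF pnt_in_Z1, of s] by (simp add: slope1 X1_def)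

lemma center_pE: "s < n \<Longrightarrow> center (X1 n \<delta> c) (pE \<delta> c s) = (0, 0)"
proof -
  assume "s < n"
  have "psi1 \<delta> c s (0, 0) = pE \<delta> c s" by (simp add: psi1_def pE_def)
  then show ?thesis
    using inv_into_f_f[OF params_inj[OF psi1_params[OF \<open>s < n\<close>]], of "(0, 0)"]
    by (simp add: center_def chart_pE)
qed

text \<open>
  In the charts around the fiber the line is l = 0, which meets the fiber in the direction of slope 0, and
  the complement of l = 0 is open.
\<close>

lemma F1_L_eq: assumes s: "s < n" shows "F1_L n \<delta> c s = {pE \<delta> c s}"
proof -
  interpret X1: complex_surface "blowup P2 (Z1 n \<delta> c)" using complex_surface_X1 by (simp add: X1_def)
  let ?T = "surf_top (blowup P2 (Z1 n \<delta> c))" and ?p = "pnt \<delta> c s"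
  let ?C = "Base ` (Lline \<delta> c s - Z1 n \<delta> c)"
  note par = B1.bp_slope_params[OF pnt_in_Z1[OF s]]
  note parv = B1.bp_vert_params[OF pnt_in_Z1[OF s]]
  have "snd (bp_slope P2 (Z1 n \<delta> c) ?p) (0, 0) \<in> ?T closure_of ?C"
  proof (rule X1.closure_of_chartI[OF par])
    show "((\<lambda>h. (h, 0)) \<longlongrightarrow> (0, 0)) (at (0::complex))" by (intro tendsto_intros)
    show "(0, 0) \<in> fst (bp_slope P2 (Z1 n \<delta> c) ?p)" by (simp add: slope1)
    have "psi1 \<delta> c s (h, 0) \<in> ?C" if "h \<noteq> 0" for h
      using that Lline_aff_at[of s "(h, om \<delta> c s)" \<delta> c] aff_at_notin_Z1[of "(h, om \<delta> c s)" s]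
      by (simp add: psi1_def)
    then show "\<forall>\<^sub>F h in at 0. snd (bp_slope P2 (Z1 n \<delta> c) ?p) (h, 0) \<in> ?C"
      by (simp add: slope1 eventually_at_filter)
  qed
  then have 1: "pE \<delta> c s \<in> ?T closure_of ?C" by (simp add: slope1 psi1_def pE_def)
  have 2: "d = Slope 0" if d: "Exc ?p d \<in> ?T closure_of ?C" for d
  proof (rule ccontr)
    assume "d \<noteq> Slope 0"
    have "\<exists>V. openin ?T V \<and> Exc ?p d \<in> V \<and> V \<inter> ?C = {}"
    proof (cases d)
      case (Slope l)
      then have l: "l \<noteq> 0" using \<open>d \<noteq> Slope 0\<close> by simp
      let ?V = "psi1 \<delta> c s ` {z. snd z \<noteq> 0}"
      have "openin ?T ?V"
        using X1.openin_chart_image[OF par, of "{z. snd z \<noteq> 0}"] open_snd_neq[of 0]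
        by (simp add: slope1)
      moreover have "Exc ?p d \<in> ?V"
        using l Slope by (intro image_eqI[of _ _ "(0, l)"]) (simp_all add: psi1_def)
      moreover have "psi1 \<delta> c s z \<notin> ?C" if "snd z \<noteq> 0" for z
        using that Lline_aff_at[of s "(fst z, om \<delta> c s + fst z * snd z)" \<delta> c]
        by (auto simp: psi1_def)
      then have "\<forall>y\<in>?V. y \<notin> ?C" by (intro ballI, elim imageE) simp
      then have "?V \<inter> ?C = {}" by (simp only: disjoint_iff) blast
      ultimately show ?thesis by (intro exI[of _ ?V] conjI)
    next
      case Vertical
      let ?X = "bp_vert P2 (Z1 n \<delta> c) ?p"
      have "openin ?T (snd ?X ` fst ?X)"
        by (rule X1.openin_chart_image[OF parv params_open[OF parv]]) simp
      moreover have "Exc ?p d \<in> snd ?X ` fst ?X"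
        using Vertical B1.Exc_vert[OF pnt_in_Z1[OF s], of 0]
        by (intro image_eqI[of _ _ "(0, 0)"]) simp_all
      moreover have "snd ?X z \<notin> ?C" for z
        using Lline_aff_at[of s "vert_map (center P2 ?p) z" \<delta> c]
        by (auto simp: bp_vert_def chart_pnt center_pnt vert_map_def)
      then have "\<forall>y\<in>snd ?X ` fst ?X. y \<notin> ?C" by (intro ballI, elim imageE) simp
      then have "snd ?X ` fst ?X \<inter> ?C = {}" by (simp only: disjoint_iff) blast
      ultimately show ?thesis by (intro exI[of _ "snd ?X ` fst ?X"] conjI)
    qed
    then obtain V where V: "openin ?T V" "Exc ?p d \<in> V" "V \<inter> ?C = {}" by (elim exE conjE)
    have "\<forall>V. Exc ?p d \<in> V \<and> openin ?T V \<longrightarrow> (\<exists>y. y \<in> ?C \<and> y \<in> V)"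
      using d unfolding in_closure_of by (rule conjunct2)
    from this[rule_format, of V] V obtain y where "y \<in> ?C" "y \<in> V" by auto
    then show False using V(3) by (metis IntI empty_iff)
  qed
  have "F1_L n \<delta> c s = {Exc ?p d |d. Exc ?p d \<in> ?T closure_of ?C}"
    unfolding F1_L_def F1_def exc_fiber_def strict_transform_def by blast
  also have "\<dots> = {pE \<delta> c s}"     using 1 2 unfolding pE_def by blast
  finally show ?thesis .
qed

lemma Z2_eq: "Z2 n \<delta> c = pE \<delta> c ` {..<n}"
  unfolding Z2_def using F1_L_eq by auto

lemma pE_in_Z2: "s < n \<Longrightarrow> pE \<delta> c s \<in> Z2 n \<delta> c"
  by (simp add: Z2_eq)

lemma Base_notin_Z2: "Base p \<notin> Z2 n \<delta> c"
  by (auto simp: Z2_eq pE_def)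

lemma Exc_in_Z2_iff: "s < n \<Longrightarrow> Exc (pnt \<delta> c s) d \<in> Z2 n \<delta> c \<longleftrightarrow> d = Slope 0"
  using pnt_inj by (auto simp: Z2_eq pE_def)

lemma blowup_data_X1: "blowup_data (X1 n \<delta> c) (Z2 n \<delta> c)"
proof -
  interpret X1: complex_surface "X1 n \<delta> c" by (rule complex_surface_X1)
  show ?thesis
    by unfold_locales (auto simp: Z2_eq X1_def pE_def Z1_def)
qed

sublocale B2: blowup_data "X1 n \<delta> c" "Z2 n \<delta> c" by (rule blowup_data_X1)

lemma complex_surface_X2: "complex_surface (X2 n \<delta> c)"
  unfolding X2_def by (rule B2.complex_surface_blowup)

text \<open>
  Points of these charts off the new exceptional fiber are never centers, so their domains are all of the
  plane.
\<close>

lemma slope2: "s < n \<Longrightarrow> bp_slope (X1 n \<delta> c) (Z2 n \<delta> c) (pE \<delta> c s) = (UNIV, psi2 \<delta> c s)"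
  unfolding bp_slope_def chart_pE center_pE
  by (auto simp: slope_map_def psi1_def psi2_def fun_eq_iff Base_notin_Z2 power2_eq_square mult.assoc)

lemma vert2: "s < n \<Longrightarrow> bp_vert (X1 n \<delta> c) (Z2 n \<delta> c) (pE \<delta> c s) = (UNIV, psi2v \<delta> c s)"
  unfolding bp_vert_def chart_pE center_pE
  by (auto simp: vert_map_def psi1_def psi2v_def fun_eq_iff Base_notin_Z2 Exc_in_Z2_iff
      power2_eq_square mult.assoc)

lemma psi2_params: "s < n \<Longrightarrow> (UNIV, psi2 \<delta> c s) \<in> params (X2 n \<delta> c)"
  using B2.bp_slope_params[OF pE_in_Z2, of s] by (simp add: slope2 X2_def)

lemma psi2v_params: "s < n \<Longrightarrow> (UNIV, psi2v \<delta> c s) \<in> params (X2 n \<delta> c)"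
  using B2.bp_vert_params[OF pE_in_Z2, of s] by (simp add: vert2 X2_def)

lemma dense_in_X2: "dense_in (X2 n \<delta> c) emb2 fdom"
  using B2.dense_in_blowup[OF B1.dense_in_blowup[OF dense_in_P2, folded X1_def]]
  by (simp add: X2_def)

section \<open>The map in local coordinates\<close>

lemma om_last_Suc: "om \<delta> c (n - Suc 0) = 0"
  using om_last by simp

lemma aff_last: "aff_at (n - Suc 0) = aff1"
  using n3 by (simp add: aff_at_def)

abbreviation "f \<equiv> fmap \<delta> c"

lemma aff_at_simps: "aff_at 0 = aff2" "aff_at (Suc s) = aff1"
  by (simp_all add: aff_at_def)

lemma om_0 [simp]: "om \<delta> c 0 = 0"
  by (simp add: om_def)

text \<open>
  Off \<^const>\<open>Sigma2\<close> the map is the polynomial automorphism of \<open>fmap_aff21\<close>, of Jacobian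
  \<open>- \<delta>\<close>.
\<close>

lemma biholo_P2:
  "biholo_at P2 emb fdom f (snd aff2 z) (snd aff1 (fst z, c - \<delta> * snd z + (fst z)\<^sup>2))"
proof -
  let ?\<Phi> = "\<lambda>z. (fst z, c - \<delta> * snd z + (fst z)\<^sup>2)"
  have "local_form P2 emb fdom f aff2 aff1 UNIV ?\<Phi>"
    unfolding local_form_def holo2_iff
    by (auto simp: aff_params fmap_aff21 aff1_def[THEN arg_cong[of _ _ fst]] aff2_def[THEN arg_cong[of _ _ fst]]
        intro!: sdiff_intros)
  moreover have "nondeg ?\<Phi> z"
  proof -
    have 1: "sder (\<lambda>x. fst (?\<Phi> x)) z 1 0" by (simp add: sder_fst)
    have "sder (\<lambda>x. c - \<delta> * snd x + (fst x)\<^sup>2) z (2 * fst z) (- \<delta>)"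
      by (rule sder_eq[OF sder_add[OF sder_diff[OF sder_const sder_mult[OF sder_const sder_snd]]
            sder_power[OF sder_fst]]]) simp_all
    then have 2: "sder (\<lambda>x. snd (?\<Phi> x)) z (2 * fst z) (- \<delta>)" by simp
    show ?thesis by (rule nondegI[OF 1 2]) (use d0 in simp)
  qed
  ultimately show ?thesis unfolding biholo_at_def
    by (intro exI[of _ aff2] exI[of _ aff1] exI[of _ UNIV] exI[of _ ?\<Phi>] exI[of _ z] conjI) simp_all
qed

text \<open>
  The next six lemmas give the triangular form of the map at the centers of the three blowups.  Each form
  comes from the preceding one as the lift in the chart (u, l), recentered; the second coordinate is taken
  relative to the center and its target.
\<close>

lemma tri_pnt_0:
  "tri_form P2 emb fdom f (pnt \<delta> c 0) (pnt \<delta> c (Suc 0)) UNIV (\<lambda>z. 1) (\<lambda>z. fst z) (\<lambda>z. - \<delta>)"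
proof (rule tri_formI[OF trans[OF chart_pnt aff_at_UNIV] trans[OF chart_pnt aff_at_UNIV] center_pnt center_pnt])
  fix z v assume v: "v \<in> fdom" "snd (aff_at 0) z = emb v"
  have "tri_map (0, om \<delta> c 0) (0, om \<delta> c (Suc 0)) (\<lambda>z. 1) (\<lambda>z. fst z) (\<lambda>z. - \<delta>) z =
      (fst z, c - \<delta> * snd z + (fst z)\<^sup>2)"
    by (simp add: tri_map_def om_1 power2_eq_square)
  then show "snd (aff_at (Suc 0)) (tri_map (0, om \<delta> c 0) (0, om \<delta> c (Suc 0)) (\<lambda>z. 1) (\<lambda>z. fst z)
      (\<lambda>z. - \<delta>) z) = emb (f v)"
    using fmap_aff21[of z v] v by (simp add: aff_at_simps)
qed (use d0 in \<open>auto intro!: sdiff_intros\<close>)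

lemma tri_pnt:
  assumes s: "1 \<le> s" "s < n - 1"
  shows "tri_form P2 emb fdom f (pnt \<delta> c s) (pnt \<delta> c (Suc s)) {z. snd z \<noteq> 0}
    (\<lambda>z. 1 / snd z) (\<lambda>z. fst z / (snd z)\<^sup>2) (\<lambda>z. \<delta> / (om \<delta> c s * snd z))"
  unfolding tri_form_def chart_pnt center_pnt
proof (intro conjI ballI impI)
  have nz: "om \<delta> c s \<noteq> 0" using om_nz s by simp
  have aff: "aff_at s = aff1" using s by (simp add: aff_at_def)
  let ?T = "tri_map (0, om \<delta> c s) (0, om \<delta> c (Suc s))
    (\<lambda>z. 1 / snd z) (\<lambda>z. fst z / (snd z)\<^sup>2) (\<lambda>z. \<delta> / (om \<delta> c s * snd z))"
  show "open {z::complex \<times> complex. snd z \<noteq> 0}" by (rule open_snd_neq)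
  show "(0, om \<delta> c s) \<in> {z. snd z \<noteq> 0}" using nz by simp
  show "snd (aff_at (Suc s)) (?T z) = emb (f v)"
    if z: "z \<in> {z. snd z \<noteq> 0}" and v: "v \<in> fdom" "snd (aff_at s) z = emb v" for z v
  proof -
    have "(snd z - om \<delta> c s) * (\<delta> / (om \<delta> c s * snd z)) = \<delta> / om \<delta> c s - \<delta> / snd z"
      using z nz by (simp add: divide_simps) (simp add: algebra_simps)
    then have "?T z = (fst z / snd z, c - \<delta> / snd z + (fst z / snd z)\<^sup>2)"
      unfolding tri_map_def om_Suc[OF s(1)] by (simp add: power2_eq_square)
    then show ?thesis using fmap_aff11(2)[of z v] v by (simp add: aff aff_at_simps)
  qed
qed (use om_nz[OF s] d0 in \<open>auto intro!: sdiff_intros\<close>)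

lemma tri_pE_0:
  "tri_form (X1 n \<delta> c) emb1 fdom f (pE \<delta> c 0) (pE \<delta> c (Suc 0)) UNIV (\<lambda>z. 1) (\<lambda>z. 1) (\<lambda>z. - \<delta>)"
proof -
  have n: "0 < n" "Suc 0 < n" using n3 by simp_all
  show ?thesis
  proof (rule tri_formI[OF chart_pE chart_pE center_pE[OF n(1)] center_pE[OF n(2)]])
    fix z v assume v: "v \<in> fdom" "psi1 \<delta> c 0 z = emb1 v"
    have z: "fst z \<noteq> 0" "snd aff2 (fst z, fst z * snd z) = emb v"
      using v by (auto simp: psi1_def aff_at_simps split: if_splits)
    have t: "tri_map (0, 0) (0, 0) (\<lambda>z. 1) (\<lambda>z. 1) (\<lambda>z. - \<delta>) z = (fst z, fst z - \<delta> * snd z)"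
      by (simp add: tri_map_def)
    show "psi1 \<delta> c (Suc 0) (tri_map (0, 0) (0, 0) (\<lambda>z. 1) (\<lambda>z. 1) (\<lambda>z. - \<delta>) z) = emb1 (f v)"
      unfolding t using fmap_aff21[OF z(2), of \<delta> c] z(1)
      by (simp add: psi1_def aff_at_simps om_1 algebra_simps power2_eq_square)
  qed (use d0 in \<open>auto intro!: sdiff_intros\<close>)
qed

lemma tri_pE:
  assumes s: "1 \<le> s" "s < n - 1"
  shows "tri_form (X1 n \<delta> c) emb1 fdom f (pE \<delta> c s) (pE \<delta> c (Suc s))
    {z. om \<delta> c s + fst z * snd z \<noteq> 0}
    (\<lambda>z. 1 / (om \<delta> c s + fst z * snd z)) (\<lambda>z. 1 / (om \<delta> c s + fst z * snd z)) (\<lambda>z. \<delta> / om \<delta> c s)"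
proof -
  have n: "s < n" "Suc s < n" using s by simp_all
  have nz: "om \<delta> c s \<noteq> 0" using om_nz s by simp
  have aff: "aff_at s = aff1" using s by (simp add: aff_at_def)
  let ?w = "\<lambda>z. om \<delta> c s + fst z * snd z"
  have op: "open {z. ?w z \<noteq> 0}" by (intro open_Collect_neq continuous_intros)
  let ?T = "tri_map (0, 0) (0, 0) (\<lambda>z. 1 / ?w z) (\<lambda>z. 1 / ?w z) (\<lambda>z. \<delta> / om \<delta> c s)"
  show ?thesis
  proof (rule tri_formI[OF chart_pE chart_pE center_pE[OF n(1)] center_pE[OF n(2)] op])
    fix z v assume "z \<in> {z. ?w z \<noteq> 0}" and v: "v \<in> fdom" "psi1 \<delta> c s z = emb1 v"
    then have w: "?w z \<noteq> 0" by simp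
    have t: "?T z = (fst z / ?w z, fst z / ?w z + snd z * \<delta> / om \<delta> c s)"
      by (simp add: tri_map_def)
    have z: "fst z \<noteq> 0" "snd aff1 (fst z, ?w z) = emb v"
      using v by (auto simp: psi1_def aff split: if_splits)
    have "\<delta> / ?w z = \<delta> / om \<delta> c s - fst z / ?w z * (snd z * \<delta> / om \<delta> c s)"
      using w nz by (simp add: divide_simps) (simp add: algebra_simps)
    then have "om \<delta> c (Suc s) + fst z / ?w z * (fst z / ?w z + snd z * \<delta> / om \<delta> c s) =
        c - \<delta> / ?w z + (fst z / ?w z)\<^sup>2"
      unfolding om_Suc[OF s(1)] by (simp add: algebra_simps power2_eq_square)
    then show "psi1 \<delta> c (Suc s) (?T z) = emb1 (f v)"
      unfolding t using fmap_aff11(2)[OF z(2) v(1), of \<delta> c] z(1) w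
      by (simp add: psi1_def aff_at_simps)
  qed (use d0 nz in \<open>auto intro!: sdiff_intros\<close>)
qed

text \<open>
  The points of the second exceptional fibers, which are the candidates for the centers of the third
  blowup.
\<close>

definition Qp :: "nat \<Rightarrow> complex \<Rightarrow> p2 bpt bpt"
  where "Qp s e = Exc (pE \<delta> c s) (Slope e)"

lemma chart_Qp: "s < n \<Longrightarrow> chart (X2 n \<delta> c) (Qp s e) = (UNIV, psi2 \<delta> c s)"
  by (simp add: X2_def Qp_def chart_blowup slope2)

lemma center_Qp: assumes "s < n" shows "center (X2 n \<delta> c) (Qp s e) = (0, e)"
proof -
  have "psi2 \<delta> c s (0, e) = Qp s e" by (simp add: psi2_def Qp_def)
  then show ?thesis
    using inv_into_f_f[OF params_inj[OF psi2_params[OF assms]], of "(0, e)"]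
    by (simp add: center_def chart_Qp assms)
qed

lemma tri_Qp_0:
  "tri_form (X2 n \<delta> c) emb2 fdom f (Qp 0 e) (Qp (Suc 0) (1 - \<delta> * e)) UNIV (\<lambda>z. 1) (\<lambda>z. 0) (\<lambda>z. - \<delta>)"
proof -
  have n: "0 < n" "Suc 0 < n" using n3 by simp_all
  let ?T = "tri_map (0, e) (0, 1 - \<delta> * e) (\<lambda>z. 1) (\<lambda>z. 0) (\<lambda>z. - \<delta>)"
  show ?thesis
  proof (rule tri_formI[OF chart_Qp[OF n(1)] chart_Qp[OF n(2)] center_Qp[OF n(1)] center_Qp[OF n(2)]])
    fix z v assume v: "v \<in> fdom" "psi2 \<delta> c 0 z = emb2 v"
    have t: "?T z = (fst z, 1 - \<delta> * snd z)" by (simp add: tri_map_def algebra_simps)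
    have z: "fst z \<noteq> 0" "snd aff2 (fst z, (fst z)\<^sup>2 * snd z) = emb v"
      using v by (auto simp: psi2_def aff_at_simps split: if_splits)
    show "psi2 \<delta> c (Suc 0) (?T z) = emb2 (f v)"
      unfolding t using fmap_aff21[OF z(2), of \<delta> c] z(1)
      by (simp add: psi2_def aff_at_simps om_1 algebra_simps power2_eq_square)
  qed (use d0 in \<open>auto intro!: sdiff_intros\<close>)
qed

lemma tri_Qp:
  assumes s: "1 \<le> s" "s < n - 1"
  shows "tri_form (X2 n \<delta> c) emb2 fdom f (Qp s e) (Qp (Suc s) (1 + \<delta> * e))
    {z. om \<delta> c s + (fst z)\<^sup>2 * snd z \<noteq> 0}
    (\<lambda>z. 1 / (om \<delta> c s + (fst z)\<^sup>2 * snd z)) (\<lambda>z. \<delta> * e * fst z * snd z / om \<delta> c s)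
    (\<lambda>z. \<delta> * (om \<delta> c s + (fst z)\<^sup>2 * snd z) / om \<delta> c s)"
proof -
  have n: "s < n" "Suc s < n" using s by simp_all
  have nz: "om \<delta> c s \<noteq> 0" using om_nz s by simp
  have aff: "aff_at s = aff1" using s by (simp add: aff_at_def)
  let ?w = "\<lambda>z. om \<delta> c s + (fst z)\<^sup>2 * snd z"
  let ?h = "\<lambda>z. 1 + \<delta> * e + fst z * (\<delta> * e * fst z * snd z / om \<delta> c s) +
    (snd z - e) * (\<delta> * ?w z / om \<delta> c s)"
  have op: "open {z. ?w z \<noteq> 0}" by (intro open_Collect_neq continuous_intros)
  have h: "?h z = 1 + \<delta> * snd z * ?w z / om \<delta> c s" for z
    using nz by (simp add: divide_simps) (simp add: algebra_simps power2_eq_square)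
  let ?T = "tri_map (0, e) (0, 1 + \<delta> * e) (\<lambda>z. 1 / ?w z) (\<lambda>z. \<delta> * e * fst z * snd z / om \<delta> c s)
    (\<lambda>z. \<delta> * ?w z / om \<delta> c s)"
  show ?thesis
  proof (rule tri_formI[OF chart_Qp[OF n(1)] chart_Qp[OF n(2)] center_Qp[OF n(1)] center_Qp[OF n(2)] op])
    fix z v assume "z \<in> {z. ?w z \<noteq> 0}" and v: "v \<in> fdom" "psi2 \<delta> c s z = emb2 v"
    then have w: "?w z \<noteq> 0" by simp
    have "?T z = (fst z / ?w z, ?h z)" by (simp add: tri_map_def)
    then have t: "?T z = (fst z / ?w z, 1 + \<delta> * snd z * ?w z / om \<delta> c s)" by (simp only: h)
    have z: "fst z \<noteq> 0" "snd aff1 (fst z, ?w z) = emb v"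
      using v by (auto simp: psi2_def aff split: if_splits)
    have "\<delta> / ?w z = \<delta> / om \<delta> c s - (fst z / ?w z)\<^sup>2 * (\<delta> * snd z * ?w z / om \<delta> c s)"
      using w nz by (simp add: divide_simps power2_eq_square) (simp add: algebra_simps)
    then have "om \<delta> c (Suc s) + (fst z / ?w z)\<^sup>2 * (1 + \<delta> * snd z * ?w z / om \<delta> c s) =
        c - \<delta> / ?w z + (fst z / ?w z)\<^sup>2"
      unfolding om_Suc[OF s(1)] by (simp add: algebra_simps)
    then show "psi2 \<delta> c (Suc s) (?T z) = emb2 (f v)"
      unfolding t using fmap_aff11(2)[OF z(2) v(1), of \<delta> c] z(1) w
      by (simp add: psi2_def aff_at_simps del: power_divide)
  qed (use d0 nz in \<open>auto intro!: sdiff_intros\<close>)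
qed

text \<open>
  On the last fiber the map is \<open>fmap_aff12\<close> with t = u and w = \<open>u\<^sup>2\<close> \<open>\<eta>\<close>, where the denominator becomes
  \<open>u\<^sup>2\<close> H.  The value H is the coordinate on the fiber over [0:0:1]; it vanishes at \<open>\<eta>\<close> = 1/\<open>\<delta>\<close>, the point of
  indeterminacy, and is 1 on \<open>\<eta>\<close> = 0, the strict transform of \<^const>\<open>Sigma2\<close>.
\<close>

lemma fmap_psi2_last:
  assumes z: "psi2 \<delta> c (n - 1) z = emb2 v" and v: "v \<in> fdom"
    and H: "H = 1 - \<delta> * snd z + c * (snd z)\<^sup>2 * (fst z)\<^sup>2" "H \<noteq> 0"
  shows "fst z \<noteq> 0" "snd z \<noteq> 0" "emb2 (f v) = psi2 \<delta> c 0 (fst z * snd z / H, H)"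
proof -
  show u: "fst z \<noteq> 0" using z by (auto simp: psi2_def split: if_splits)
  have e: "snd aff1 (fst z, (fst z)\<^sup>2 * snd z) = emb v"
    using z u by (simp add: psi2_def aff_last om_last_Suc)
  show \<eta>: "snd z \<noteq> 0" using fmap_aff11(1)[OF e v] by simp
  have D: "(fst z)\<^sup>2 * H = (fst (fst z, (fst z)\<^sup>2 * snd z))\<^sup>2 + snd (fst z, (fst z)\<^sup>2 * snd z) *
      (c * snd (fst z, (fst z)\<^sup>2 * snd z) - \<delta>)"
    by (simp add: H(1) algebra_simps power2_eq_square)
  show "emb2 (f v) = psi2 \<delta> c 0 (fst z * snd z / H, H)"
    using fmap_aff12[OF e v D] u \<eta> H(2)
    by (simp add: psi2_def aff_at_simps power2_eq_square mult_ac)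
qed

lemma tri_Qp_last:
  assumes e: "e \<noteq> 0" "1 - \<delta> * e \<noteq> 0"
  shows "tri_form (X2 n \<delta> c) emb2 fdom f (Qp (n - 1) e) (Qp 0 (1 - \<delta> * e))
    {z. 1 - \<delta> * snd z + c * (snd z)\<^sup>2 * (fst z)\<^sup>2 \<noteq> 0}
    (\<lambda>z. snd z / (1 - \<delta> * snd z + c * (snd z)\<^sup>2 * (fst z)\<^sup>2)) (\<lambda>z. c * (snd z)\<^sup>2 * fst z) (\<lambda>z. - \<delta>)"
proof -
  have n: "n - 1 < n" "0 < n" using n3 by simp_all
  let ?H = "\<lambda>z. 1 - \<delta> * snd z + c * (snd z)\<^sup>2 * (fst z)\<^sup>2"
  have op: "open {z. ?H z \<noteq> 0}" by (intro open_Collect_neq continuous_intros)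
  let ?T = "tri_map (0, e) (0, 1 - \<delta> * e) (\<lambda>z. snd z / ?H z) (\<lambda>z. c * (snd z)\<^sup>2 * fst z) (\<lambda>z. - \<delta>)"
  show ?thesis
  proof (rule tri_formI[OF chart_Qp[OF n(1)] chart_Qp[OF n(2)] center_Qp[OF n(1)] center_Qp[OF n(2)] op])
    fix z v assume z: "z \<in> {z. ?H z \<noteq> 0}" and v: "v \<in> fdom" "psi2 \<delta> c (n - 1) z = emb2 v"
    have t: "?T z = (fst z * snd z / ?H z, ?H z)"
      by (simp add: tri_map_def algebra_simps power2_eq_square)
    show "psi2 \<delta> c 0 (?T z) = emb2 (f v)"
      unfolding t using fmap_psi2_last(3)[OF v(2,1) refl] z by simp
  qed (use e d0 in \<open>auto intro!: sdiff_intros\<close>)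
qed

text \<open>
  In the vertical charts over the last and the first center, the map is (\<open>\<lambda>\<close>, v) \<open>\<mapsto>\<close> (\<open>\<lambda>\<close> / E, v) with
  E = \<open>\<lambda>\<close> - \<open>\<delta>\<close> + c \<open>\<lambda>\<close> \<open>v\<^sup>2\<close>: put t = \<open>\<lambda>\<close> v and w = \<open>\<lambda>\<close> \<open>v\<^sup>2\<close> in \<open>fmap_aff12\<close>.  The line \<open>\<lambda>\<close> = 0 is the first exceptional
  fiber without its vertical direction, and v = 0 is the second one without the point \<open>\<eta>\<close> = 0, so this
  single formula covers both.
\<close>

lemma biholo_vert2:
  assumes E: "fst z - \<delta> + c * fst z * (snd z)\<^sup>2 \<noteq> 0"
  shows "biholo_at (X2 n \<delta> c) emb2 fdom f (psi2v \<delta> c (n - 1) z)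
    (psi2v \<delta> c 0 (fst z / (fst z - \<delta> + c * fst z * (snd z)\<^sup>2), snd z))"
proof -
  have n: "n - 1 < n" "0 < n" using n3 by simp_all
  let ?E = "\<lambda>z. fst z - \<delta> + c * fst z * (snd z)\<^sup>2"
  let ?M = "{z. ?E z \<noteq> 0}" and ?\<Phi> = "\<lambda>z. (fst z / ?E z, snd z)"
  have "open ?M" by (intro open_Collect_neq continuous_intros)
  then have h: "holo2 ?M ?\<Phi>" by (auto simp: holo2_iff intro!: sdiff_intros)
  have eq: "psi2v \<delta> c 0 (?\<Phi> z) = emb2 (f v)"
    if z: "?E z \<noteq> 0" and v: "v \<in> fdom" "psi2v \<delta> c (n - 1) z = emb2 v" for z v
  proof -
    have nz: "fst z \<noteq> 0" "snd z \<noteq> 0" and e: "snd aff1 (fst z * snd z, fst z * (snd z)\<^sup>2) = emb v"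
      using v by (auto simp: psi2v_def aff_last om_last_Suc split: if_splits)
    have D: "fst z * (snd z)\<^sup>2 * ?E z = (fst (fst z * snd z, fst z * (snd z)\<^sup>2))\<^sup>2 +
        snd (fst z * snd z, fst z * (snd z)\<^sup>2) * (c * snd (fst z * snd z, fst z * (snd z)\<^sup>2) - \<delta>)"
      by (simp add: algebra_simps power2_eq_square)
    show ?thesis
      using fmap_aff12[OF e v(1) D] nz z
      by (simp add: psi2v_def aff_at_simps power2_eq_square)
  qed
  have "local_form (X2 n \<delta> c) emb2 fdom f (UNIV, psi2v \<delta> c (n - 1)) (UNIV, psi2v \<delta> c 0) ?M ?\<Phi>"
    unfolding local_form_def
  proof (intro conjI ballI impI psi2v_params n h)
    show "snd (UNIV, psi2v \<delta> c 0) (?\<Phi> z) = emb2 (f v)"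
      if "z \<in> ?M" "v \<in> fdom" "snd (UNIV, psi2v \<delta> c (n - 1)) z = emb2 v" for z v
      using eq[of z v] that by simp
  qed simp_all
  moreover have "nondeg ?\<Phi> z"
  proof -
    have "sder ?E z (1 + c * (snd z)\<^sup>2) (c * fst z * (2 * snd z))"
      by (rule sder_eq[OF sder_add[OF sder_diff[OF sder_fst sder_const] sder_mult[OF
                sder_mult[OF sder_const sder_fst] sder_power[OF sder_snd]]]]) simp_all
    from sder_divide[OF sder_fst this E]
    have 1: "sder (\<lambda>x. fst (?\<Phi> x)) z ((1 * ?E z - fst z * (1 + c * (snd z)\<^sup>2)) / (?E z)\<^sup>2)
        ((0 * ?E z - fst z * (c * fst z * (2 * snd z))) / (?E z)\<^sup>2)" by simp
    have 2: "sder (\<lambda>x. snd (?\<Phi> x)) z 0 1" by (simp add: sder_snd)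
    \<comment> \<open>The terms with \<open>v\<^sup>2\<close> cancel, so the Jacobian vanishes nowhere.\<close>
    have num: "1 * ?E z - fst z * (1 + c * (snd z)\<^sup>2) = - \<delta>" by (simp add: algebra_simps)
    show ?thesis by (rule nondegI[OF 1[unfolded num] 2]) (use d0 E in simp)
  qed
  ultimately show ?thesis unfolding biholo_at_def
    by (intro exI[of _ "(UNIV, psi2v \<delta> c (n - 1))"] exI[of _ "(UNIV, psi2v \<delta> c 0)"] exI[of _ ?M]
        exI[of _ ?\<Phi>] exI[of _ z] conjI) (use E in simp_all)
qed

text \<open>
  The direction of the line at infinity is missing from the charts of \<open>biholo_vert2\<close>.  With t = l v and
  w = v the map becomes (l, v) \<open>\<mapsto>\<close> (l, v / (c v + \<open>l\<^sup>2\<close> v - \<open>\<delta>\<close>)).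
\<close>

lemma biholo_vert1:
  "biholo_at (X1 n \<delta> c) emb1 fdom f (Exc (pnt \<delta> c (n - 1)) Vertical) (Exc (pnt \<delta> c 0) Vertical)"
proof -
  have n: "n - 1 < n" "0 < n" using n3 by simp_all
  let ?P = "bp_vert P2 (Z1 n \<delta> c) (pnt \<delta> c (n - 1))" and ?Q = "bp_vert P2 (Z1 n \<delta> c) (pnt \<delta> c 0)"
  have P: "?P \<in> params (X1 n \<delta> c)" and Q: "?Q \<in> params (X1 n \<delta> c)"
    unfolding X1_def by (rule B1.bp_vert_params[OF pnt_in_Z1], simp add: n)+
  let ?K = "\<lambda>z. c * snd z + (fst z)\<^sup>2 * snd z - \<delta>"
  let ?\<Phi> = "\<lambda>z. (fst z, snd z / ?K z)"
  have "open (fst ?P \<inter> {z. ?K z \<noteq> 0})"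
    using params_open[OF P] by (intro open_Int open_Collect_neq continuous_intros)
  then have h0: "holo2 (fst ?P \<inter> {z. ?K z \<noteq> 0}) ?\<Phi>"
    by (auto simp: holo2_iff intro!: sdiff_intros)
  let ?M = "{z \<in> fst ?P \<inter> {z. ?K z \<noteq> 0}. ?\<Phi> z \<in> fst ?Q}"
  have "open ?M" by (rule holo2_open_preimage[OF h0 params_open[OF Q]])
  then have h: "holo2 ?M ?\<Phi>" by (rule holo2_subset[OF h0]) blast
  have zero: "(0, 0) \<in> fst ?P" "snd ?P (0, 0) = Exc (pnt \<delta> c (n - 1)) Vertical"
    "(0, 0) \<in> fst ?Q" "snd ?Q (0, 0) = Exc (pnt \<delta> c 0) Vertical"
    using B1.Exc_vert[OF pnt_in_Z1[OF n(1)], of 0] B1.Exc_vert[OF pnt_in_Z1[OF n(2)], of 0] by simp_all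
  have eq: "snd ?Q (?\<Phi> z) = emb1 (f v)"
    if z: "?K z \<noteq> 0" and v: "v \<in> fdom" "snd ?P z = emb1 v" for z v
  proof -
    have nz: "snd z \<noteq> 0" and e: "snd aff1 (fst z * snd z, snd z) = emb v"
      using v by (auto simp: bp_vert_def chart_pnt center_pnt vert_map_def aff_last om_last_Suc split: if_splits)
    have D: "snd z * ?K z = (fst (fst z * snd z, snd z))\<^sup>2 +
        snd (fst z * snd z, snd z) * (c * snd (fst z * snd z, snd z) - \<delta>)"
      by (simp add: algebra_simps power2_eq_square)
    show ?thesis
      using fmap_aff12[OF e v(1) D] nz z
      by (simp add: bp_vert_def chart_pnt center_pnt vert_map_def aff_at_simps power2_eq_square)
  qed
  have "local_form (X1 n \<delta> c) emb1 fdom f ?P ?Q ?M ?\<Phi>"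
    unfolding local_form_def
  proof (intro conjI ballI impI P Q h)
    show "snd ?Q (?\<Phi> z) = emb1 (f v)" if "z \<in> ?M" "v \<in> fdom" "snd ?P z = emb1 v" for z v
      using eq[of z v] that by simp
  qed auto
  moreover have "nondeg ?\<Phi> (0, 0)"
  proof -
    have "sdiff ?K (0, 0)" by (intro sdiff_intros)
    then obtain a b where K: "sder ?K (0, 0) a b" unfolding sdiff_def by auto
    have 1: "sder (\<lambda>x. fst (?\<Phi> x)) (0, 0) 1 0" by (simp add: sder_fst)
    have "sder (\<lambda>x. snd x / ?K x) (0, 0) 0 (- 1 / \<delta>)"
      by (rule sder_eq[OF sder_divide[OF sder_snd K]]) (use d0 in \<open>simp_all add: power2_eq_square\<close>)
    then have 2: "sder (\<lambda>x. snd (?\<Phi> x)) (0, 0) 0 (- 1 / \<delta>)" by simp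
    show ?thesis by (rule nondegI[OF 1 2]) (use d0 in simp)
  qed
  moreover have "(0, 0) \<in> ?M" using zero d0 by simp
  ultimately show ?thesis unfolding biholo_at_def
    by (intro exI[of _ ?P] exI[of _ ?Q] exI[of _ ?M] exI[of _ ?\<Phi>] exI[of _ "(0, 0)"] conjI)
      (use zero in simp_all)
qed


section \<open>The orbit of the contracted line\<close>

text \<open>
  The index of the center that follows; at the last one the cycle starts again.
\<close>

definition nxt :: "nat \<Rightarrow> nat"
  where "nxt s = (if s = n - 1 then 0 else Suc s)"

text \<open>
  The map between the second exceptional fibers, in the coordinate \<open>\<eta>\<close>.
\<close>

definition step :: "nat \<Rightarrow> complex \<Rightarrow> complex"
  where "step s e = (if s = 0 \<or> s = n - 1 then 1 - \<delta> * e else 1 + \<delta> * e)"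

text \<open>
  The factor by which slopes change from one first exceptional fiber to the next.
\<close>

definition scale1 :: "nat \<Rightarrow> complex"
  where "scale1 s = (if s = 0 then - \<delta> else if s = n - 1 then 1 else \<delta> / om \<delta> c s)"

lemma scale1_nz: "s < n \<Longrightarrow> scale1 s \<noteq> 0"
  using d0 om_nz[of s] by (auto simp: scale1_def)

lemma nxt_less: "s < n \<Longrightarrow> nxt s < n"
  using n3 by (auto simp: nxt_def)

lemma last_nz: "n - 1 \<noteq> 0" "n - 1 < n" "0 < n"
  using n3 by auto

lemma biholo_F1_slope:
  assumes s: "s < n - 1"
  shows "biholo_at (X1 n \<delta> c) emb1 fdom f (Exc (pnt \<delta> c s) (Slope l)) (Exc (pnt \<delta> c (Suc s)) (Slope (scale1 s * l)))"
proof (cases "s = 0")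
  case True
  show ?thesis unfolding True X1_def
    by (rule B1.biholo_at_slope[OF tri_pnt_0]) (use s True in \<open>simp_all add: pnt_in_Z1 scale1_def center_pnt\<close>)
next
  case False
  then have "1 \<le> s" by simp
  show ?thesis unfolding X1_def
  proof (rule B1.biholo_at_slope[OF tri_pnt[OF \<open>1 \<le> s\<close> s]])
    show "scale1 s * l = (fst (center P2 (pnt \<delta> c s)) / (snd (center P2 (pnt \<delta> c s)))\<^sup>2 +
        l * (\<delta> / (om \<delta> c s * snd (center P2 (pnt \<delta> c s))))) / (1 / snd (center P2 (pnt \<delta> c s)))"
      using False s om_nz[of s] by (simp add: center_pnt scale1_def)
  qed (use s in \<open>simp_all add: pnt_in_Z1\<close>)
qed

lemma biholo_F1_vertical:
  assumes s: "s < n - 1"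
  shows "biholo_at (X1 n \<delta> c) emb1 fdom f (Exc (pnt \<delta> c s) Vertical) (Exc (pnt \<delta> c (Suc s)) Vertical)"
proof (cases "s = 0")
  case True
  show ?thesis unfolding True X1_def
    by (rule B1.biholo_at_vertical[OF tri_pnt_0]) (use s True in \<open>simp_all add: pnt_in_Z1\<close>)
next
  case False
  then have "1 \<le> s" by simp
  show ?thesis unfolding X1_def
    by (rule B1.biholo_at_vertical[OF tri_pnt[OF \<open>1 \<le> s\<close> s]]) (use s in \<open>simp_all add: pnt_in_Z1\<close>)
qed

lemma biholo_X2_F1_slope:
  assumes s: "s < n" and l: "l \<noteq> 0"
  shows "biholo_at (X2 n \<delta> c) emb2 fdom f (Base (Exc (pnt \<delta> c s) (Slope l)))
    (Base (Exc (pnt \<delta> c (nxt s)) (Slope (scale1 s * l))))"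
proof (cases "s = n - 1")
  case True
  have "fst (0, l) - \<delta> + c * fst (0, l) * (snd (0, l))\<^sup>2 \<noteq> 0" using d0 by simp
  from biholo_vert2[OF this] show ?thesis
    using True l last_nz by (simp add: psi2v_def nxt_def scale1_def)
next
  case False
  then have s': "s < n - 1" using s by simp
  show ?thesis unfolding X2_def
  proof (rule B2.biholo_at_Base)
    show "biholo_at (X1 n \<delta> c) emb1 fdom f (Exc (pnt \<delta> c s) (Slope l))
        (Exc (pnt \<delta> c (nxt s)) (Slope (scale1 s * l)))"
      using biholo_F1_slope[OF s'] False by (simp add: nxt_def)
  qed (use l s nxt_less scale1_nz in \<open>simp_all add: Exc_in_Z2_iff\<close>)
qed

lemma biholo_X2_F1_vertical:
  assumes s: "s < n"
  shows "biholo_at (X2 n \<delta> c) emb2 fdom f (Base (Exc (pnt \<delta> c s) Vertical))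
    (Base (Exc (pnt \<delta> c (nxt s)) Vertical))"
  unfolding X2_def
proof (rule B2.biholo_at_Base)
  show "biholo_at (X1 n \<delta> c) emb1 fdom f (Exc (pnt \<delta> c s) Vertical) (Exc (pnt \<delta> c (nxt s)) Vertical)"
    using biholo_F1_vertical[of s] biholo_vert1 s by (cases "s = n - 1") (simp_all add: nxt_def)
qed (use s nxt_less in \<open>simp_all add: Exc_in_Z2_iff\<close>)

lemma biholo_X2_F2_slope:
  assumes s: "s < n" and e: "s = n - 1 \<longrightarrow> e \<noteq> 0 \<and> 1 - \<delta> * e \<noteq> 0"
  shows "biholo_at (X2 n \<delta> c) emb2 fdom f (Qp s e) (Qp (nxt s) (step s e))"
proof -
  consider "s = 0" | "1 \<le> s" "s < n - 1" | "s = n - 1" using s by linarith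
  then show ?thesis
  proof cases
    case 1
    have "biholo_at (X2 n \<delta> c) emb2 fdom f (Exc (pE \<delta> c 0) (Slope e)) (Exc (pE \<delta> c (Suc 0)) (Slope (1 - \<delta> * e)))"
      unfolding X2_def
      by (rule B2.biholo_at_slope[OF tri_pE_0]) (use n3 in \<open>simp_all add: pE_in_Z2\<close>)
    then show ?thesis using 1 last_nz by (simp add: Qp_def nxt_def step_def)
  next
    case 2
    have "biholo_at (X2 n \<delta> c) emb2 fdom f (Exc (pE \<delta> c s) (Slope e)) (Exc (pE \<delta> c (Suc s)) (Slope (1 + \<delta> * e)))"
      unfolding X2_def
      by (rule B2.biholo_at_slope[OF tri_pE[OF 2]])
        (use 2 om_nz[OF 2] in \<open>simp_all add: pE_in_Z2 center_pE field_simps\<close>)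
    then show ?thesis using 2 by (simp add: Qp_def nxt_def step_def)
  next
    case 3
    then have e': "e \<noteq> 0" "1 - \<delta> * e \<noteq> 0" using e by simp_all
    have E: "1 / e - \<delta> = (1 - \<delta> * e) / e" using e' by (simp add: field_simps)
    then have "fst (1 / e, 0) - \<delta> + c * fst (1 / e, 0) * (snd (1 / e, 0::complex))\<^sup>2 \<noteq> 0"
      using e' by simp
    from biholo_vert2[OF this] show ?thesis
      using 3 e' last_nz E by (simp add: psi2v_def nxt_def step_def Qp_def)
  qed
qed

lemma biholo_X2_F2_vertical:
  assumes s: "s < n"
  shows "biholo_at (X2 n \<delta> c) emb2 fdom f (Exc (pE \<delta> c s) Vertical) (Exc (pE \<delta> c (nxt s)) Vertical)"
proof -
  consider "s = 0" | "1 \<le> s" "s < n - 1" | "s = n - 1" using s by linarith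
  then show ?thesis
  proof cases
    case 1
    have "biholo_at (X2 n \<delta> c) emb2 fdom f (Exc (pE \<delta> c 0) Vertical) (Exc (pE \<delta> c (Suc 0)) Vertical)"
      unfolding X2_def
      by (rule B2.biholo_at_vertical[OF tri_pE_0]) (use n3 in \<open>simp_all add: pE_in_Z2\<close>)
    then show ?thesis using 1 last_nz by (simp add: nxt_def)
  next
    case 2
    have "biholo_at (X2 n \<delta> c) emb2 fdom f (Exc (pE \<delta> c s) Vertical) (Exc (pE \<delta> c (Suc s)) Vertical)"
      unfolding X2_def
      by (rule B2.biholo_at_vertical[OF tri_pE[OF 2]]) (use 2 in \<open>simp_all add: pE_in_Z2\<close>)
    then show ?thesis using 2 by (simp add: nxt_def)
  next
    case 3
    have "fst (0, 0) - \<delta> + c * fst (0, 0) * (snd (0, 0))\<^sup>2 \<noteq> 0" using d0 by simp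
    from biholo_vert2[OF this] show ?thesis
      using 3 by (simp add: psi2v_def nxt_def)
  qed
qed

text \<open>
  The factor by which slopes change from one third exceptional fiber to the next.
\<close>

definition scale3 :: "nat \<Rightarrow> complex \<Rightarrow> complex"
  where "scale3 s e =
    (if s = 0 then - \<delta> else if s = n - 1 then - \<delta> * (1 - \<delta> * e) / e else \<delta> * om \<delta> c s)"

text \<open>
  The excluded values on the last fiber are \<open>\<eta>\<close> = 0, where \<^const>\<open>Sigma2\<close> meets it, and the point of
  indeterminacy \<open>\<eta>\<close> = 1/\<open>\<delta>\<close>.
\<close>

lemma tri_Qp_any:
  assumes s: "s < n" and e: "s = n - 1 \<longrightarrow> e \<noteq> 0 \<and> 1 - \<delta> * e \<noteq> 0"
  shows "\<exists>N A B C. tri_form (X2 n \<delta> c) emb2 fdom f (Qp s e) (Qp (nxt s) (step s e)) N A B C \<and>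
    (\<forall>l. scale3 s e * l = (B (0, e) + l * C (0, e)) / A (0, e))"
proof -
  consider "s = 0" | "1 \<le> s" "s < n - 1" | "s = n - 1" using s by linarith
  then show ?thesis
  proof cases
    case 1
    have st: "nxt s = Suc 0" "step s e = 1 - \<delta> * e" "scale3 s e = - \<delta>"
      using 1 last_nz by (simp_all add: nxt_def step_def scale3_def)
    show ?thesis unfolding st unfolding 1
      by (intro exI conjI, rule tri_Qp_0) simp
  next
    case 2
    have st: "nxt s = Suc s" "step s e = 1 + \<delta> * e" "scale3 s e = \<delta> * om \<delta> c s"
      using 2 by (simp_all add: nxt_def step_def scale3_def)
    show ?thesis unfolding st
      by (intro exI conjI, rule tri_Qp[OF 2]) (use om_nz[OF 2] in simp)
  next
    case 3
    have st: "nxt s = 0" "step s e = 1 - \<delta> * e" "scale3 s e = - \<delta> * (1 - \<delta> * e) / e"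
      using 3 last_nz by (simp_all add: nxt_def step_def scale3_def)
    have e': "e \<noteq> 0" "1 - \<delta> * e \<noteq> 0" using e 3 by simp_all
    show ?thesis unfolding st unfolding 3
      by (intro exI conjI, rule tri_Qp_last[OF e']) (use e' in simp)
  qed
qed

lemma scale3_nz:
  assumes "s < n" "s = n - 1 \<longrightarrow> e \<noteq> 0 \<and> 1 - \<delta> * e \<noteq> 0"
  shows "scale3 s e \<noteq> 0"
  using assms d0 om_nz[of s] by (auto simp: scale3_def)

text \<open>
  For y tending to 0 the image tends to [0:0:1], and so close to the parabola x = \<open>t\<^sup>2\<close> that its coordinate
  \<open>\<eta>\<close> = K on the second exceptional fiber tends to 1.
\<close>

lemma fmap_near_Sigma2:
  assumes y: "snd z \<noteq> 0" and K: "K = 1 + snd z * (c * snd z - \<delta> * fst z)" "K \<noteq> 0"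
  shows "psi2 \<delta> c 0 (snd z / K, K) = emb2 (f z)"
proof -
  have "K / snd z = - \<delta> * fst z + c * snd z + 1 / snd z" using y by (simp add: K(1) field_simps)
  moreover have "(snd z / K)\<^sup>2 * K = (snd z)\<^sup>2 / K" using K(2) by (simp add: power2_eq_square)
  ultimately show ?thesis
    using y K(2) by (simp add: psi2_def aff_at_simps aff2_def emb_eq fmap_eq hom_eq_simps power2_eq_square)
qed

text \<open>
  The induced map is regular along \<^const>\<open>Sigma2\<close> on the second blowup, but not locally invertible: by
  \<open>fmap_near_Sigma2\<close> the whole affine line goes to one point.
\<close>

lemma contracted_line: "(emb2 (x, 0), Qp 0 1) \<in> fX2 n \<delta> c"
proof -
  interpret X2: complex_surface "X2 n \<delta> c" by (rule complex_surface_X2)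
  have n: "0 < n" using n3 by simp
  let ?P = "bp_base (Z2 n \<delta> c) (bp_base (Z1 n \<delta> c) aff0)"
  \<comment> \<open>This is y times the second coordinate of the image, the denominator of 1/y removed.\<close>
  let ?K = "\<lambda>z. 1 + snd z * (c * snd z - \<delta> * fst z)"
  let ?\<Phi> = "\<lambda>z. (snd z / ?K z, ?K z)" and ?M = "{z. ?K z \<noteq> 0}"
  have P: "?P \<in> params (X2 n \<delta> c)"
    unfolding X2_def
    by (rule B2.bp_base_params) (simp only: X1_def, rule B1.bp_base_params, simp add: aff_params)
  have fP: "fst ?P = UNIV" "snd ?P z = emb2 z" for z
    using emb_notin_Z1[of "z"]
    by (auto simp: bp_base_def aff0_def emb_eq Base_notin_Z2 emb_notin_Z1[unfolded emb_eq, of "(_, _)", simplified])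
  have "open ?M" by (intro open_Collect_neq continuous_intros)
  then have h: "holo2 ?M ?\<Phi>" by (auto simp: holo2_iff intro!: sdiff_intros)
  have eq: "psi2 \<delta> c 0 (?\<Phi> z) = emb2 (f v)" if z: "?K z \<noteq> 0" "v \<in> fdom" "emb2 z = emb2 v" for z v
  proof -
    have v: "v = z" "snd z \<noteq> 0" using z by (auto simp: emb_eq hom_eq_simps fdom_iff prod_eq_iff)
    show ?thesis using fmap_near_Sigma2[OF v(2) refl z(1)] v(1) by simp
  qed
  have "local_form (X2 n \<delta> c) emb2 fdom f ?P (UNIV, psi2 \<delta> c 0) ?M ?\<Phi>"
    unfolding local_form_def
  proof (intro conjI ballI impI P psi2_params[OF n] h)
    show "snd (UNIV, psi2 \<delta> c 0) (?\<Phi> z) = emb2 (f v)" if "z \<in> ?M" "v \<in> fdom" "snd ?P z = emb2 v" for z v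
      using eq[of z v] that fP by simp
  qed (use fP in auto)
  from X2.local_form_induced[OF this, of "(x, 0)"] show ?thesis
    unfolding fX2_def fP by (simp add: psi2_def Qp_def)
qed

text \<open>
  Closure commutes with strict transforms, so only the generic points of a curve matter.
\<close>

lemma lift2_eq:
  assumes "C \<subseteq> pts P2"
  shows "lift2 n \<delta> c C = surf_top (X2 n \<delta> c) closure_of ((\<lambda>p. Base (Base p)) ` (C - Z1 n \<delta> c))"
proof -
  have 1: "Base ` (C - Z1 n \<delta> c) \<inter> pts (X1 n \<delta> c) = Base ` (C - Z1 n \<delta> c)"
    using assms by (auto simp: X1_def)
  have 2: "Base ` (C - Z1 n \<delta> c) - Z2 n \<delta> c = Base ` (C - Z1 n \<delta> c)"
    using Base_notin_Z2 by auto
  have "lift2 n \<delta> c C = strict_transform (X1 n \<delta> c) (Z2 n \<delta> c)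
      (surf_top (X1 n \<delta> c) closure_of (Base ` (C - Z1 n \<delta> c)))"
    by (simp only: lift2_def strict_transform_def[of P2] X1_def)
  also have "\<dots> = strict_transform (X1 n \<delta> c) (Z2 n \<delta> c) (Base ` (C - Z1 n \<delta> c))"
    by (simp only: B2.strict_transform_closure 1)
  also have "\<dots> = surf_top (X2 n \<delta> c) closure_of (Base ` Base ` (C - Z1 n \<delta> c))"
    by (simp only: strict_transform_def X2_def 2)
  finally show ?thesis by (simp only: image_image)
qed

lemma Sigma2_minus: "Sigma2 - Z1 n \<delta> c = (\<lambda>x. emb (x, 0)) ` UNIV"
proof (intro set_eqI iffI)
  fix p assume "p \<in> Sigma2 - Z1 n \<delta> c"
  then obtain t x where p: "p = hom t x 0" "(t, x) \<noteq> (0, 0)" "p \<notin> Z1 n \<delta> c"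
    by (auto simp: Sigma2_def)
  have "t \<noteq> 0"
  proof
    assume "t = 0"
    then have "p = hom 0 1 0" unfolding p hom_eq_iff by (intro exI[of _ "1 / x"]) (use p in auto)
    also have "\<dots> = pnt \<delta> c (n - 1)" using last_nz omega_last by (simp add: pnt_def)
    finally show False using p(3) pnt_in_Z1[of "n - 1"] last_nz by simp
  qed
  then have "p = emb (x / t, 0)" unfolding p(1) emb_eq hom_eq_iff by (intro exI[of _ "1 / t"]) simp
  then show "p \<in> (\<lambda>x. emb (x, 0)) ` UNIV" by blast
next
  fix p assume "p \<in> (\<lambda>x. emb (x, 0)) ` UNIV"
  then obtain x where p: "p = emb (x, 0)" by blast
  then have "p \<in> Sigma2"
    unfolding Sigma2_def mem_Collect_eq by (intro exI[of _ 1] exI[of _ x]) (simp add: emb_eq)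
  then show "p \<in> Sigma2 - Z1 n \<delta> c" using p emb_notin_Z1 by simp
qed

primrec ev :: "nat \<Rightarrow> complex" where
  "ev 0 = 1"
| "ev (Suc i) = step (i mod n) (ev i)"

definition Q :: "nat \<Rightarrow> p2 bpt bpt"
  where "Q i = Qp (i mod n) (ev i)"

lemma nxt_mod: "nxt (i mod n) = Suc i mod n"
  using n3 by (auto simp: nxt_def mod_Suc)

text \<open>
  The strict transform contains points besides the affine line, but the map is continuous where it is
  regular, so they have no other image.
\<close>

lemma orbit_0: "orbit n \<delta> c 0 = {Q 0}"
proof -
  interpret X2: complex_surface "X2 n \<delta> c" by (rule complex_surface_X2)
  let ?C = "(\<lambda>x. emb2 (x, 0)) ` UNIV"
  have "Sigma2 \<subseteq> pts P2" by (auto simp: Sigma2_def intro!: hom_in_P2)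
  then have l: "lift2 n \<delta> c Sigma2 = surf_top (X2 n \<delta> c) closure_of ?C"
    by (simp add: lift2_eq Sigma2_minus image_image)
  have C: "(p, Qp 0 1) \<in> fX2 n \<delta> c" if "p \<in> ?C" for p
    using contracted_line that by auto
  have uniq: "q = Qp 0 1" if "p \<in> lift2 n \<delta> c Sigma2" "(p, q) \<in> fX2 n \<delta> c" for p q
    by (rule X2.induced_map_closure[OF dense_in_X2 that(2)[unfolded fX2_def] that(1)[unfolded l]])
      (rule C[unfolded fX2_def])
  have "emb2 (0, 0) \<in> pts (X2 n \<delta> c)"
    using X2.induced_map_pts[OF contracted_line[of 0, unfolded fX2_def]] by (rule conjunct1)
  then have "emb2 (0, 0) \<in> topspace (surf_top (X2 n \<delta> c)) \<inter> ?C"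
    by (intro IntI image_eqI[of _ _ 0]) (simp_all add: X2.topspace_surf)
  then have mem: "emb2 (0, 0) \<in> lift2 n \<delta> c Sigma2"
    unfolding l by (rule subsetD[OF closure_of_subset_Int])
  have "fX2 n \<delta> c `` lift2 n \<delta> c Sigma2 = {Qp 0 1}"
  proof (intro set_eqI iffI)
    fix q assume "q \<in> fX2 n \<delta> c `` lift2 n \<delta> c Sigma2"
    then show "q \<in> {Qp 0 1}" by (elim ImageE) (simp add: uniq)
  next
    fix q assume "q \<in> {Qp 0 1}"
    then show "q \<in> fX2 n \<delta> c `` lift2 n \<delta> c Sigma2"
      using ImageI[OF contracted_line[of 0] mem] by simp
  qed
  then show ?thesis by (simp add: orbit_def Q_def)
qed

text \<open>
  The orbit can be followed as long as it avoids, on the last fiber, the strict transform of \<^const>\<open>Sigma2\<close> and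
  the point of indeterminacy.
\<close>

lemma orbit_eq:
  assumes "\<And>i. i < N \<Longrightarrow> i mod n = n - 1 \<Longrightarrow> ev i \<noteq> 0 \<and> 1 - \<delta> * ev i \<noteq> 0"
  shows "orbit n \<delta> c N = {Q N}"
  using assms
proof (induction N)
  case 0
  show ?case by (rule orbit_0)
next
  case (Suc N)
  interpret X2: complex_surface "X2 n \<delta> c" by (rule complex_surface_X2)
  have IH: "orbit n \<delta> c N = {Q N}" using Suc by simp
  have "biholo_at (X2 n \<delta> c) emb2 fdom f (Q N) (Q (Suc N))"
    using biholo_X2_F2_slope[of "N mod n" "ev N"] Suc.prems[of N] last_nz
    by (simp add: Q_def nxt_mod)
  then have mem: "(Q N, Q (Suc N)) \<in> fX2 n \<delta> c"
    unfolding fX2_def by (rule X2.biholo_at_induced)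
  have uniq: "q = Q (Suc N)" if "(Q N, q) \<in> fX2 n \<delta> c" for q
    by (rule X2.induced_map_unique[OF dense_in_X2 that[unfolded fX2_def] mem[unfolded fX2_def]])
  have "fX2 n \<delta> c `` {Q N} = {Q (Suc N)}"
  proof (intro set_eqI iffI)
    fix q assume "q \<in> fX2 n \<delta> c `` {Q N}"
    then show "q \<in> {Q (Suc N)}" by (elim ImageE) (simp add: uniq)
  next
    fix q assume "q \<in> {Q (Suc N)}"
    then show "q \<in> fX2 n \<delta> c `` {Q N}" using ImageI[OF mem, of "{Q N}"] by simp
  qed
  moreover have "orbit n \<delta> c (Suc N) = fX2 n \<delta> c `` orbit n \<delta> c N"
    by (simp add: orbit_def relcomp_Image)
  ultimately show ?case using IH by simp
qed

end

section \<open>The third blowup\<close>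

text \<open>
  The orbit of the contracted line ends in the point of indeterminacy after n m points, and does not
  meet itself before.
\<close>

locale henon_root = henon +
  fixes m :: nat
  assumes m1: "1 \<le> m"
    and ev_last: "ev (n * m - 1) = 1 / \<delta>"
    and ev_nonzero: "\<And>i. i < n * m \<Longrightarrow> i mod n = 0 \<or> i mod n = n - 1 \<Longrightarrow> ev i \<noteq> 0"
    and ev_inj: "\<And>i j. i < n * m \<Longrightarrow> j < n * m \<Longrightarrow> i mod n = j mod n \<Longrightarrow> ev i = ev j \<Longrightarrow> i = j"
begin

definition last_index :: nat where "last_index = n * m - 1"

lemma last_index: "Suc last_index = n * m" "last_index mod n = n - 1" "last_index < n * m" "ev last_index = 1 / \<delta>"
proof -
  obtain k where k: "m = Suc k" using m1 by (cases m) auto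
  have nm: "n * m = n * k + n" using k by simp
  have t: "last_index = n * k + (n - 1)" using nm n3 unfolding last_index_def by linarith
  show "Suc last_index = n * m" using nm t n3 by linarith
  then show "last_index < n * m" by linarith
  have "last_index mod n = (n - 1) mod n" unfolding t by (rule mod_mult_self4)
  then show "last_index mod n = n - 1" using n3 by simp
  show "ev last_index = 1 / \<delta>" using ev_last by (simp add: last_index_def)
qed

text \<open>
  An earlier visit to the point of indeterminacy would repeat the point reached at the end.
\<close>

lemma ev_regular:
  assumes "i < last_index" "i mod n = n - 1"
  shows "ev i \<noteq> 0 \<and> 1 - \<delta> * ev i \<noteq> 0"
proof
  show "ev i \<noteq> 0" using ev_nonzero[of i] assms last_index(3) by simp
  have "ev i \<noteq> ev last_index" using ev_inj[of i last_index] assms last_index by auto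
  then show "1 - \<delta> * ev i \<noteq> 0" using d0 by (auto simp: last_index field_simps)
qed

lemma Qp_eq_iff: "s < n \<Longrightarrow> r < n \<Longrightarrow> Qp s e = Qp r e' \<longleftrightarrow> s = r \<and> e = e'"
  by (auto simp: Qp_def pE_inj)

lemma Q_inj: "i < n * m \<Longrightarrow> j < n * m \<Longrightarrow> Q i = Q j \<longleftrightarrow> i = j"
  using ev_inj[of i j] n3 by (auto simp: Q_def Qp_eq_iff)

lemma orbit_Q: "i < n * m \<Longrightarrow> orbit n \<delta> c i = {Q i}"
  by (rule orbit_eq) (rule ev_regular, use last_index(1) in simp_all)

lemma Z3_eq: "Z3 n m \<delta> c = Q ` {..<n * m}"
  unfolding Z3_def using orbit_Q by auto

lemma Q_in_Z3: "i < n * m \<Longrightarrow> Q i \<in> Z3 n m \<delta> c"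
  by (simp add: Z3_eq)

lemma Base_notin_Z3: "Base x \<notin> Z3 n m \<delta> c"
  by (auto simp: Z3_eq Q_def Qp_def)

lemma Vertical_notin_Z3: "Exc p Vertical \<notin> Z3 n m \<delta> c"
  by (auto simp: Z3_eq Q_def Qp_def)

lemma Qp_in_Z3_iff: "s < n \<Longrightarrow> Qp s e \<in> Z3 n m \<delta> c \<longleftrightarrow> (\<exists>i<n * m. s = i mod n \<and> e = ev i)"
  using n3 by (auto simp: Z3_eq Q_def Qp_eq_iff)

lemma Q_0_neq: "0 < n * m"
  using n3 m1 by simp

lemma nxt_inj: "s < n \<Longrightarrow> r < n \<Longrightarrow> nxt s = nxt r \<longleftrightarrow> s = r"
  by (auto simp: nxt_def split: if_splits)

lemma nxt_onto: "s < n \<Longrightarrow> \<exists>r<n. s = nxt r"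
proof (cases s)
  case 0
  then show ?thesis using last_nz by (intro exI[of _ "n - 1"]) (simp add: nxt_def)
next
  case (Suc r)
  assume "s < n"
  then show ?thesis using Suc by (intro exI[of _ r]) (simp add: nxt_def)
qed

lemma nxt_0_iff: "s < n \<Longrightarrow> nxt s = 0 \<longleftrightarrow> s = n - 1"
  by (auto simp: nxt_def)

lemma step_inj: "step s e = step s e' \<longleftrightarrow> e = e'"
  using d0 by (auto simp: step_def)

lemma step_onto: "\<exists>e. e' = step s e"
proof
  show "e' = step s (if s = 0 \<or> s = n - 1 then (1 - e') / \<delta> else (e' - 1) / \<delta>)"
    using d0 by (simp add: step_def)
qed

lemma Q_Suc: "Q (Suc i) = Qp (nxt (i mod n)) (step (i mod n) (ev i))"
  by (simp add: Q_def nxt_mod)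

lemma Q_0: "Q 0 = Qp 0 1"
  by (simp add: Q_def)

text \<open>The centers of the third blowup are carried along, except where the orbit begins and ends.\<close>

lemma step_in_Z3_iff:
  assumes s: "s < n"
  shows "Qp (nxt s) (step s e) \<in> Z3 n m \<delta> c \<longleftrightarrow>
    (s = n - 1 \<and> e = 0) \<or> (Qp s e \<in> Z3 n m \<delta> c \<and> \<not> (s = n - 1 \<and> e = 1 / \<delta>))"
proof
  assume "Qp (nxt s) (step s e) \<in> Z3 n m \<delta> c"
  then obtain j where j: "j < n * m" "Qp (nxt s) (step s e) = Q j" by (auto simp: Z3_eq)
  show "(s = n - 1 \<and> e = 0) \<or> (Qp s e \<in> Z3 n m \<delta> c \<and> \<not> (s = n - 1 \<and> e = 1 / \<delta>))"
  proof (cases j)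
    case 0
    then have "nxt s = 0" "step s e = 1"
      using j(2) nxt_less[OF s] last_nz by (simp_all add: Q_0 Qp_eq_iff)
    then show ?thesis using d0 nxt_0_iff[OF s] by (auto simp: step_def)
  next
    case (Suc i)
    have "nxt s = nxt (i mod n)" "step s e = step (i mod n) (ev i)"
      using j(2) nxt_less[OF s] nxt_less[of "i mod n"] last_nz by (simp_all add: Suc Q_Suc Qp_eq_iff)
    then have i: "s = i mod n" "e = ev i" using nxt_inj[OF s, of "i mod n"] last_nz step_inj by auto
    then have "Qp s e = Q i" by (simp add: Q_def)
    moreover have "i < last_index" using j(1) Suc last_index(1) by simp
    ultimately show ?thesis
      using ev_regular[of i] i Q_in_Z3[of i] last_index(3) d0 by auto
  qed
next
  assume "(s = n - 1 \<and> e = 0) \<or> (Qp s e \<in> Z3 n m \<delta> c \<and> \<not> (s = n - 1 \<and> e = 1 / \<delta>))"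
  then show "Qp (nxt s) (step s e) \<in> Z3 n m \<delta> c"
  proof
    assume "s = n - 1 \<and> e = 0"
    then have "Qp (nxt s) (step s e) = Q 0" by (simp add: nxt_def step_def Q_0)
    then show ?thesis using Q_in_Z3[OF Q_0_neq] by simp
  next
    assume *: "Qp s e \<in> Z3 n m \<delta> c \<and> \<not> (s = n - 1 \<and> e = 1 / \<delta>)"
    then obtain i where i: "i < n * m" "s = i mod n" "e = ev i" using Qp_in_Z3_iff[OF s] by auto
    have "i \<noteq> last_index" using * i last_index by auto
    then have "Suc i < n * m" using i(1) last_index(1) by simp
    then show ?thesis using Q_in_Z3[of "Suc i"] i by (simp add: Q_Suc)
  qed
qed

lemma blowup_data_X2: "blowup_data (X2 n \<delta> c) (Z3 n m \<delta> c)"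
proof -
  interpret X2: complex_surface "X2 n \<delta> c" by (rule complex_surface_X2)
  have "Q i \<in> pts (X2 n \<delta> c)" for i
    using pE_in_Z2[of "i mod n"] n3 by (simp add: Q_def Qp_def X2_def)
  then show ?thesis by unfold_locales (auto simp: Z3_eq)
qed

sublocale B3: blowup_data "X2 n \<delta> c" "Z3 n m \<delta> c" by (rule blowup_data_X2)

lemma complex_surface_X3: "complex_surface (X3 n m \<delta> c)"
  unfolding X3_def by (rule B3.complex_surface_blowup)

lemma dense_in_X3: "dense_in (X3 n m \<delta> c) emb3 fdom"
  using B3.dense_in_blowup[OF dense_in_X2] by (simp add: X3_def)

lemma index_less: "i mod n < n"
  using n3 by simp

definition psi3 :: "nat \<Rightarrow> complex \<times> complex \<Rightarrow> p2 bpt bpt bpt"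
  where "psi3 i z = (if fst z = 0 then Exc (Q i) (Slope (snd z))
    else Base (psi2 \<delta> c (i mod n) (fst z, ev i + fst z * snd z)))"

lemma chart_Q: "chart (X2 n \<delta> c) (Q i) = (UNIV, psi2 \<delta> c (i mod n))"
  unfolding Q_def by (rule chart_Qp[OF index_less])

lemma center_Q: "center (X2 n \<delta> c) (Q i) = (0, ev i)"
  unfolding Q_def by (rule center_Qp[OF index_less])

lemma slope3: "bp_slope (X2 n \<delta> c) (Z3 n m \<delta> c) (Q i) = (UNIV, psi3 i)"
proof -
  have "psi2 \<delta> c (i mod n) (a, b) \<notin> Z3 n m \<delta> c" if "a \<noteq> 0" for a b
    using that by (simp add: psi2_def Base_notin_Z3)
  then show ?thesis
    unfolding bp_slope_def chart_Q center_Q by (auto simp: slope_map_def psi3_def fun_eq_iff)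
qed

lemma psi3_params: "i < n * m \<Longrightarrow> (UNIV, psi3 i) \<in> params (X3 n m \<delta> c)"
  using B3.bp_slope_params[OF Q_in_Z3, of i] by (simp add: slope3 X3_def)

abbreviation "affX \<equiv> bp_base (Z3 n m \<delta> c) (bp_base (Z2 n \<delta> c) (bp_base (Z1 n \<delta> c) aff0))"

lemma affX: "affX \<in> params (X3 n m \<delta> c)" "fst affX = UNIV" "snd affX z = emb3 z"
proof -
  have "bp_base (Z1 n \<delta> c) aff0 \<in> params (X1 n \<delta> c)"
    unfolding X1_def by (rule B1.bp_base_params) (simp add: aff_params)
  then have "bp_base (Z2 n \<delta> c) (bp_base (Z1 n \<delta> c) aff0) \<in> params (X2 n \<delta> c)"
    unfolding X2_def by (rule B2.bp_base_params)
  then show "affX \<in> params (X3 n m \<delta> c)"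
    unfolding X3_def by (rule B3.bp_base_params)
  have "snd aff0 z \<notin> Z1 n \<delta> c" for z
    using emb_notin_Z1[of z] by (simp add: aff0_def emb_eq)
  then show "fst affX = UNIV"
    by (simp add: bp_base_def Base_notin_Z2 Base_notin_Z3) (simp add: aff0_def)
  show "snd affX z = emb3 z"
    by (simp add: bp_base_def aff0_def emb_eq)
qed

text \<open>
  Blowing up the image of the contracted line resolves the contraction.  In \<open>fmap_near_Sigma2\<close> the second
  coordinate satisfies K = 1 + y (c y - \<open>\<delta>\<close> x), so its slope relative to the center with \<open>\<eta>\<close> = 1 is
  (c y - \<open>\<delta>\<close> x) K, and x is recovered from the slope at y = 0.
\<close>

lemma biholo_line: "biholo_at (X3 n m \<delta> c) emb3 fdom f (emb3 (x, 0)) (Exc (Q 0) (Slope (- \<delta> * x)))"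
proof -
  let ?g = "\<lambda>z. c * snd z - \<delta> * fst z"
  let ?K = "\<lambda>z. 1 + snd z * ?g z"
  let ?\<Phi> = "\<lambda>z. (snd z / ?K z, ?g z * ?K z)" and ?M = "{z. ?K z \<noteq> 0}"
  have "open ?M" by (intro open_Collect_neq continuous_intros)
  then have h: "holo2 ?M ?\<Phi>" by (auto simp: holo2_iff intro!: sdiff_intros)
  have eq: "psi3 0 (?\<Phi> z) = emb3 (f v)" if z: "?K z \<noteq> 0" "v \<in> fdom" "emb3 z = emb3 v" for z v
  proof -
    have v: "v = z" "snd z \<noteq> 0" using z by (auto simp: emb_eq hom_eq_simps fdom_iff prod_eq_iff)
    have "ev 0 + snd z / ?K z * (?g z * ?K z) = ?K z" using z(1) by simp
    then show ?thesis
      using fmap_near_Sigma2[OF v(2) refl z(1)] v z(1) unfolding psi3_def by simp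
  qed
  have "local_form (X3 n m \<delta> c) emb3 fdom f affX (UNIV, psi3 0) ?M ?\<Phi>"
    unfolding local_form_def
  proof (intro conjI ballI impI affX(1) psi3_params[OF Q_0_neq] h)
    show "snd (UNIV, psi3 0) (?\<Phi> z) = emb3 (f v)" if "z \<in> ?M" "v \<in> fdom" "snd affX z = emb3 v" for z v
      using eq[of z v] that affX(3)[of z] by simp
  qed (use affX(2) in auto)
  moreover have "nondeg ?\<Phi> (x, 0)"
  proof -
    have g: "sder ?g (x, 0) (- \<delta>) c"
      by (rule sder_eq[OF sder_diff[OF sder_mult[OF sder_const sder_snd] sder_mult[OF sder_const sder_fst]]])
        simp_all
    have K: "sder ?K (x, 0) 0 (- \<delta> * x)"
      by (rule sder_eq[OF sder_add[OF sder_const sder_mult[OF sder_snd g]]]) simp_all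
    have "sder (\<lambda>z. snd z / ?K z) (x, 0) 0 1"
      by (rule sder_eq[OF sder_divide[OF sder_snd K]]) simp_all
    then have 1: "sder (\<lambda>z. fst (?\<Phi> z)) (x, 0) 0 1" by simp
    have "sder (\<lambda>z. ?g z * ?K z) (x, 0) (- \<delta>) (- \<delta> * x * (- \<delta> * x) + c)"
      by (rule sder_eq[OF sder_mult[OF g K]]) simp_all
    then have 2: "sder (\<lambda>z. snd (?\<Phi> z)) (x, 0) (- \<delta>) (- \<delta> * x * (- \<delta> * x) + c)" by simp
    show ?thesis by (rule nondegI[OF 1 2]) (use d0 in simp)
  qed
  ultimately show ?thesis unfolding biholo_at_def
    by (intro exI[of _ affX] exI[of _ "(UNIV, psi3 0)"] exI[of _ ?M] exI[of _ ?\<Phi>] exI[of _ "(x, 0)"] conjI)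
      (simp_all add: affX(3) psi3_def)
qed

text \<open>
  The point where the strict transform of \<^const>\<open>Sigma2\<close> meets the last second fiber.  Its image, on the blowup
  of \<open>\<eta>\<close> = 1, is the vertical direction: in the coordinates (l, v) with u = l v and \<open>\<eta>\<close> = 1 + v the map
  \<open>fmap_psi2_last\<close> is v = \<open>\<eta>\<close> G and l = u / (H G).
\<close>

lemma biholo_F2_zero:
  "biholo_at (X3 n m \<delta> c) emb3 fdom f (Base (Qp (n - 1) 0)) (Exc (Q 0) Vertical)"
proof -
  let ?P = "bp_base (Z3 n m \<delta> c) (UNIV, psi2 \<delta> c (n - 1))"
  let ?R = "bp_vert (X2 n \<delta> c) (Z3 n m \<delta> c) (Q 0)"
  have P: "?P \<in> params (X3 n m \<delta> c)"
    unfolding X3_def by (rule B3.bp_base_params[OF psi2_params]) (simp add: last_nz)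
  have R: "?R \<in> params (X3 n m \<delta> c)"
    unfolding X3_def by (rule B3.bp_vert_params[OF Q_in_Z3[OF Q_0_neq]])
  let ?G = "\<lambda>z. c * snd z * (fst z)\<^sup>2 - \<delta>"
  let ?H = "\<lambda>z. 1 + snd z * ?G z"
  let ?\<Phi> = "\<lambda>z. (fst z / (?H z * ?G z), snd z * ?G z)"
  let ?N = "fst ?P \<inter> {z. ?H z * ?G z \<noteq> 0}"
  let ?M = "{z \<in> ?N. ?\<Phi> z \<in> fst ?R}"
  have "open ?N" using params_open[OF P] by (intro open_Int open_Collect_neq continuous_intros)
  then have h0: "holo2 ?N ?\<Phi>" by (auto simp: holo2_iff intro!: sdiff_intros)
  have "open ?M" by (rule holo2_open_preimage[OF h0 params_open[OF R]])
  then have h: "holo2 ?M ?\<Phi>" by (rule holo2_subset[OF h0]) blast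
  have eq: "snd ?R (?\<Phi> z) = emb3 (f v)"
    if z: "?H z * ?G z \<noteq> 0" and v: "v \<in> fdom" "psi2 \<delta> c (n - 1) z = emb2 v" for z v
  proof -
    have H: "?H z = 1 - \<delta> * snd z + c * (snd z)\<^sup>2 * (fst z)\<^sup>2"
      by (simp add: algebra_simps power2_eq_square)
    have nz: "?H z \<noteq> 0" "?G z \<noteq> 0" using z by simp_all
    note f = fmap_psi2_last[OF v(2,1) H nz(1)]
    have "vert_map (0, 1) (?\<Phi> z) = (fst z * snd z / ?H z, ?H z)"
      using nz by (simp add: vert_map_def)
    moreover have "snd (?\<Phi> z) \<noteq> 0" using f(2) nz by simp
    ultimately show ?thesis
      using f(3) by (simp only: bp_vert_def snd_conv chart_Q center_Q ev.simps mod_0 if_False)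
  qed
  have "local_form (X3 n m \<delta> c) emb3 fdom f ?P ?R ?M ?\<Phi>"
    unfolding local_form_def
  proof (intro conjI ballI impI P R h)
    show "snd ?R (?\<Phi> z) = emb3 (f v)" if "z \<in> ?M" "v \<in> fdom" "snd ?P z = emb3 v" for z v
      using eq[of z v] that by (simp add: bp_base_def)
  qed auto
  moreover have "Qp (n - 1) 0 \<notin> Z3 n m \<delta> c"
    using ev_nonzero last_nz by (auto simp: Qp_in_Z3_iff)
  then have "(0, 0) \<in> fst ?P" "snd ?P (0, 0) = Base (Qp (n - 1) 0)"
    by (simp_all add: bp_base_def psi2_def Qp_def)
  moreover have "(0, 0) \<in> fst ?R" "snd ?R (0, 0) = Exc (Q 0) Vertical"
    using B3.Exc_vert[OF Q_in_Z3[OF Q_0_neq], of 0] by simp_all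
  moreover have "nondeg ?\<Phi> (0, 0)"
  proof -
    have "sdiff ?G (0, 0)" "sdiff (\<lambda>z. ?H z * ?G z) (0, 0)" by (intro sdiff_intros)+
    then obtain a b a' b' where G: "sder ?G (0, 0) a b" and HG: "sder (\<lambda>z. ?H z * ?G z) (0, 0) a' b'"
      unfolding sdiff_def by auto
    have "sder (\<lambda>z. fst z / (?H z * ?G z)) (0, 0) (- 1 / \<delta>) 0"
      by (rule sder_eq[OF sder_divide[OF sder_fst HG]]) (use d0 in \<open>simp_all add: power2_eq_square\<close>)
    then have 1: "sder (\<lambda>z. fst (?\<Phi> z)) (0, 0) (- 1 / \<delta>) 0" by simp
    have "sder (\<lambda>z. snd z * ?G z) (0, 0) 0 (- \<delta>)"
      by (rule sder_eq[OF sder_mult[OF sder_snd G]]) simp_all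
    then have 2: "sder (\<lambda>z. snd (?\<Phi> z)) (0, 0) 0 (- \<delta>)" by simp
    show ?thesis by (rule nondegI[OF 1 2]) (use d0 in simp)
  qed
  ultimately show ?thesis unfolding biholo_at_def
    by (intro exI[of _ ?P] exI[of _ ?R] exI[of _ ?M] exI[of _ ?\<Phi>] exI[of _ "(0, 0)"] conjI)
      (use d0 in simp_all)
qed

text \<open>
  Blowing up the point of indeterminacy \<open>\<eta>\<close> = 1/\<open>\<delta>\<close> removes the indeterminacy: with \<open>\<eta>\<close> = 1/\<open>\<delta>\<close> + u l the numerator
  1 - \<open>\<delta>\<close> \<open>\<eta>\<close> = - \<open>\<delta>\<close> u l cancels the pole 1/u of the second affine coordinate of the image, and the exceptional
  fiber u = 0 is spread out over \<^const>\<open>Sigma1\<close>.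
\<close>

lemma biholo_last_slope:
  "biholo_at (X3 n m \<delta> c) emb3 fdom f (Exc (Q last_index) (Slope l)) (emb3 (0, - (\<delta>\<^sup>2 * l)))"
proof -
  let ?e = "\<lambda>z. 1 / \<delta> + fst z * snd z"
  let ?g = "\<lambda>z. c * (?e z)\<^sup>2 * fst z - \<delta> * snd z"
  let ?\<Phi> = "\<lambda>z. (fst z * ?e z, ?g z / ?e z)" and ?M = "{z. ?e z \<noteq> 0}"
  have "open ?M" by (intro open_Collect_neq continuous_intros)
  then have h: "holo2 ?M ?\<Phi>" by (auto simp: holo2_iff d0 intro!: sdiff_intros)
  have eq: "emb3 (?\<Phi> z) = emb3 (f v)" if z: "?e z \<noteq> 0" "psi3 last_index z = emb3 v" for z v
  proof -
    have u: "fst z \<noteq> 0" and e: "snd aff1 (fst z, (fst z)\<^sup>2 * ?e z) = emb v"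
      using z(2) by (auto simp: psi3_def psi2_def last_index aff_last om_last_Suc split: if_splits)
    have v: "fst v = 1 / fst z" "snd v = fst z * ?e z"
      using e u by (simp_all add: aff1_def emb_eq hom_eq_simps power2_eq_square)
    have k: "1 - \<delta> * ?e z = - \<delta> * fst z * snd z" using d0 by (simp add: algebra_simps)
    have "- \<delta> * (1 / fst z) + c * (fst z * ?e z) + 1 / (fst z * ?e z) =
        ((1 - \<delta> * ?e z) / fst z + c * (?e z)\<^sup>2 * fst z) / ?e z"
      using u z(1) by (simp add: divide_simps power2_eq_square) (simp add: algebra_simps)
    also have "\<dots> = ?g z / ?e z" unfolding k using u by simp
    finally show ?thesis by (simp add: emb_eq fmap_eq v)
  qed
  have "local_form (X3 n m \<delta> c) emb3 fdom f (UNIV, psi3 last_index) affX ?M ?\<Phi>"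
    unfolding local_form_def
  proof (intro conjI ballI impI affX(1) psi3_params[OF last_index(3)] h)
    show "snd affX (?\<Phi> z) = emb3 (f v)" if "z \<in> ?M" "v \<in> fdom" "snd (UNIV, psi3 last_index) z = emb3 v" for z v
      using eq[of z v] that affX(3) by simp
  qed (use affX(2) in auto)
  moreover have "nondeg ?\<Phi> (0, l)"
  proof -
    have e: "sder ?e (0, l) l 0"
      by (rule sder_eq[OF sder_add[OF sder_const sder_mult[OF sder_fst sder_snd]]]) simp_all
    have "sdiff (\<lambda>z. c * (?e z)\<^sup>2) (0, l)" by (intro sdiff_intros) (simp_all add: d0)
    then obtain a b where c: "sder (\<lambda>z. c * (?e z)\<^sup>2) (0, l) a b" unfolding sdiff_def by auto
    have g: "sder ?g (0, l) (c / \<delta>\<^sup>2) (- \<delta>)"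
      by (rule sder_eq[OF sder_diff[OF sder_mult[OF c sder_fst] sder_mult[OF sder_const sder_snd]]])
        (simp_all add: power_divide)
    have "sder (\<lambda>z. fst z * ?e z) (0, l) (1 / \<delta>) 0"
      by (rule sder_eq[OF sder_mult[OF sder_fst e]]) simp_all
    then have 1: "sder (\<lambda>z. fst (?\<Phi> z)) (0, l) (1 / \<delta>) 0" by simp
    have "?e (0, l) \<noteq> 0" using d0 by simp
    from sder_divide[OF g e this]
    have 2: "sder (\<lambda>z. snd (?\<Phi> z)) (0, l) ((c / \<delta>\<^sup>2 * ?e (0, l) - ?g (0, l) * l) / (?e (0, l))\<^sup>2)
        ((- \<delta> * ?e (0, l) - ?g (0, l) * 0) / (?e (0, l))\<^sup>2)" by simp
    show ?thesis by (rule nondegI[OF 1 2]) (use d0 in simp)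
  qed
  ultimately show ?thesis unfolding biholo_at_def
    by (intro exI[of _ "(UNIV, psi3 last_index)"] exI[of _ affX] exI[of _ ?M] exI[of _ ?\<Phi>] exI[of _ "(0, l)"] conjI)
      (use d0 in \<open>simp_all add: affX(3) psi3_def power2_eq_square mult_ac\<close>)
qed

text \<open>
  The remaining direction, in the coordinates (l, v) with u = l v and \<open>\<eta>\<close> = 1/\<open>\<delta>\<close> + v.  There H = v G, and the
  factor v cancels from u \<open>\<eta>\<close> / H; the image is the point where \<^const>\<open>Sigma1\<close> meets the second exceptional fiber.
\<close>

lemma biholo_last_vertical:
  "biholo_at (X3 n m \<delta> c) emb3 fdom f (Exc (Q last_index) Vertical) (Base (Qp 0 0))"
proof -
  let ?P = "bp_vert (X2 n \<delta> c) (Z3 n m \<delta> c) (Q last_index)"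
  let ?R = "bp_base (Z3 n m \<delta> c) (UNIV, psi2 \<delta> c 0)"
  have R: "?R \<in> params (X3 n m \<delta> c)"
    unfolding X3_def by (rule B3.bp_base_params[OF psi2_params]) (simp add: last_nz)
  have P: "?P \<in> params (X3 n m \<delta> c)"
    unfolding X3_def by (rule B3.bp_vert_params[OF Q_in_Z3[OF last_index(3)]])
  let ?e = "\<lambda>z. 1 / \<delta> + snd z"
  let ?G = "\<lambda>z. c * (?e z)\<^sup>2 * (fst z)\<^sup>2 * snd z - \<delta>"
  let ?\<Phi> = "\<lambda>z. (?e z * fst z / ?G z, snd z * ?G z)"
  let ?N = "fst ?P \<inter> {z. ?G z \<noteq> 0}"
  let ?M = "{z \<in> ?N. ?\<Phi> z \<in> fst ?R}"
  have "open ?N" using params_open[OF P] by (intro open_Int open_Collect_neq continuous_intros)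
  then have h0: "holo2 ?N ?\<Phi>" by (auto simp: holo2_iff d0 intro!: sdiff_intros)
  have "open ?M" by (rule holo2_open_preimage[OF h0 params_open[OF R]])
  then have h: "holo2 ?M ?\<Phi>" by (rule holo2_subset[OF h0]) blast
  have eq: "snd ?R (?\<Phi> z) = emb3 (f v)"
    if z: "?G z \<noteq> 0" and v: "v \<in> fdom" "snd ?P z = emb3 v" for z v
  proof -
    have s: "snd z \<noteq> 0" and e: "psi2 \<delta> c (n - 1) (fst z * snd z, ?e z) = emb2 v"
      using v(2) by (auto simp: bp_vert_def chart_Q center_Q last_index vert_map_def split: if_splits)
    have H: "snd z * ?G z = 1 - \<delta> * snd (fst z * snd z, ?e z) +
        c * (snd (fst z * snd z, ?e z))\<^sup>2 * (fst (fst z * snd z, ?e z))\<^sup>2"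
      using d0 by (simp add: power_mult_distrib) (simp add: algebra_simps power2_eq_square)
    have nz: "snd z * ?G z \<noteq> 0" using s z by simp
    have "emb2 (f v) = psi2 \<delta> c 0 (fst z * snd z * ?e z / (snd z * ?G z), snd z * ?G z)"
      using fmap_psi2_last(3)[OF e v(1) H nz] by simp
    moreover have "fst z * snd z * ?e z / (snd z * ?G z) = ?e z * fst z / ?G z"
      using s by simp
    ultimately show ?thesis by (simp only: bp_base_def snd_conv)
  qed
  have "local_form (X3 n m \<delta> c) emb3 fdom f ?P ?R ?M ?\<Phi>"
    unfolding local_form_def
  proof (intro conjI ballI impI P R h)
    show "snd ?R (?\<Phi> z) = emb3 (f v)" if "z \<in> ?M" "v \<in> fdom" "snd ?P z = emb3 v" for z v
      using eq[of z v] that by blast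
  qed auto
  moreover have "Qp 0 0 \<notin> Z3 n m \<delta> c"
    using ev_nonzero last_nz by (auto simp: Qp_in_Z3_iff)
  then have "(0, 0) \<in> fst ?R" "snd ?R (0, 0) = Base (Qp 0 0)"
    by (simp_all add: bp_base_def psi2_def Qp_def)
  moreover have "(0, 0) \<in> fst ?P" "snd ?P (0, 0) = Exc (Q last_index) Vertical"
    using B3.Exc_vert[OF Q_in_Z3[OF last_index(3)], of 0] by simp_all
  moreover have "nondeg ?\<Phi> (0, 0)"
  proof -
    have "sdiff ?G (0, 0)" by (intro sdiff_intros) (simp_all add: d0)
    then obtain a b where G: "sder ?G (0, 0) a b" unfolding sdiff_def by auto
    have e: "sder ?e (0, 0) 0 1"
      by (rule sder_eq[OF sder_add[OF sder_const sder_snd]]) simp_all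
    have ef: "sder (\<lambda>z. ?e z * fst z) (0, 0) (1 / \<delta>) 0"
      by (rule sder_eq[OF sder_mult[OF e sder_fst]]) simp_all
    have "sder (\<lambda>z. ?e z * fst z / ?G z) (0, 0) (1 / \<delta> / (- \<delta>)) 0"
      by (rule sder_eq[OF sder_divide[OF ef G]]) (use d0 in \<open>simp_all add: power2_eq_square\<close>)
    then have 1: "sder (\<lambda>z. fst (?\<Phi> z)) (0, 0) (1 / \<delta> / (- \<delta>)) 0" by simp
    have "sder (\<lambda>z. snd z * ?G z) (0, 0) 0 (- \<delta>)"
      by (rule sder_eq[OF sder_mult[OF sder_snd G]]) simp_all
    then have 2: "sder (\<lambda>z. snd (?\<Phi> z)) (0, 0) 0 (- \<delta>)" by simp
    show ?thesis by (rule nondegI[OF 1 2]) (use d0 in simp)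
  qed
  ultimately show ?thesis unfolding biholo_at_def
    by (intro exI[of _ ?P] exI[of _ ?R] exI[of _ ?M] exI[of _ ?\<Phi>] exI[of _ "(0, 0)"] conjI)
      (use d0 in simp_all)
qed


section \<open>The automorphism\<close>

text \<open>
  The graph of the automorphism, point by point.  The rule \<open>plane\<close> covers everything in the plane
  off \<^const>\<open>Sigma2\<close>, including the line at infinity.  Where a curve is contracted or a point is blown
  up by the map, on \<^const>\<open>Sigma2\<close> and over the last center, the rules \<open>line\<close>, \<open>F2_zero\<close>,
  \<open>last_slope\<close> and \<open>last_vertical\<close> pass between different kinds of points.
\<close>

inductive rel :: "p2 bpt bpt bpt \<Rightarrow> p2 bpt bpt bpt \<Rightarrow> bool" where
  plane: "snd aff2 z \<notin> Z1 n \<delta> c \<Longrightarrow>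
    rel (Base (Base (Base (snd aff2 z)))) (Base (Base (Base (snd aff1 (fst z, c - \<delta> * snd z + (fst z)\<^sup>2)))))"
| line: "rel (emb3 (x, 0)) (Exc (Q 0) (Slope (- \<delta> * x)))"
| F1_slope: "s < n \<Longrightarrow> l \<noteq> 0 \<Longrightarrow>
    rel (Base (Base (Exc (pnt \<delta> c s) (Slope l)))) (Base (Base (Exc (pnt \<delta> c (nxt s)) (Slope (scale1 s * l)))))"
| F1_vertical: "s < n \<Longrightarrow>
    rel (Base (Base (Exc (pnt \<delta> c s) Vertical))) (Base (Base (Exc (pnt \<delta> c (nxt s)) Vertical)))"
| F2_slope: "s < n \<Longrightarrow> Qp s e \<notin> Z3 n m \<delta> c \<Longrightarrow> (s = n - 1 \<longrightarrow> e \<noteq> 0) \<Longrightarrow>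
    rel (Base (Qp s e)) (Base (Qp (nxt s) (step s e)))"
| F2_zero: "rel (Base (Qp (n - 1) 0)) (Exc (Q 0) Vertical)"
| F2_vertical: "s < n \<Longrightarrow> rel (Base (Exc (pE \<delta> c s) Vertical)) (Base (Exc (pE \<delta> c (nxt s)) Vertical))"
| F3_slope: "i < last_index \<Longrightarrow>
    rel (Exc (Q i) (Slope l)) (Exc (Q (Suc i)) (Slope (scale3 (i mod n) (ev i) * l)))"
| F3_vertical: "i < last_index \<Longrightarrow> rel (Exc (Q i) Vertical) (Exc (Q (Suc i)) Vertical)"
| last_slope: "rel (Exc (Q last_index) (Slope l)) (emb3 (0, - (\<delta>\<^sup>2 * l)))"
| last_vertical: "rel (Exc (Q last_index) Vertical) (Base (Qp 0 0))"

text \<open>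
  On the line at infinity the map is \<open>w \<mapsto> c - \<delta> / w\<close>, which permutes the centers; the one in
  \<^const>\<open>Sigma2\<close> and the one in \<^const>\<open>Sigma1\<close> are outside of the respective charts.
\<close>

lemma plane_Z1_iff:
  "snd aff1 (fst z, c - \<delta> * snd z + (fst z)\<^sup>2) \<in> Z1 n \<delta> c \<longleftrightarrow> snd aff2 z \<in> Z1 n \<delta> c"
proof (cases "fst z = 0")
  case False
  then show ?thesis
    using aff_at_notin_Z1[of z 0] aff_at_notin_Z1[of "(fst z, c - \<delta> * snd z + (fst z)\<^sup>2)" 1]
    by (simp add: aff_at_simps)
next
  case True
  then obtain x where z: "z = (0, x)" by (cases z) auto
  have 1: "hom 0 x 1 = pnt \<delta> c s \<Longrightarrow> s < n - 1 \<and> hom 0 1 (c - \<delta> * x) = pnt \<delta> c (Suc s)"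
    if s: "s < n" for s
  proof (cases "s = 0")
    case True
    assume "hom 0 x 1 = pnt \<delta> c s"
    then show ?thesis using True n3 by (simp add: pnt_def hom_eq_simps omega_def)
  next
    case False
    assume "hom 0 x 1 = pnt \<delta> c s"
    then have x: "x \<noteq> 0" "omega \<delta> c s = 1 / x" using False by (simp_all add: pnt_def hom_eq_simps)
    then have "s \<noteq> n - 1" using omega_last by auto
    then show ?thesis using False s x by (simp add: pnt_def omega_Suc)
  qed
  have 2: "hom 0 x 1 = pnt \<delta> c s" if s: "Suc s < n" "hom 0 1 (c - \<delta> * x) = pnt \<delta> c (Suc s)" for s
  proof (cases "s = 0")
    case True
    then show ?thesis using s d0 by (simp add: pnt_def hom_eq_simps omega_def)
  next
    case False
    then have nz: "omega \<delta> c s \<noteq> 0" using s omega_nz[of s] by simp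
    have "c - \<delta> / omega \<delta> c s = c - \<delta> * x"
      using s(2) False by (simp add: pnt_def hom_eq_simps omega_Suc)
    then have "x = 1 / omega \<delta> c s" using d0 nz by (simp add: field_simps)
    then show ?thesis using False nz by (simp add: pnt_def hom_eq_simps)
  qed
  have "(\<exists>s<n. hom 0 1 (c - \<delta> * x) = pnt \<delta> c s) \<longleftrightarrow> (\<exists>s<n. hom 0 x 1 = pnt \<delta> c s)"
  proof
    assume "\<exists>s<n. hom 0 1 (c - \<delta> * x) = pnt \<delta> c s"
    then obtain s where s: "s < n" "hom 0 1 (c - \<delta> * x) = pnt \<delta> c s" by blast
    then have "s \<noteq> 0" by (cases "s = 0") (simp_all add: pnt_def hom_eq_simps)
    then obtain r where "s = Suc r" by (cases s) auto
    then show "\<exists>s<n. hom 0 x 1 = pnt \<delta> c s" using 2[of r] s by (intro exI[of _ r]) simp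
  next
    assume "\<exists>s<n. hom 0 x 1 = pnt \<delta> c s"
    then obtain s where "s < n" "hom 0 x 1 = pnt \<delta> c s" by blast
    then have "s < n - 1" "hom 0 1 (c - \<delta> * x) = pnt \<delta> c (Suc s)" using 1[of s] by blast+
    then show "\<exists>s<n. hom 0 1 (c - \<delta> * x) = pnt \<delta> c s" by (intro exI[of _ "Suc s"]) simp
  qed
  then show ?thesis by (auto simp: z aff1_def aff2_def Z1_def)
qed

lemma biholo_rel: "rel p q \<Longrightarrow> biholo_at (X3 n m \<delta> c) emb3 fdom f p q"
proof (induction rule: rel.induct)
  case (plane z)
  have 1: "snd aff1 (fst z, c - \<delta> * snd z + (fst z)\<^sup>2) \<notin> Z1 n \<delta> c" using plane plane_Z1_iff by simp
  have "biholo_at (X1 n \<delta> c) emb1 fdom f (Base (snd aff2 z)) (Base (snd aff1 (fst z, c - \<delta> * snd z + (fst z)\<^sup>2)))"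
    unfolding X1_def by (rule B1.biholo_at_Base[OF biholo_P2 plane 1])
  from B2.biholo_at_Base[OF this Base_notin_Z2 Base_notin_Z2, folded X2_def]
  show ?case unfolding X3_def by (rule B3.biholo_at_Base[OF _ Base_notin_Z3 Base_notin_Z3])
next
  case (line x)
  show ?case by (rule biholo_line)
next
  case (F1_slope s l)
  show ?case unfolding X3_def
    by (rule B3.biholo_at_Base[OF biholo_X2_F1_slope[OF F1_slope] Base_notin_Z3 Base_notin_Z3])
next
  case (F1_vertical s)
  show ?case unfolding X3_def
    by (rule B3.biholo_at_Base[OF biholo_X2_F1_vertical[OF F1_vertical] Base_notin_Z3 Base_notin_Z3])
next
  case (F2_slope s e)
  have "s = n - 1 \<longrightarrow> e \<noteq> 0 \<and> 1 - \<delta> * e \<noteq> 0"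
  proof (intro impI conjI)
    assume s: "s = n - 1"
    show "e \<noteq> 0" using F2_slope(3) s by simp
    have "e \<noteq> 1 / \<delta>" using F2_slope(2) Q_in_Z3[OF last_index(3)] s by (auto simp: Q_def last_index)
    then show "1 - \<delta> * e \<noteq> 0" using d0 by (auto simp: field_simps)
  qed
  note bi = biholo_X2_F2_slope[OF F2_slope(1) this]
  have "Qp (nxt s) (step s e) \<notin> Z3 n m \<delta> c" using F2_slope step_in_Z3_iff by blast
  then show ?case unfolding X3_def by (rule B3.biholo_at_Base[OF bi F2_slope(2)])
next
  case F2_zero
  show ?case by (rule biholo_F2_zero)
next
  case (F2_vertical s)
  show ?case unfolding X3_def
    by (rule B3.biholo_at_Base[OF biholo_X2_F2_vertical[OF F2_vertical] Vertical_notin_Z3 Vertical_notin_Z3])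
next
  case (F3_slope i l)
  have i: "i < n * m" "Suc i < n * m" using F3_slope last_index(1) by simp_all
  obtain N A B C where t: "tri_form (X2 n \<delta> c) emb2 fdom f (Q i) (Q (Suc i)) N A B C"
    and sc: "\<forall>l. scale3 (i mod n) (ev i) * l = (B (0, ev i) + l * C (0, ev i)) / A (0, ev i)"
    using tri_Qp_any[OF index_less[of i], of "ev i"] ev_regular[OF F3_slope] unfolding Q_Suc
    by (auto simp: Q_def)
  show ?case unfolding X3_def
    by (rule B3.biholo_at_slope[OF t Q_in_Z3[OF i(1)] Q_in_Z3[OF i(2)]]) (simp only: center_Q sc)
next
  case (F3_vertical i)
  have i: "i < n * m" "Suc i < n * m" using F3_vertical last_index(1) by simp_all
  obtain N A B C where t: "tri_form (X2 n \<delta> c) emb2 fdom f (Q i) (Q (Suc i)) N A B C"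
    using tri_Qp_any[OF index_less[of i], of "ev i"] ev_regular[OF F3_vertical] unfolding Q_Suc
    by (auto simp: Q_def)
  show ?case unfolding X3_def
    by (rule B3.biholo_at_vertical[OF t Q_in_Z3[OF i(1)] Q_in_Z3[OF i(2)]])
next
  case (last_slope l)
  show ?case by (rule biholo_last_slope)
next
  case last_vertical
  show ?case by (rule biholo_last_vertical)
qed

lemma pts_X3_cases:
  assumes "p \<in> pts (X3 n m \<delta> c)"
  obtains (plane) P where "p = Base (Base (Base P))" "P \<in> pts P2" "P \<notin> Z1 n \<delta> c"
    | (F1_slope) s l where "p = Base (Base (Exc (pnt \<delta> c s) (Slope l)))" "s < n" "l \<noteq> 0"
    | (F1_vertical) s where "p = Base (Base (Exc (pnt \<delta> c s) Vertical))" "s < n"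
    | (F2_slope) s e where "p = Base (Qp s e)" "s < n" "Qp s e \<notin> Z3 n m \<delta> c"
    | (F2_vertical) s where "p = Base (Exc (pE \<delta> c s) Vertical)" "s < n"
    | (F3_slope) i l where "p = Exc (Q i) (Slope l)" "i < n * m"
    | (F3_vertical) i where "p = Exc (Q i) Vertical" "i < n * m"
proof (cases p)
  case (Base x)
  then have x: "x \<in> pts (X2 n \<delta> c)" "x \<notin> Z3 n m \<delta> c" using assms by (simp_all add: X3_def)
  show thesis
  proof (cases x)
    case B2: (Base y)
    then have y: "y \<in> pts (X1 n \<delta> c)" "y \<notin> Z2 n \<delta> c" using x by (simp_all add: X2_def)
    show thesis
    proof (cases y)
      case B1: (Base P)
      then show thesis using that(1)[of P] y Base B2 by (simp add: X1_def)
    next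
      case (Exc r d)
      then obtain s where s: "r = pnt \<delta> c s" "s < n" using y by (auto simp: X1_def Z1_def)
      show thesis
      proof (cases d)
        case (Slope l)
        then have "l \<noteq> 0" using y(2) Exc s by (auto simp: Exc_in_Z2_iff)
        then show thesis using that(2)[of s l] s Base B2 Exc Slope by simp
      next
        case Vertical
        then show thesis using that(3)[of s] s Base B2 Exc by simp
      qed
    qed
  next
    case (Exc r d)
    then obtain s where s: "r = pE \<delta> c s" "s < n" using x by (auto simp: X2_def Z2_eq)
    show thesis
    proof (cases d)
      case (Slope e)
      then show thesis using that(4)[of s e] s Base Exc x(2) by (simp add: Qp_def)
    next
      case Vertical
      then show thesis using that(5)[of s] s Base Exc by simp
    qed
  qed
next
  case (Exc r d)
  then obtain i where i: "r = Q i" "i < n * m" using assms by (auto simp: X3_def Z3_eq)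
  show thesis using that(6)[of i] that(7)[of i] i Exc by (cases d) simp_all
qed

lemma rel_total: "p \<in> pts (X3 n m \<delta> c) \<Longrightarrow> \<exists>q. rel p q"
proof (erule pts_X3_cases)
  fix P assume p: "p = Base (Base (Base P))" "P \<in> pts P2" "P \<notin> Z1 n \<delta> c"
  show ?thesis
  proof (cases "\<exists>z. P = snd aff2 z")
    case True
    then show ?thesis using rel.plane p by blast
  next
    case False
    then have no: "P \<noteq> hom t x 1" for t x by (auto simp: aff2_def)
    from p(2) show ?thesis
    proof (cases rule: P2_cases)
      case (1 x y)
      then have "y = 0" using no[of "1 / y" "x / y"] by (auto simp: hom_eq_simps)
      then have "p = emb3 (x, 0)" using p(1) 1 by (simp add: emb_eq)
      then show ?thesis using rel.line by blast
    next
      case (2 y)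
      then have "y = 0" using no[of 0 "1 / y"] by (auto simp: hom_eq_simps)
      then have "P = pnt \<delta> c (n - 1)" using 2 last_nz omega_last by (simp add: pnt_def)
      then show ?thesis using p(3) pnt_in_Z1[OF last_nz(2)] by simp
    next
      case 3
      then show ?thesis using no[of 0 0] by simp
    qed
  qed
next
  fix s e assume p: "p = Base (Qp s e)" "s < n" "Qp s e \<notin> Z3 n m \<delta> c"
  show ?thesis
  proof (cases "s = n - 1 \<and> e = 0")
    case True
    then show ?thesis using rel.F2_zero p(1) by blast
  next
    case False
    then show ?thesis using rel.F2_slope[OF p(2,3)] p(1) by blast
  qed
next
  fix i l assume p: "p = Exc (Q i) (Slope l)" "i < n * m"
  show ?thesis
  proof (cases "i = last_index")
    case True
    then show ?thesis using rel.last_slope p(1) by blast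
  next
    case False
    then have "i < last_index" using p(2) last_index(1) by simp
    then show ?thesis using rel.F3_slope p(1) by blast
  qed
next
  fix i assume p: "p = Exc (Q i) Vertical" "i < n * m"
  show ?thesis
  proof (cases "i = last_index")
    case True
    then show ?thesis using rel.last_vertical p(1) by blast
  next
    case False
    then have "i < last_index" using p(2) last_index(1) by simp
    then show ?thesis using rel.F3_vertical p(1) by blast
  qed
qed (use rel.F1_slope rel.F1_vertical rel.F2_vertical in blast)+

text \<open>
  Every rule can be solved for its source.  On the second fiber over [0:0:1] the value \<open>\<eta>\<close> = 0 comes from the
  point of indeterminacy, which is a center, and hence is the image of a vertical direction.
\<close>

lemma rel_onto: "q \<in> pts (X3 n m \<delta> c) \<Longrightarrow> \<exists>p. rel p q"
proof (erule pts_X3_cases)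
  fix P assume q: "q = Base (Base (Base P))" "P \<in> pts P2" "P \<notin> Z1 n \<delta> c"
  have aff1: "\<exists>p. rel p q" if P: "P = snd aff1 (t, w)" for t w
  proof -
    let ?z = "(t, (c + t\<^sup>2 - w) / \<delta>)"
    have e: "snd aff1 (fst ?z, c - \<delta> * snd ?z + (fst ?z)\<^sup>2) = P" using d0 P by simp
    have "snd aff2 ?z \<notin> Z1 n \<delta> c" using plane_Z1_iff[of ?z] q(3) unfolding e by simp
    from rel.plane[OF this] show ?thesis unfolding e q(1) by (rule exI)
  qed
  from q(2) show ?thesis
  proof (cases rule: P2_cases)
    case (1 x y)
    show ?thesis
    proof (cases "x = 0")
      case True
      have "rel (Exc (Q last_index) (Slope (- y / \<delta>\<^sup>2))) (emb3 (0, - (\<delta>\<^sup>2 * (- y / \<delta>\<^sup>2))))"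
        by (rule rel.last_slope)
      moreover have "emb3 (0, - (\<delta>\<^sup>2 * (- y / \<delta>\<^sup>2))) = q" using q(1) 1 True d0 by (simp add: emb_eq)
      ultimately show ?thesis by auto
    next
      case False
      then have "P = snd aff1 (1 / x, y / x)" using 1 by (simp add: aff1_def hom_eq_simps)
      then show ?thesis by (rule aff1)
    qed
  next
    case (2 y)
    then have "P = snd aff1 (0, y)" by (simp add: aff1_def)
    then show ?thesis by (rule aff1)
  next
    case 3
    then have "P = pnt \<delta> c 0" by (simp add: pnt_def)
    then show ?thesis using q(3) pnt_in_Z1[OF last_nz(3)] by simp
  qed
next
  fix s l assume q: "q = Base (Base (Exc (pnt \<delta> c s) (Slope l)))" "s < n" "l \<noteq> 0"
  obtain r where r: "r < n" "s = nxt r" using nxt_onto[OF q(2)] by blast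
  have "l / scale1 r \<noteq> 0" "scale1 r * (l / scale1 r) = l" using scale1_nz[OF r(1)] q(3) by simp_all
  then show ?thesis using rel.F1_slope[OF r(1), of "l / scale1 r"] q(1) r(2) by auto
next
  fix s assume q: "q = Base (Base (Exc (pnt \<delta> c s) Vertical))" "s < n"
  obtain r where r: "r < n" "s = nxt r" using nxt_onto[OF q(2)] by blast
  then show ?thesis using rel.F1_vertical[OF r(1)] q(1) by auto
next
  fix s e assume q: "q = Base (Qp s e)" "s < n" "Qp s e \<notin> Z3 n m \<delta> c"
  obtain r where r: "r < n" "s = nxt r" using nxt_onto[OF q(2)] by blast
  obtain d where d: "e = step r d" using step_onto by blast
  have not: "\<not> (r = n - 1 \<and> d = 0)" "Qp r d \<in> Z3 n m \<delta> c \<longrightarrow> r = n - 1 \<and> d = 1 / \<delta>"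
    using q(3) step_in_Z3_iff[OF r(1), of d] unfolding r(2) d by blast+
  show ?thesis
  proof (cases "r = n - 1 \<and> d = 1 / \<delta>")
    case True
    then have "Qp s e = Qp 0 0" using r d d0 last_nz by (simp add: nxt_def step_def)
    then show ?thesis using rel.last_vertical q(1) by auto
  next
    case False
    then have "Qp r d \<notin> Z3 n m \<delta> c" using not(2) by blast
    then show ?thesis using rel.F2_slope[OF r(1), of d] not(1) q(1) r(2) d by auto
  qed
next
  fix s assume q: "q = Base (Exc (pE \<delta> c s) Vertical)" "s < n"
  obtain r where r: "r < n" "s = nxt r" using nxt_onto[OF q(2)] by blast
  then show ?thesis using rel.F2_vertical[OF r(1)] q(1) by auto
next
  fix j l assume q: "q = Exc (Q j) (Slope l)" "j < n * m"
  show ?thesis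
  proof (cases j)
    case 0
    have "rel (emb3 (- l / \<delta>, 0)) q" using rel.line[of "- l / \<delta>"] q(1) 0 d0 by simp
    then show ?thesis by blast
  next
    case (Suc i)
    then have i: "i < last_index" using q(2) last_index(1) by simp
    let ?k = "scale3 (i mod n) (ev i)"
    have "?k \<noteq> 0" using scale3_nz[OF index_less] ev_regular[OF i] by blast
    then have "rel (Exc (Q i) (Slope (l / ?k))) q" using rel.F3_slope[OF i, of "l / ?k"] q(1) Suc by simp
    then show ?thesis by blast
  qed
next
  fix j assume q: "q = Exc (Q j) Vertical" "j < n * m"
  show ?thesis
  proof (cases j)
    case 0
    then show ?thesis using rel.F2_zero q(1) by blast
  next
    case (Suc i)
    then have "i < last_index" using q(2) last_index(1) by simp
    then show ?thesis using rel.F3_vertical q(1) Suc by blast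
  qed
qed


lemma Qp_neq: "Qp s e \<noteq> Exc x Vertical" "Exc x Vertical \<noteq> Qp s e" "Qp s e \<noteq> Base y" "Base y \<noteq> Qp s e"
  by (simp_all add: Qp_def)

lemma Q_Suc_inj: "i < last_index \<Longrightarrow> j < last_index \<Longrightarrow> Q (Suc i) = Q (Suc j) \<longleftrightarrow> i = j"
  using Q_inj[of "Suc i" "Suc j"] last_index(1) by simp

lemma Q_Suc_neq_0: "i < last_index \<Longrightarrow> Q (Suc i) \<noteq> Q 0" "i < last_index \<Longrightarrow> Q 0 \<noteq> Q (Suc i)"
  using Q_inj[of "Suc i" 0] Q_0_neq last_index(1) by auto

lemma step_neq_zero:
  assumes "s < n" "Qp s e \<notin> Z3 n m \<delta> c"
  shows "Qp (nxt s) (step s e) \<noteq> Qp 0 0"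
proof
  assume "Qp (nxt s) (step s e) = Qp 0 0"
  then have "nxt s = 0" "step s e = 0"
    using assms(1) nxt_less last_nz by (simp_all add: Qp_eq_iff)
  then have s: "s = n - 1" "1 - \<delta> * e = 0" using nxt_0_iff[OF assms(1)] by (simp_all add: step_def)
  then have "e = 1 / \<delta>" using d0 by (simp add: field_simps)
  then have "Qp s e = Q last_index" using s by (simp add: Q_def last_index)
  then show False using assms(2) Q_in_Z3[OF last_index(3)] by simp
qed

text \<open>
  Different rules have different images, and each is injective; the only overlap that the form of the points
  leaves open, a value 0 of \<^const>\<open>step\<close> on the last fiber, is excluded by \<open>step_neq_zero\<close>.
\<close>

lemma rel_inj:
  assumes "rel p q" "rel p' q"
  shows "p = p'"
  using assms(1)
proof (cases rule: rel.cases)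
  case (plane z)
  note r = assms(2)[unfolded plane(2)]
  from r show ?thesis
    by (cases rule: rel.cases) (use plane d0 in \<open>auto simp: aff1_def emb_eq hom_eq_simps prod_eq_iff Qp_neq\<close>)
next
  case (line x)
  note r = assms(2)[unfolded line(2)]
  from r show ?thesis
    by (cases rule: rel.cases) (use line d0 in \<open>auto simp: Q_Suc_neq_0\<close>)
next
  case (F1_slope s l)
  note r = assms(2)[unfolded F1_slope(2)]
  from r show ?thesis
    by (cases rule: rel.cases)
      (use F1_slope scale1_nz[of s] in \<open>auto simp: pnt_inj nxt_less nxt_inj Qp_neq\<close>)
next
  case (F1_vertical s)
  note r = assms(2)[unfolded F1_vertical(2)]
  from r show ?thesis
    by (cases rule: rel.cases) (use F1_vertical in \<open>auto simp: pnt_inj nxt_less nxt_inj Qp_neq\<close>)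
next
  case (F2_slope s e)
  note r = assms(2)[unfolded F2_slope(2)]
  from r show ?thesis
    by (cases rule: rel.cases)
      (use F2_slope step_neq_zero[OF F2_slope(3,4)] last_nz in \<open>auto simp: Qp_eq_iff nxt_less nxt_inj step_inj Qp_neq\<close>)
next
  case F2_zero
  note r = assms(2)[unfolded F2_zero(2)]
  from r show ?thesis
    by (cases rule: rel.cases) (use F2_zero in \<open>auto simp: Q_Suc_neq_0\<close>)
next
  case (F2_vertical s)
  note r = assms(2)[unfolded F2_vertical(2)]
  from r show ?thesis
    by (cases rule: rel.cases)
      (use F2_vertical in \<open>auto simp: pE_inj nxt_less nxt_inj Qp_neq\<close>)
next
  case (F3_slope i l)
  note r = assms(2)[unfolded F3_slope(2)]
  from r show ?thesis
    by (cases rule: rel.cases)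
      (use F3_slope scale3_nz[OF index_less, of i "ev i"] ev_regular[of i] in
        \<open>auto simp: Q_Suc_neq_0 Q_Suc_inj\<close>)
next
  case (F3_vertical i)
  note r = assms(2)[unfolded F3_vertical(2)]
  from r show ?thesis
    by (cases rule: rel.cases) (use F3_vertical in \<open>auto simp: Q_Suc_neq_0 Q_Suc_inj\<close>)
next
  case (last_slope l)
  note r = assms(2)[unfolded last_slope(2)]
  from r show ?thesis
    by (cases rule: rel.cases) (use last_slope d0 in \<open>auto simp: aff1_def emb_eq hom_eq_simps Qp_neq\<close>)
next
  case last_vertical
  note r = assms(2)[unfolded last_vertical(2)]
  from r show ?thesis
    by (cases rule: rel.cases)
      (use last_vertical in \<open>auto simp: Qp_neq step_neq_zero step_neq_zero[symmetric]\<close>)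
qed

abbreviation "cl \<equiv> (closure_of) (surf_top (X3 n m \<delta> c))"

lemmas criterion = complex_surface.automorphism_criterion[OF complex_surface_X3 dense_in_X3
    biholo_rel rel_total rel_onto rel_inj, folded fX3_def]

lemma automorphism_X3: "is_automorphism (X3 n m \<delta> c) (fX3 n m \<delta> c)"
  by (rule criterion(1))

lemma fX3_iff: "(p, q) \<in> fX3 n m \<delta> c \<longleftrightarrow> rel p q"
  by (rule criterion(2))

lemma fX3_closure:
  "C \<subseteq> pts (X3 n m \<delta> c) \<Longrightarrow> fX3 n m \<delta> c `` cl C = cl {q. \<exists>p\<in>C. rel p q}"
  by (rule criterion(3))

lemma rel_unique:
  assumes "rel p q" "rel p q'" shows "q = q'"
proof -
  have "(p, q) \<in> fX3 n m \<delta> c" "(p, q') \<in> fX3 n m \<delta> c" using assms by (simp_all add: fX3_iff)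
  then show ?thesis
    unfolding fX3_def by (rule complex_surface.induced_map_unique[OF complex_surface_X3 dense_in_X3])
qed

lemma rel_pts:
  assumes "rel p q" shows "p \<in> pts (X3 n m \<delta> c)"
proof -
  have "(p, q) \<in> fX3 n m \<delta> c" using assms by (simp add: fX3_iff)
  then show ?thesis
    unfolding fX3_def by (rule complex_surface.induced_map_pts[OF complex_surface_X3, THEN conjunct1])
qed

lemma fX3_image:
  assumes "\<And>t. t \<in> T \<Longrightarrow> rel (a t) (b t)"
  shows "fX3 n m \<delta> c `` (a ` T) = b ` T"
proof (intro set_eqI iffI)
  fix q assume "q \<in> fX3 n m \<delta> c `` (a ` T)"
  then obtain t where t: "t \<in> T" "rel (a t) q" by (auto simp: fX3_iff)
  then have "q = b t" using rel_unique[OF assms[OF t(1)]] by simp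
  then show "q \<in> b ` T" using t(1) by blast
next
  fix q assume "q \<in> b ` T"
  then obtain t where t: "t \<in> T" "q = b t" by blast
  then have "(a t, q) \<in> fX3 n m \<delta> c" using assms by (simp add: fX3_iff)
  then show "q \<in> fX3 n m \<delta> c `` (a ` T)" using t(1) by blast
qed

lemma fX3_closure_image:
  assumes "\<And>t. t \<in> T \<Longrightarrow> rel (a t) (b t)"
  shows "fX3 n m \<delta> c `` cl (a ` T) = cl (b ` T)"
proof -
  have "a ` T \<subseteq> pts (X3 n m \<delta> c)" by (rule image_subsetI) (rule rel_pts[OF assms])
  moreover have "{q. \<exists>p\<in>a ` T. rel p q} = fX3 n m \<delta> c `` (a ` T)" by (auto simp: fX3_iff)
  ultimately show ?thesis by (simp only: fX3_closure fX3_image[OF assms])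
qed

section \<open>Strict transforms as closures\<close>

lemma strict_X3:
  assumes "C \<subseteq> pts (X2 n \<delta> c)"
  shows "strict_transform (X2 n \<delta> c) (Z3 n m \<delta> c) (surf_top (X2 n \<delta> c) closure_of C) =
    cl (Base ` (C - Z3 n m \<delta> c))"
  unfolding B3.strict_transform_closure
  using assms by (simp add: strict_transform_def X3_def Int_absorb2)

lemma lift3_eq:
  assumes "C \<subseteq> pts P2"
  shows "lift3 n m \<delta> c C = cl ((\<lambda>p. Base (Base (Base p))) ` (C - Z1 n \<delta> c))"
proof -
  let ?D = "(\<lambda>p. Base (Base p)) ` (C - Z1 n \<delta> c)"
  have "?D \<subseteq> pts (X2 n \<delta> c)" using assms by (auto simp: X2_def X1_def Base_notin_Z2)
  moreover have "?D - Z3 n m \<delta> c = ?D" using Base_notin_Z3 by auto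
  ultimately show ?thesis
    unfolding lift3_def lift2_eq[OF assms] using strict_X3[of ?D] by (simp add: image_image)
qed

lemma F1_X3_eq:
  assumes s: "s < n"
  shows "F1_X3 n m \<delta> c s = cl ((\<lambda>d. Base (Base (Exc (pnt \<delta> c s) d))) ` (- {Slope 0}))"
proof -
  let ?D = "Base ` (F1 \<delta> c s - Z2 n \<delta> c)"
  have F1: "F1 \<delta> c s - Z2 n \<delta> c = Exc (pnt \<delta> c s) ` (- {Slope 0})"
    using s by (auto simp: F1_def exc_fiber_def Exc_in_Z2_iff)
  have "?D \<subseteq> pts (X2 n \<delta> c)"
    using s by (auto simp: F1 X2_def X1_def Exc_in_Z2_iff pnt_in_Z1)
  from strict_X3[OF this]
  have "F1_X3 n m \<delta> c s = cl (Base ` (?D - Z3 n m \<delta> c))"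
    by (simp only: F1_X3_def strict_transform_def[of "X1 n \<delta> c"] X2_def)
  also have "?D - Z3 n m \<delta> c = ?D" using Base_notin_Z3 by auto
  finally show ?thesis by (simp only: F1 image_image)
qed

lemma F2_X3_eq:
  assumes s: "s < n"
  shows "F2_X3 n m \<delta> c s = cl ((\<lambda>d. Base (Exc (pE \<delta> c s) d)) ` {d. Exc (pE \<delta> c s) d \<notin> Z3 n m \<delta> c})"
proof -
  have "exc_fiber {pE \<delta> c s} - Z3 n m \<delta> c = Exc (pE \<delta> c s) ` {d. Exc (pE \<delta> c s) d \<notin> Z3 n m \<delta> c}"
    by (auto simp: exc_fiber_def)
  then show ?thesis
    by (simp add: F2_X3_def F2_def F1_L_eq[OF s] strict_transform_def X3_def image_image)
qed

text \<open>
  Single points of a curve can be ignored when its closure is taken.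
\<close>

lemma closure_insert_limit: "x \<in> T closure_of D \<Longrightarrow> T closure_of (insert x D) = T closure_of D"
proof -
  assume x: "x \<in> T closure_of D"
  have "insert x D \<inter> topspace T \<subseteq> T closure_of D"
    using x closure_of_subset_Int[of T D] by auto
  then have "T closure_of (insert x D) \<subseteq> T closure_of D"
    by (metis closedin_closure_of closure_of_minimal closure_of_restrict inf_commute)
  moreover have "T closure_of D \<subseteq> T closure_of (insert x D)" by (rule closure_of_mono) blast
  ultimately show ?thesis by blast
qed

text \<open>
  The vertical direction is the limit of the slopes 1/h for h tending to 0, and the fiber is closed.
\<close>

lemma closure_slopes:
  assumes i: "i < n * m"
  shows "cl (range (\<lambda>l. Exc (Q i) (Slope l))) = exc_fiber {Q i}"
proof
  interpret X3: complex_surface "X3 n m \<delta> c" by (rule complex_surface_X3)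
  let ?C = "range (\<lambda>l. Exc (Q i) (Slope l))"
  have Qi: "Q i \<in> Z3 n m \<delta> c" using i by (rule Q_in_Z3)
  show "cl ?C \<subseteq> exc_fiber {Q i}"
    unfolding X3_def by (rule closure_of_minimal[OF _ B3.blowup_closed_point[OF Qi]])
      (auto simp: exc_fiber_def)
  have "?C \<subseteq> topspace (surf_top (X3 n m \<delta> c))"
    using Qi by (auto simp: X3.topspace_surf) (simp add: X3_def)
  then have 1: "?C \<subseteq> cl ?C" by (rule closure_of_subset)
  let ?P = "bp_vert (X2 n \<delta> c) (Z3 n m \<delta> c) (Q i)"
  have P: "?P \<in> params (X3 n m \<delta> c)" unfolding X3_def by (rule B3.bp_vert_params[OF Qi])
  have v: "(l, 0) \<in> fst ?P" "snd ?P (l, 0) = Exc (Q i) (if l = 0 then Vertical else Slope (1 / l))" for l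
    using B3.Exc_vert[OF Qi, of l] by simp_all
  have "snd ?P (0, 0) \<in> cl ?C"
  proof (rule X3.closure_of_chartI[OF P _ v(1)])
    show "((\<lambda>h. (h, 0)) \<longlongrightarrow> (0, 0)) (at (0::complex))" by (intro tendsto_intros)
    show "\<forall>\<^sub>F h in at 0. snd ?P (h, 0) \<in> ?C"
      using v(2) by (simp add: eventually_at_filter)
  qed
  then have 2: "Exc (Q i) Vertical \<in> cl ?C" by (simp add: v)
  show "exc_fiber {Q i} \<subseteq> cl ?C"
  proof
    fix x assume "x \<in> exc_fiber {Q i}"
    then obtain d where "x = Exc (Q i) d" by (auto simp: exc_fiber_def)
    then show "x \<in> cl ?C" using 1 2 by (cases d) auto
  qed
qed

section \<open>Images of the curves\<close>

text \<open>
  The centers on the line at infinity form one cycle, so the map permutes the other points of the line.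
\<close>

lemma image_Sigma0: "fX3 n m \<delta> c `` lift3 n m \<delta> c Sigma0 = lift3 n m \<delta> c Sigma0"
proof -
  let ?T = "{t. snd aff2 (0, t) \<notin> Z1 n \<delta> c}"
  let ?a = "\<lambda>t. Base (Base (Base (snd aff2 (0, t))))"
  let ?b = "\<lambda>t. Base (Base (Base (snd aff1 (0, c - \<delta> * t))))"
  have "Sigma0 \<subseteq> pts P2" by (auto simp: Sigma0_def intro!: hom_in_P2)
  note l = lift3_eq[OF this]
  have a: "Sigma0 - Z1 n \<delta> c = (\<lambda>t. snd aff2 (0, t)) ` ?T"
  proof (intro set_eqI iffI)
    fix P assume "P \<in> Sigma0 - Z1 n \<delta> c"
    then obtain x y where P: "P = hom 0 x y" "(x, y) \<noteq> (0, 0)" "P \<notin> Z1 n \<delta> c" by (auto simp: Sigma0_def)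
    have "y \<noteq> 0"
    proof
      assume "y = 0"
      then have "P = hom 0 1 0" unfolding P(1) hom_eq_iff by (intro exI[of _ "1 / x"]) (use P in auto)
      also have "\<dots> = pnt \<delta> c (n - 1)" using last_nz omega_last by (simp add: pnt_def)
      finally show False using P(3) pnt_in_Z1[OF last_nz(2)] by simp
    qed
    then have "P = snd aff2 (0, x / y)"
      unfolding P(1) aff2_def by (simp add: hom_eq_iff) (intro exI[of _ "1 / y"], simp)
    then show "P \<in> (\<lambda>t. snd aff2 (0, t)) ` ?T" using P(3) by blast
  next
    fix P assume "P \<in> (\<lambda>t. snd aff2 (0, t)) ` ?T"
    then obtain t where t: "P = hom 0 t 1" "P \<notin> Z1 n \<delta> c" by (auto simp: aff2_def)
    then have "P \<in> Sigma0"
      unfolding Sigma0_def mem_Collect_eq by (intro exI[of _ t] exI[of _ 1]) simp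
    then show "P \<in> Sigma0 - Z1 n \<delta> c" using t(2) by simp
  qed
  have b: "Sigma0 - Z1 n \<delta> c = (\<lambda>t. snd aff1 (0, c - \<delta> * t)) ` ?T"
  proof (intro set_eqI iffI)
    fix P assume "P \<in> Sigma0 - Z1 n \<delta> c"
    then obtain x y where P: "P = hom 0 x y" "(x, y) \<noteq> (0, 0)" "P \<notin> Z1 n \<delta> c" by (auto simp: Sigma0_def)
    have "x \<noteq> 0"
    proof
      assume "x = 0"
      then have "P = hom 0 0 1" unfolding P(1) hom_eq_iff by (intro exI[of _ "1 / y"]) (use P in auto)
      also have "\<dots> = pnt \<delta> c 0" by (simp add: pnt_def)
      finally show False using P(3) pnt_in_Z1[OF last_nz(3)] by simp
    qed
    then have e: "P = snd aff1 (0, c - \<delta> * ((c - y / x) / \<delta>))"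
      unfolding P(1) aff1_def using d0 by (simp add: hom_eq_iff) (intro exI[of _ "1 / x"], simp)
    moreover from this have "(c - y / x) / \<delta> \<in> ?T"
      using P(3) plane_Z1_iff[of "(0, (c - y / x) / \<delta>)"] by simp
    ultimately show "P \<in> (\<lambda>t. snd aff1 (0, c - \<delta> * t)) ` ?T" by (rule image_eqI)
  next
    fix P assume "P \<in> (\<lambda>t. snd aff1 (0, c - \<delta> * t)) ` ?T"
    then obtain t where t: "P = snd aff1 (0, c - \<delta> * t)" "snd aff2 (0, t) \<notin> Z1 n \<delta> c" by blast
    then have "P \<notin> Z1 n \<delta> c" using plane_Z1_iff[of "(0, t)"] by simp
    moreover have "P \<in> Sigma0"
      unfolding t(1) Sigma0_def mem_Collect_eq
      by (intro exI[of _ 1] exI[of _ "c - \<delta> * t"]) (simp add: aff1_def)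
    ultimately show "P \<in> Sigma0 - Z1 n \<delta> c" by simp
  qed
  have "fX3 n m \<delta> c `` cl (?a ` ?T) = cl (?b ` ?T)"
  proof (rule fX3_closure_image)
    fix t assume "t \<in> ?T"
    then show "rel (?a t) (?b t)" using rel.plane[of "(0, t)"] by simp
  qed
  moreover have "lift3 n m \<delta> c Sigma0 = cl (?a ` ?T)" unfolding l a by (simp only: image_image)
  moreover have "lift3 n m \<delta> c Sigma0 = cl (?b ` ?T)" unfolding l b by (simp only: image_image)
  ultimately show ?thesis by simp
qed

lemma image_F1:
  assumes s: "s < n"
  shows "fX3 n m \<delta> c `` F1_X3 n m \<delta> c s = F1_X3 n m \<delta> c (nxt s)"
proof -
  let ?g = "\<lambda>d. case d of Slope l \<Rightarrow> Slope (scale1 s * l) | Vertical \<Rightarrow> Vertical"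
  have k: "scale1 s \<noteq> 0" by (rule scale1_nz[OF s])
  have g: "?g ` (- {Slope 0}) = - {Slope 0}"
  proof (intro set_eqI iffI)
    fix d assume "d \<in> ?g ` (- {Slope 0})"
    then show "d \<in> - {Slope 0}" using k by (auto split: dir.splits)
  next
    fix d assume d: "d \<in> - {Slope 0}"
    show "d \<in> ?g ` (- {Slope 0})"
    proof (cases d)
      case (Slope l)
      then show ?thesis using d k by (intro image_eqI[of _ _ "Slope (l / scale1 s)"]) simp_all
    next
      case Vertical
      then show ?thesis by (intro image_eqI[of _ _ Vertical]) simp_all
    qed
  qed
  have e: "F1_X3 n m \<delta> c (nxt s) = cl ((\<lambda>d. Base (Base (Exc (pnt \<delta> c (nxt s)) (?g d)))) ` (- {Slope 0}))"
    unfolding F1_X3_eq[OF nxt_less[OF s]] by (subst (1) g[symmetric]) (simp only: image_image)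
  show ?thesis unfolding e F1_X3_eq[OF s]
  proof (rule fX3_closure_image)
    fix d assume "d \<in> - {Slope 0}"
    then show "rel (Base (Base (Exc (pnt \<delta> c s) d))) (Base (Base (Exc (pnt \<delta> c (nxt s)) (?g d))))"
      using rel.F1_slope[OF s] rel.F1_vertical[OF s] by (cases d) simp_all
  qed
qed

lemma image_F2:
  assumes s: "s < n - 1"
  shows "fX3 n m \<delta> c `` F2_X3 n m \<delta> c s = F2_X3 n m \<delta> c (Suc s)"
proof -
  have s': "s < n" "nxt s = Suc s" "Suc s < n" using s by (auto simp: nxt_def)
  let ?g = "\<lambda>d. case d of Slope e \<Rightarrow> Slope (step s e) | Vertical \<Rightarrow> Vertical"
  let ?T = "\<lambda>s. {d. Exc (pE \<delta> c s) d \<notin> Z3 n m \<delta> c}"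
  have iff: "Exc (pE \<delta> c (Suc s)) (Slope (step s e)) \<in> Z3 n m \<delta> c \<longleftrightarrow> Exc (pE \<delta> c s) (Slope e) \<in> Z3 n m \<delta> c" for e
    using step_in_Z3_iff[OF s'(1), of e] s by (simp add: s' Qp_def)
  have g: "?g ` ?T s = ?T (Suc s)"
  proof (intro set_eqI iffI)
    fix d assume "d \<in> ?g ` ?T s"
    then show "d \<in> ?T (Suc s)" using iff Vertical_notin_Z3 by (auto split: dir.splits)
  next
    fix d assume d: "d \<in> ?T (Suc s)"
    show "d \<in> ?g ` ?T s"
    proof (cases d)
      case (Slope e')
      obtain e where "e' = step s e" using step_onto by blast
      then show ?thesis using d Slope iff by (intro image_eqI[of _ _ "Slope e"]) simp_all
    next
      case Vertical
      then show ?thesis using Vertical_notin_Z3 by (intro image_eqI[of _ _ Vertical]) simp_all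
    qed
  qed
  have e: "F2_X3 n m \<delta> c (Suc s) = cl ((\<lambda>d. Base (Exc (pE \<delta> c (Suc s)) (?g d))) ` ?T s)"
    unfolding F2_X3_eq[OF s'(3)] by (subst (1) g[symmetric]) (simp only: image_image)
  show ?thesis unfolding e F2_X3_eq[OF s'(1)]
  proof (rule fX3_closure_image)
    fix d assume "d \<in> ?T s"
    then show "rel (Base (Exc (pE \<delta> c s) d)) (Base (Exc (pE \<delta> c (Suc s)) (?g d)))"
      using rel.F2_slope[OF s'(1)] rel.F2_vertical[OF s'(1)] s
      by (cases d) (simp_all add: s' Qp_def)
  qed
qed

text \<open>
  The images of the generic points of the last fiber differ from the generic points of the first one by two
  points: the point with \<open>\<eta>\<close> = 0 of the last fiber goes to the third fiber over \<open>\<eta>\<close> = 1, and \<open>\<eta>\<close> = 0 on the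
  first fiber comes from a third fiber.  Both points are limits of the common ones.
\<close>

lemma image_F2_last: "fX3 n m \<delta> c `` F2_X3 n m \<delta> c (n - 1) = F2_X3 n m \<delta> c 0"
proof -
  interpret X3: complex_surface "X3 n m \<delta> c" by (rule complex_surface_X3)
  let ?r = "n - 1"
  let ?T = "\<lambda>s. {d. Exc (pE \<delta> c s) d \<notin> Z3 n m \<delta> c}"
  let ?D = "(\<lambda>d. Base (Exc (pE \<delta> c 0) d)) ` (?T 0 - {Slope 0})"
  let ?g = "\<lambda>d. case d of Slope e \<Rightarrow> (if e = 0 then Exc (Q 0) Vertical else Base (Qp 0 (step ?r e)))
    | Vertical \<Rightarrow> Base (Exc (pE \<delta> c 0) Vertical)"
  have nx: "nxt ?r = 0" by (simp add: nxt_def)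
  have st: "step (n - Suc 0) e = 1 - \<delta> * e" for e by (simp add: step_def)
  have rT: "Slope 0 \<in> ?T ?r"
    using ev_nonzero last_nz by (auto simp: Qp_in_Z3_iff Qp_def[symmetric])
  have zT: "Slope 0 \<in> ?T 0"
    using ev_nonzero last_nz by (auto simp: Qp_in_Z3_iff Qp_def[symmetric])
  have iff: "Qp 0 (step ?r e) \<in> Z3 n m \<delta> c \<longleftrightarrow> e = 0 \<or> (Qp ?r e \<in> Z3 n m \<delta> c \<and> e \<noteq> 1 / \<delta>)" for e
    using step_in_Z3_iff[OF last_nz(2), of e] unfolding nx by simp
  have lastZ: "Qp ?r (1 / \<delta>) \<in> Z3 n m \<delta> c" using Q_in_Z3[OF last_index(3)] by (simp add: Q_def last_index)
  have img: "?g ` ?T ?r = insert (Exc (Q 0) Vertical) ?D"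
  proof (intro set_eqI iffI)
    fix x assume "x \<in> ?g ` ?T ?r"
    then obtain d where d: "d \<in> ?T ?r" "x = ?g d" by (elim imageE)
    show "x \<in> insert (Exc (Q 0) Vertical) ?D"
    proof (cases d)
      case (Slope e)
      show ?thesis
      proof (cases "e = 0")
        case True
        then show ?thesis using d Slope by simp
      next
        case False
        have "Qp ?r e \<notin> Z3 n m \<delta> c" using d(1) Slope by (simp add: Qp_def)
        moreover from this have "e \<noteq> 1 / \<delta>" using lastZ by blast
        then have "1 - \<delta> * e \<noteq> 0" using d0 by (auto simp: field_simps)
        ultimately have "Qp 0 (step ?r e) \<notin> Z3 n m \<delta> c" "step ?r e \<noteq> 0"
          using iff[of e] False by (simp_all add: st)
        then have "x \<in> ?D" using d(2) Slope False
          by (intro image_eqI[of _ _ "Slope (step ?r e)"]) (simp_all add: Qp_def)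
        then show ?thesis by blast
      qed
    next
      case Vertical
      then have "x \<in> ?D" using d(2) Vertical_notin_Z3 by (intro image_eqI[of _ _ Vertical]) simp_all
      then show ?thesis by blast
    qed
  next
    fix x assume "x \<in> insert (Exc (Q 0) Vertical) ?D"
    then consider "x = Exc (Q 0) Vertical" | d where "d \<in> ?T 0 - {Slope 0}" "x = Base (Exc (pE \<delta> c 0) d)"
      by blast
    then show "x \<in> ?g ` ?T ?r"
    proof cases
      case 1
      then show ?thesis using rT by (intro image_eqI[of _ _ "Slope 0"]) simp_all
    next
      case (2 d)
      show ?thesis
      proof (cases d)
        case (Slope e')
        obtain e where e: "e' = step ?r e" using step_onto by blast
        have "Qp 0 (step ?r e) \<notin> Z3 n m \<delta> c" "step ?r e \<noteq> 0" using 2 Slope e by (simp_all add: Qp_def)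
        then have "e \<noteq> 1 / \<delta>" using d0 by (auto simp: st)
        then have "e \<noteq> 0" "Qp ?r e \<notin> Z3 n m \<delta> c"
          using iff[of e] \<open>Qp 0 (step ?r e) \<notin> Z3 n m \<delta> c\<close> by blast+
        then show ?thesis using 2 Slope e
          by (intro image_eqI[of _ _ "Slope e"]) (simp_all add: Qp_def)
      next
        case Vertical
        then show ?thesis using 2 Vertical_notin_Z3 by (intro image_eqI[of _ _ Vertical]) simp_all
      qed
    qed
  qed
  have z0: "(\<lambda>d. Base (Exc (pE \<delta> c 0) d)) ` ?T 0 = insert (Base (Qp 0 0)) ?D"
    using zT by (auto simp: Qp_def)
  have DI: "Base (Qp 0 e) \<in> ?D" if "Qp 0 e \<notin> Z3 n m \<delta> c" "e \<noteq> 0" for e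
    using that by (intro image_eqI[of _ _ "Slope e"]) (simp_all add: Qp_def)
  have lim1: "Base (Qp 0 0) \<in> cl ?D"
  proof -
    let ?P = "bp_base (Z3 n m \<delta> c) (UNIV, psi2 \<delta> c 0)"
    have P: "?P \<in> params (X3 n m \<delta> c)"
      unfolding X3_def by (rule B3.bp_base_params[OF psi2_params[OF last_nz(3)]])
    have psi: "psi2 \<delta> c 0 (0, h) = Qp 0 h" for h by (simp add: psi2_def Qp_def)
    have z: "(0, 0) \<in> fst ?P" using zT by (simp add: bp_base_def psi Qp_def)
    have t: "((\<lambda>h. (0, h)) \<longlongrightarrow> (0, 0)) (at (0::complex))" by (intro tendsto_intros)
    have "eventually (\<lambda>h. (0, h) \<in> fst ?P) (at 0)"
      by (rule topological_tendstoD[OF t params_open[OF P] z])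
    then have ev: "eventually (\<lambda>h. snd ?P (0, h) \<in> ?D) (at 0)"
      using eventually_neq_at_within[of 0 0 UNIV]
      by eventually_elim (simp add: bp_base_def psi DI del: image_iff)
    have "snd ?P (0, 0) \<in> cl ?D" by (rule X3.closure_of_chartI[OF P t z ev])
    then show ?thesis by (simp add: bp_base_def psi)
  qed
  have lim2: "Exc (Q 0) Vertical \<in> cl ?D"
  proof -
    let ?P = "bp_vert (X2 n \<delta> c) (Z3 n m \<delta> c) (Q 0)"
    have P: "?P \<in> params (X3 n m \<delta> c)"
      unfolding X3_def by (rule B3.bp_vert_params[OF Q_in_Z3[OF Q_0_neq]])
    have z: "(0, 0) \<in> fst ?P" "snd ?P (0, 0) = Exc (Q 0) Vertical"
      using B3.Exc_vert[OF Q_in_Z3[OF Q_0_neq], of 0] by simp_all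
    have psi: "psi2 \<delta> c 0 (0, h) = Qp 0 h" for h by (simp add: psi2_def Qp_def)
    have t: "((\<lambda>h. (0, h)) \<longlongrightarrow> (0, 0)) (at (0::complex))" by (intro tendsto_intros)
    \<comment> \<open>The value -1 is cut out because it would give \<open>\<eta>\<close> = 0.\<close>
    have o: "open (fst ?P \<inter> {z. snd z \<noteq> - 1})" using params_open[OF P] open_snd_neq by (rule open_Int)
    have "eventually (\<lambda>h. (0, h) \<in> fst ?P \<inter> {z. snd z \<noteq> - 1}) (at 0)"
      by (rule topological_tendstoD[OF t o]) (use z in simp)
    then have ev: "eventually (\<lambda>h. snd ?P (0, h) \<in> ?D) (at 0)"
      using eventually_neq_at_within[of 0 0 UNIV]
    proof eventually_elim
      case (elim h)
      then have "Qp 0 (1 + h) \<notin> Z3 n m \<delta> c"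
        by (simp add: bp_vert_def chart_Q center_Q vert_map_def psi)
      moreover have "1 + h \<noteq> 0" using elim by (auto simp: add_eq_0_iff)
      ultimately have "Base (Qp 0 (1 + h)) \<in> ?D" by (rule DI)
      moreover have "snd ?P (0, h) = Base (Qp 0 (1 + h))"
        using elim by (simp add: bp_vert_def chart_Q center_Q vert_map_def psi)
      ultimately show ?case by (simp only:)
    qed
    have "snd ?P (0, 0) \<in> cl ?D" by (rule X3.closure_of_chartI[OF P t z(1) ev])
    then show ?thesis by (simp only: z)
  qed
  have "fX3 n m \<delta> c `` F2_X3 n m \<delta> c ?r = cl (?g ` ?T ?r)"
    unfolding F2_X3_eq[OF last_nz(2)]
  proof (rule fX3_closure_image)
    fix d assume d: "d \<in> ?T ?r"
    show "rel (Base (Exc (pE \<delta> c ?r) d)) (?g d)"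
    proof (cases d)
      case (Slope e)
      then show ?thesis
        using rel.F2_zero rel.F2_slope[OF last_nz(2), of e] d nx by (simp add: Qp_def)
    next
      case Vertical
      then show ?thesis using rel.F2_vertical[OF last_nz(2)] nx by simp
    qed
  qed
  also have "\<dots> = cl ?D" unfolding img by (rule closure_insert_limit[OF lim2])
  also have "\<dots> = F2_X3 n m \<delta> c 0"
    unfolding F2_X3_eq[OF last_nz(3)] z0 by (rule closure_insert_limit[OF lim1, symmetric])
  finally show ?thesis .
qed

lemma image_Sigma2: "fX3 n m \<delta> c `` lift3 n m \<delta> c Sigma2 = exc_fiber {Q 0}"
proof -
  have "Sigma2 \<subseteq> pts P2" by (auto simp: Sigma2_def intro!: hom_in_P2)
  then have "lift3 n m \<delta> c Sigma2 = cl (range (\<lambda>x. emb3 (x, 0)))"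
    by (simp only: lift3_eq Sigma2_minus image_image)
  then have "fX3 n m \<delta> c `` lift3 n m \<delta> c Sigma2 = cl (range (\<lambda>x. Exc (Q 0) (Slope (- \<delta> * x))))"
    using fX3_closure_image[of UNIV "\<lambda>x. emb3 (x, 0)"] rel.line by simp
  also have "range (\<lambda>x. Exc (Q 0) (Slope (- \<delta> * x))) = range (\<lambda>l. Exc (Q 0) (Slope l))"
  proof (intro set_eqI iffI)
    fix y assume "y \<in> range (\<lambda>l. Exc (Q 0) (Slope l))"
    then obtain l where "y = Exc (Q 0) (Slope l)" by blast
    then show "y \<in> range (\<lambda>x. Exc (Q 0) (Slope (- \<delta> * x)))"
      using d0 by (intro image_eqI[of _ _ "- l / \<delta>"]) simp_all
  qed blast
  finally show ?thesis by (simp only: closure_slopes[OF Q_0_neq])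
qed

lemma image_F3:
  assumes i: "i < last_index"
  shows "fX3 n m \<delta> c `` exc_fiber {Q i} = exc_fiber {Q (Suc i)}"
proof -
  have "i < n * m" "Suc i < n * m" using i last_index(1) by simp_all
  let ?k = "scale3 (i mod n) (ev i)"
  have k: "?k \<noteq> 0" using scale3_nz[OF index_less] ev_regular[OF i] by blast
  have "fX3 n m \<delta> c `` exc_fiber {Q i} = cl (range (\<lambda>l. Exc (Q (Suc i)) (Slope (?k * l))))"
    unfolding closure_slopes[OF \<open>i < n * m\<close>, symmetric]
    by (rule fX3_closure_image) (rule rel.F3_slope[OF i])
  also have "range (\<lambda>l. Exc (Q (Suc i)) (Slope (?k * l))) = range (\<lambda>l. Exc (Q (Suc i)) (Slope l))"
  proof (intro set_eqI iffI)
    fix y assume "y \<in> range (\<lambda>l. Exc (Q (Suc i)) (Slope l))"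
    then obtain l where "y = Exc (Q (Suc i)) (Slope l)" by blast
    then show "y \<in> range (\<lambda>l. Exc (Q (Suc i)) (Slope (?k * l)))"
      using k by (intro image_eqI[of _ _ "l / ?k"]) simp_all
  qed blast
  finally show ?thesis by (simp only: closure_slopes[OF \<open>Suc i < n * m\<close>])
qed

lemma image_last: "fX3 n m \<delta> c `` exc_fiber {Q last_index} = lift3 n m \<delta> c Sigma1"
proof -
  have "Sigma1 \<subseteq> pts P2" by (auto simp: Sigma1_def intro!: hom_in_P2)
  note l = lift3_eq[OF this]
  have s1: "Sigma1 - Z1 n \<delta> c = range (\<lambda>l. emb (0, - (\<delta>\<^sup>2 * l)))"
  proof (intro set_eqI iffI)
    fix P assume "P \<in> Sigma1 - Z1 n \<delta> c"
    then obtain t y where P: "P = hom t 0 y" "(t, y) \<noteq> (0, 0)" "P \<notin> Z1 n \<delta> c" by (auto simp: Sigma1_def)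
    have "t \<noteq> 0"
    proof
      assume "t = 0"
      then have "P = hom 0 0 1" unfolding P(1) hom_eq_iff by (intro exI[of _ "1 / y"]) (use P in auto)
      also have "\<dots> = pnt \<delta> c 0" by (simp add: pnt_def)
      finally show False using P(3) pnt_in_Z1[OF last_nz(3)] by simp
    qed
    then have "P = emb (0, y / t)" unfolding P(1) emb_eq hom_eq_iff by (intro exI[of _ "1 / t"]) simp
    then show "P \<in> range (\<lambda>l. emb (0, - (\<delta>\<^sup>2 * l)))"
      using d0 by (intro image_eqI[of _ _ "- (y / t) / \<delta>\<^sup>2"]) simp_all
  next
    fix P assume "P \<in> range (\<lambda>l. emb (0, - (\<delta>\<^sup>2 * l)))"
    then obtain l where p: "P = emb (0, - (\<delta>\<^sup>2 * l))" by blast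
    then have "P \<in> Sigma1"
      unfolding Sigma1_def mem_Collect_eq by (intro exI[of _ 1] exI[of _ "- (\<delta>\<^sup>2 * l)"]) (simp add: emb_eq)
    then show "P \<in> Sigma1 - Z1 n \<delta> c" using p emb_notin_Z1 by simp
  qed
  have "fX3 n m \<delta> c `` exc_fiber {Q last_index} = cl (range (\<lambda>l. emb3 (0, - (\<delta>\<^sup>2 * l))))"
    unfolding closure_slopes[OF last_index(3), symmetric]
    by (rule fX3_closure_image) (rule rel.last_slope)
  then show ?thesis unfolding l s1 by (simp only: image_image)
qed

lemma F3_Q:
  assumes "1 \<le> l" "l \<le> m" "s < n"
  shows "F3 n \<delta> c s l = exc_fiber {Q ((l - 1) * n + s)}" "(l - 1) * n + s \<le> last_index"
    "(l - 1) * n + s = last_index \<longleftrightarrow> l = m \<and> s = n - 1"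
proof -
  obtain k where k: "l = Suc k" using assms by (cases l) auto
  have 1: "k * n + s < Suc k * n" using assms by simp
  have "Suc k * n \<le> m * n" using assms k by (intro mult_right_mono) simp_all
  then have 2: "k * n + s < n * m" using 1 by (simp add: mult.commute)
  then show "F3 n \<delta> c s l = exc_fiber {Q ((l - 1) * n + s)}" by (simp add: F3_def k orbit_Q)
  show "(l - 1) * n + s \<le> last_index" using 2 last_index(1) by (simp add: k)
  show "(l - 1) * n + s = last_index \<longleftrightarrow> l = m \<and> s = n - 1"
  proof
    assume "(l - 1) * n + s = last_index"
    then have e: "k * n + s + 1 = m * n" using last_index(1) by (simp add: k mult.commute)
    then have "m * n \<le> Suc k * n" using 1 by simp
    then have "0 < n \<longrightarrow> m \<le> Suc k" by (simp only: mult_le_cancel2)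
    then have "m \<le> Suc k" using n3 by simp
    then have "m = Suc k" using assms k by simp
    then show "l = m \<and> s = n - 1" using e k by simp
  next
    assume *: "l = m \<and> s = n - 1"
    then have "m = Suc k" "Suc s = n" using k n3 by simp_all
    then have "Suc (k * n + s) = n * m" by (simp add: mult.commute)
    then show "(l - 1) * n + s = last_index" using last_index(1) k by simp
  qed
qed

end

section \<open>The recurrence for the centers\<close>

context henon
begin


text \<open>
  With the sign reversed on the fibers over [0:0:1], the recurrence of the centers becomes
  \<open>eps (i + 1) = \<delta> eps i \<plusminus> 1\<close>, where the sign is negative exactly when n divides i + 1.
\<close>

definition eps :: "nat \<Rightarrow> complex"
  where "eps i = (if i mod n = 0 then - ev i else ev i)"

lemma eps_0: "eps 0 = - 1"
  by (simp add: eps_def)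

lemma eps_Suc: "eps (Suc i) = \<delta> * eps i + (if Suc i mod n = 0 then - 1 else 1)"
proof -
  have r: "i mod n < n" using n3 by simp
  consider "i mod n = n - 1" | "i mod n < n - 1" using r by linarith
  then show ?thesis
  proof cases
    case 1
    then have "Suc i mod n = 0" using n3 by (simp add: mod_Suc)
    then show ?thesis using 1 last_nz by (simp add: eps_def step_def)
  next
    case 2
    then have "Suc i mod n = Suc (i mod n)" by (simp add: mod_Suc)
    then show ?thesis using 2 by (simp add: eps_def step_def)
  qed
qed

text \<open>
  The inhomogeneous terms have period n, so the difference \<open>eps (i + n) - eps i\<close> satisfies the homogeneous
  recurrence, that is, it is a geometric sequence.
\<close>

lemma eps_add_period: "eps (i + n) = eps i + \<delta> ^ Suc i * eps (n - 1)"
proof (induction i)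
  case 0
  have "eps (Suc (n - 1)) = \<delta> * eps (n - 1) - 1" using n3 by (subst eps_Suc) simp
  then show ?case using n3 by (simp add: eps_0)
next
  case (Suc i)
  have "eps (Suc i + n) = \<delta> * eps (i + n) + (if Suc (i + n) mod n = 0 then - 1 else 1)"
    using eps_Suc[of "i + n"] by simp
  also have "Suc (i + n) mod n = Suc i mod n" by (metis add_Suc mod_add_self2)
  finally show ?case by (simp add: Suc.IH eps_Suc algebra_simps)
qed

lemma eps_add_periods:
  "(\<delta> ^ n - 1) * (eps (i + n * r) - eps i) = \<delta> ^ Suc i * eps (n - 1) * (\<delta> ^ (n * r) - 1)"
proof (induction r)
  case 0
  show ?case by simp
next
  case (Suc r)
  have "eps (i + n * Suc r) = eps (i + n * r) + \<delta> ^ Suc (i + n * r) * eps (n - 1)"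
    using eps_add_period[of "i + n * r"] by (simp add: ac_simps)
  then have "(\<delta> ^ n - 1) * (eps (i + n * Suc r) - eps i) =
      (\<delta> ^ n - 1) * (eps (i + n * r) - eps i) + (\<delta> ^ n - 1) * (\<delta> ^ Suc (i + n * r) * eps (n - 1))"
    by (simp add: algebra_simps)
  also have "\<dots> = \<delta> ^ Suc i * eps (n - 1) * (\<delta> ^ (n * Suc r) - 1)"
    unfolding Suc.IH by (simp add: power_add algebra_simps)
  finally show ?case .
qed

lemma eps_first_period: "i < n \<Longrightarrow> (\<delta> - 1) * eps i = - (\<delta> ^ Suc i) + 2 * \<delta> ^ i - 1"
proof (induction i)
  case 0
  show ?case by (simp add: eps_0)
next
  case (Suc i)
  then have "(\<delta> - 1) * eps (Suc i) = \<delta> * ((\<delta> - 1) * eps i) + (\<delta> - 1)"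
    by (simp add: eps_Suc algebra_simps)
  also have "(\<delta> - 1) * eps i = - (\<delta> ^ Suc i) + 2 * \<delta> ^ i - 1"
    using Suc by simp
  also have "\<delta> * (- (\<delta> ^ Suc i) + 2 * \<delta> ^ i - 1) + (\<delta> - 1) = - (\<delta> ^ Suc (Suc i)) + 2 * \<delta> ^ Suc i - 1"
    by (simp add: algebra_simps)
  finally show ?case .
qed

text \<open>
  By the two preceding lemmas, \<open>eps (n m) = - chi n m \<delta>\<close>: the root condition says that the orbit of the
  contracted line arrives at the point of indeterminacy.  The first claim follows since
  \<open>eps (n - 1) = 0\<close> would make the sequence periodic, and \<open>eps 0 = -1\<close>.
\<close>

lemma eps_root:
  assumes nru: "\<not> root_of_unity \<delta>" and root: "chi n m \<delta> = 0"
  shows "eps (n - 1) \<noteq> 0" "eps (n * m) = 0"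
proof -
  have nru': "\<delta> ^ k \<noteq> 1" if "1 \<le> k" for k using nru that by (auto simp: root_of_unity_def)
  have d1: "\<delta> - 1 \<noteq> 0" "\<delta> ^ n - 1 \<noteq> 0" using nru'[of 1] nru'[of n] n3 by auto
  let ?T = "eps (n - 1)"
  have T: "\<delta> ^ n - 2 * \<delta> ^ (n - 1) + 1 = - ((\<delta> - 1) * ?T)"
    using eps_first_period[of "n - 1"] n3 by simp
  have "\<delta> * (\<delta> ^ (n * m) - 1) * (- ((\<delta> - 1) * ?T)) / ((\<delta> ^ n - 1) * (\<delta> - 1)) = - 1"
    using root unfolding chi_def T by (simp add: eq_neg_iff_add_eq_0)
  then have "\<delta> * (\<delta> ^ (n * m) - 1) * (- ((\<delta> - 1) * ?T)) = - ((\<delta> ^ n - 1) * (\<delta> - 1))"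
    using d1 by (simp add: divide_eq_eq)
  then have "(\<delta> - 1) * (\<delta> * (\<delta> ^ (n * m) - 1) * ?T) = (\<delta> - 1) * (\<delta> ^ n - 1)"
    by (simp add: algebra_simps)
  then have key: "\<delta> * ?T * (\<delta> ^ (n * m) - 1) = \<delta> ^ n - 1"
    using d1(1) by (simp add: mult_ac)
  then show "?T \<noteq> 0" using d1(2) by auto
  have "(\<delta> ^ n - 1) * (eps (n * m) - eps 0) = (\<delta> ^ n - 1) * 1"
    using eps_add_periods[of 0 m] key by simp
  then have "eps (n * m) - eps 0 = 1" using d1(2) by (metis mult_left_cancel)
  then show "eps (n * m) = 0" by (simp add: eps_0)
qed

text \<open>
  Within a residue class the sequence moves along a geometric progression whose ratio is not a root of
  unity.
\<close>

lemma eps_inj: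
  assumes nru: "\<not> root_of_unity \<delta>" and T: "eps (n - 1) \<noteq> 0" and ij: "i < j" "i mod n = j mod n"
  shows "eps i \<noteq> eps j"
proof
  assume e: "eps i = eps j"
  have "n dvd j - i" using ij by (metis mod_eq_dvd_iff_nat less_imp_le_nat)
  then obtain r where r: "j = i + n * r" using ij by (metis dvdE le_add_diff_inverse less_imp_le_nat)
  then have "1 \<le> n * r" using ij by simp
  then have "\<delta> ^ (n * r) \<noteq> 1" using nru by (auto simp: root_of_unity_def)
  then show False using eps_add_periods[of i r] e r d0 T by simp
qed

lemma henon_rootI:
  assumes nru: "\<not> root_of_unity \<delta>" and root: "chi n m \<delta> = 0" and m: "1 \<le> m"
  shows "henon_root n \<delta> c m"
proof -
  note T = eps_root(1)[OF nru root] and z = eps_root(2)[OF nru root]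
  note inj = eps_inj[OF nru T]
  have last: "eps (Suc i) = \<delta> * ev i - 1" "Suc i mod n = 0" if "i mod n = n - 1" for i
  proof -
    show S: "Suc i mod n = 0" using that n3 by (simp add: mod_Suc)
    show "eps (Suc i) = \<delta> * ev i - 1" using eps_Suc[of i] S that last_nz by (simp add: eps_def)
  qed
  have "0 < n * m" using n3 m by simp
  show ?thesis
  proof (unfold_locales)
    show "1 \<le> m" by fact
    obtain k where k: "m = Suc k" using m by (cases m) auto
    have "n * m - 1 = n * k + (n - 1)" using n3 by (simp add: k)
    then have "(n * m - 1) mod n = (n - 1) mod n" by (simp only: mod_mult_self4)
    then have "(n * m - 1) mod n = n - 1" using n3 by simp
    from last(1)[OF this] have "\<delta> * ev (n * m - 1) = 1" using z \<open>0 < n * m\<close> by simp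
    then show "ev (n * m - 1) = 1 / \<delta>" using d0 by (simp add: field_simps)
  next
    fix i assume i: "i < n * m" "i mod n = 0 \<or> i mod n = n - 1"
    show "ev i \<noteq> 0"
    proof
      assume e: "ev i = 0"
      from i(2) show False
      proof
        assume "i mod n = 0"
        then show False using inj[of i "n * m"] i(1) e z by (simp add: eps_def)
      next
        assume "i mod n = n - 1"
        then show False using last[of i] inj[of 0 "Suc i"] e by (simp add: eps_0)
      qed
    qed
  next
    fix i j assume ij: "i < n * m" "j < n * m" "i mod n = j mod n" "ev i = ev j"
    then have "eps i = eps j" by (simp add: eps_def)
    then show "i = j" using inj[of i j] inj[of j i] ij(3) by (metis linorder_neqE_nat)
  qed
qed

end

section \<open>The centers on the line at infinity\<close>

text \<open>
  With \<open>\<theta> = j \<pi> / n\<close>, the recurrence of omega is solved by \<open>\<rho> sin ((s + 1) \<theta>) / sin (s \<theta>)\<close>.  As j is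
  prime to n, the sines do not vanish for 0 < s < n, but for s = n; and two values are distinct because
  \<open>sin ((r + 1) \<theta>) sin (s \<theta>) - sin ((s + 1) \<theta>) sin (r \<theta>) = sin ((s - r) \<theta>) sin \<theta>\<close>.
\<close>

lemma omega_trig:
  assumes n3: "3 \<le> n" and j: "1 \<le> j" "j \<le> n - 1" "gcd j n = 1"
    and sq: "\<rho> ^ 2 = \<delta>" and d0: "\<delta> \<noteq> 0" and c: "c = 2 * \<rho> * of_real (cos (real j * pi / real n))"
  shows "1 \<le> s \<Longrightarrow> s < n - 1 \<Longrightarrow> omega \<delta> c s \<noteq> 0" "omega \<delta> c (n - 1) = 0"
    "inj_on (omega \<delta> c) {1..<n}"
proof -
  define \<theta> where "\<theta> = real j * pi / real n"
  define S where "S s = complex_of_real (sin (real s * \<theta>))" for s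
  have r0: "\<rho> \<noteq> 0" using sq d0 by auto
  have S_nz: "S s \<noteq> 0" if s: "1 \<le> s" "s < n" for s
  proof
    assume "S s = 0"
    then have "sin (real s * \<theta>) = 0" by (simp add: S_def)
    then obtain i :: int where "real s * \<theta> = of_int i * pi" by (auto simp: sin_zero_iff_int2)
    then have "real s * real j = of_int i * real n" using n3 by (simp add: \<theta>_def field_simps)
    then have "int s * int j = i * int n" by (metis of_int_eq_iff of_int_mult of_int_of_nat_eq)
    then have "int n dvd int (s * j)" by simp
    then have "n dvd s * j" by (simp only: int_dvd_int_iff)
    moreover have "coprime n j" using j(3) by (simp add: coprime_iff_gcd_eq_1 gcd.commute)
    ultimately have "n dvd s" by (simp add: coprime_dvd_mult_left_iff)
    then show False using s by (auto dest: dvd_imp_le)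
  qed
  have S_n: "S n = 0" using n3 by (simp add: S_def \<theta>_def)
  have C: "c = 2 * \<rho> * complex_of_real (cos \<theta>)" by (simp add: c \<theta>_def)
  have rec: "S (Suc (Suc s)) = 2 * complex_of_real (cos \<theta>) * S (Suc s) - S s" for s
  proof -
    have "sin (real (Suc (Suc s)) * \<theta>) = 2 * cos \<theta> * sin (real (Suc s) * \<theta>) - sin (real s * \<theta>)"
    proof -
      have a: "real (Suc (Suc s)) * \<theta> = real (Suc s) * \<theta> + \<theta>" "real s * \<theta> = real (Suc s) * \<theta> - \<theta>"
        by (simp_all add: algebra_simps)
      show ?thesis unfolding a sin_add sin_diff by (simp add: algebra_simps)
    qed
    then show ?thesis unfolding S_def by (simp only: of_real_diff of_real_mult of_real_numeral)
  qed
  have om: "omega \<delta> c (Suc s) = \<rho> * S (Suc (Suc s)) / S (Suc s)" if "Suc s < n" for s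
    using that
  proof (induction s)
    case 0
    have "S 0 = 0" by (simp add: S_def)
    then show ?case using S_nz[of 1] 0 rec[of 0] C by (simp add: omega_def)
  next
    case (Suc s)
    have nz: "S (Suc s) \<noteq> 0" "S (Suc (Suc s)) \<noteq> 0" using S_nz Suc.prems by simp_all
    have "omega \<delta> c (Suc (Suc s)) = c - \<delta> / (\<rho> * S (Suc (Suc s)) / S (Suc s))"
      using Suc by (simp add: omega_Suc)
    also have "\<dots> = \<rho> * (2 * complex_of_real (cos \<theta>) * S (Suc (Suc s)) - S (Suc s)) / S (Suc (Suc s))"
      unfolding C sq[symmetric] using nz r0 by (simp add: field_simps power2_eq_square)
    finally show ?case by (simp only: rec[of "Suc s", symmetric])
  qed
  show "omega \<delta> c s \<noteq> 0" if "1 \<le> s" "s < n - 1" for s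
    using om[of "s - 1"] S_nz[of s] S_nz[of "Suc s"] r0 that by simp
  show "omega \<delta> c (n - 1) = 0"
    using om[of "n - 2"] S_n n3 by (simp add: Suc_diff_Suc numeral_2_eq_2)
  show "inj_on (omega \<delta> c) {1..<n}"
  proof (rule linorder_inj_onI)
    show "omega \<delta> c r \<noteq> omega \<delta> c s" if rs: "r < s" "r \<in> {1..<n}" "s \<in> {1..<n}" for r s
    proof
      assume "omega \<delta> c r = omega \<delta> c s"
      then have "\<rho> * S (Suc r) / S r = \<rho> * S (Suc s) / S s"
        using om[of "r - 1"] om[of "s - 1"] rs by simp
      then have "S (Suc r) * S s = S (Suc s) * S r"
        using S_nz[of r] S_nz[of s] rs r0 by (simp add: field_simps)
      moreover have "S (Suc r) * S s - S (Suc s) * S r = S (s - r) * S 1"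
      proof -
        have a: "real (Suc r) * \<theta> = real r * \<theta> + \<theta>" "real (Suc s) * \<theta> = real s * \<theta> + \<theta>"
          "real (s - r) * \<theta> = real s * \<theta> - real r * \<theta>" "real 1 * \<theta> = \<theta>"
          using rs by (simp_all add: algebra_simps of_nat_diff)
        have "sin (real (Suc r) * \<theta>) * sin (real s * \<theta>) - sin (real (Suc s) * \<theta>) * sin (real r * \<theta>) =
            sin (real (s - r) * \<theta>) * sin (real 1 * \<theta>)"
          unfolding a sin_add sin_diff by (simp add: algebra_simps)
        then have "complex_of_real (sin (real (Suc r) * \<theta>) * sin (real s * \<theta>) -
            sin (real (Suc s) * \<theta>) * sin (real r * \<theta>)) =
            complex_of_real (sin (real (s - r) * \<theta>) * sin (real 1 * \<theta>))" by (simp only:)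
        then show ?thesis by (simp only: S_def of_real_diff of_real_mult)
      qed
      ultimately have "S (s - r) * S 1 = 0" by simp
      then show False using S_nz[of "s - r"] S_nz[of 1] rs n3 by auto
    qed
  qed auto
qed

theorem theorem2p3:
  fixes n m j :: nat and \<delta> \<rho> c :: complex
  assumes nm: "(n \<ge> 4 \<and> m \<ge> 1) \<or> (n = 3 \<and> m \<ge> 2)"
    and root: "chi n m \<delta> = 0"
    and norm: "cmod \<delta> = 1"
    and not_ru: "\<not> root_of_unity \<delta>"
    and j: "1 \<le> j" "j \<le> n - 1" "gcd j n = 1"
    and sqrt: "\<rho> ^ 2 = \<delta>"
    and c: "c = 2 * \<rho> * of_real (cos (real j * pi / real n))"
  shows "is_automorphism (X3 n m \<delta> c) (fX3 n m \<delta> c)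
    \<and> fX3 n m \<delta> c `` lift3 n m \<delta> c Sigma0 = lift3 n m \<delta> c Sigma0
    \<and> (\<forall>s<n - 1. fX3 n m \<delta> c `` F1_X3 n m \<delta> c s = F1_X3 n m \<delta> c (s + 1))
    \<and> fX3 n m \<delta> c `` F1_X3 n m \<delta> c (n - 1) = F1_X3 n m \<delta> c 0
    \<and> (\<forall>s<n - 1. fX3 n m \<delta> c `` F2_X3 n m \<delta> c s = F2_X3 n m \<delta> c (s + 1))
    \<and> fX3 n m \<delta> c `` F2_X3 n m \<delta> c (n - 1) = F2_X3 n m \<delta> c 0
    \<and> fX3 n m \<delta> c `` lift3 n m \<delta> c Sigma2 = F3 n \<delta> c 0 1
    \<and> (\<forall>l\<in>{1..m}. \<forall>s<n - 1. fX3 n m \<delta> c `` F3 n \<delta> c s l = F3 n \<delta> c (s + 1) l)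
    \<and> (\<forall>l\<in>{1..<m}. fX3 n m \<delta> c `` F3 n \<delta> c (n - 1) l = F3 n \<delta> c 0 (l + 1))
    \<and> fX3 n m \<delta> c `` F3 n \<delta> c (n - 1) m = lift3 n m \<delta> c Sigma1"
proof -
  have n3: "3 \<le> n" and m1: "1 \<le> m" using nm by auto
  have d0: "\<delta> \<noteq> 0" using norm by auto
  note trig = omega_trig[OF n3 j sqrt d0 c]
  interpret henon n \<delta> c
    by (rule henon.intro[OF n3 d0 trig])
  interpret henon_root n \<delta> c m
    by (rule henon_rootI[OF not_ru root m1])
  have F1: "fX3 n m \<delta> c `` F1_X3 n m \<delta> c s = F1_X3 n m \<delta> c (s + 1)" if "s < n - 1" for s
    using image_F1[of s] that by (simp add: nxt_def)
  have F1': "fX3 n m \<delta> c `` F1_X3 n m \<delta> c (n - 1) = F1_X3 n m \<delta> c 0"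
    using image_F1[OF last_nz(2)] unfolding nxt_def by simp
  have F2: "fX3 n m \<delta> c `` F2_X3 n m \<delta> c s = F2_X3 n m \<delta> c (s + 1)" if "s < n - 1" for s
    using image_F2[OF that] by simp
  have S2: "fX3 n m \<delta> c `` lift3 n m \<delta> c Sigma2 = F3 n \<delta> c 0 1"
    using image_Sigma2 F3_Q(1)[of 1 0] m1 n3 by simp
  have F3: "fX3 n m \<delta> c `` F3 n \<delta> c s l = F3 n \<delta> c (s + 1) l" if "l \<in> {1..m}" "s < n - 1" for l s
  proof -
    have l: "1 \<le> l" "l \<le> m" "s < n" "s + 1 < n" using that by auto
    have "(l - 1) * n + s < last_index" using F3_Q(2,3)[OF l(1-3)] that by linarith
    from image_F3[OF this] show ?thesis
      unfolding F3_Q(1)[OF l(1-3)] F3_Q(1)[OF l(1,2,4)] by simp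
  qed
  have F3': "fX3 n m \<delta> c `` F3 n \<delta> c (n - 1) l = F3 n \<delta> c 0 (l + 1)" if "l \<in> {1..<m}" for l
  proof -
    have l: "1 \<le> l" "l \<le> m" "n - 1 < n" "1 \<le> l + 1" "l + 1 \<le> m" "0 < n" using that n3 by auto
    have "(l - 1) * n + (n - 1) < last_index" using F3_Q(2,3)[OF l(1-3)] that by auto
    moreover have "Suc ((l - 1) * n + (n - 1)) = (l + 1 - 1) * n + 0"
      using l n3 by (cases l) simp_all
    ultimately show ?thesis
      using image_F3[of "(l - 1) * n + (n - 1)"] unfolding F3_Q(1)[OF l(1-3)] F3_Q(1)[OF l(4-6)] by simp
  qed
  have "(m - 1) * n + (n - 1) = last_index" using F3_Q(3)[of m "n - 1"] m1 n3 by simp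
  then have last: "fX3 n m \<delta> c `` F3 n \<delta> c (n - 1) m = lift3 n m \<delta> c Sigma1"
    using image_last F3_Q(1)[of m "n - 1"] m1 n3 by simp
  show ?thesis
    by (intro conjI allI ballI impI automorphism_X3 image_Sigma0 F1 F1' F2 image_F2_last S2 F3 F3' last)
qed

end
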